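(* There is an algorithm which, given a graph $G$, a weight function $c:E(G)\to\mathbb{R}$, a stable set $U\subseteq V(G)$, and non-negative integers $\alpha_v$ and $\beta_v$ for every $v\in U$, decides in polynomial time whether $G$ contains a spanning tree $T$ such that $\alpha_v\le d_T(v)\le\beta_v$ for all $v\in U$, and which, if such a tree exists, finds in polynomial time one of minimum cost, i.e. a spanning tree $T$ of $G$ with $\alpha_v\le d_T(v)\le\beta_v$ for all $v\in U$ that minimizes $\sum_{e\in E(T)}c(e)$ among all spanning trees of $G$ satisfying these degree conditions.
   Context: Graphs are undirected, finite and simple, with vertex set $V(G)$ and edge set $E(G)$. A set $S\subseteq V(G)$ is stable if the subgraph of $G$ induced by $S$ has no edges. $d_T(v)$ denotes the degree of $v$ in $T$. The edge weights are arbitrary real numbers (possibly negative). Polynomial time means polynomial in the size of the input, where an elementary arithmetic operation or comparison on real weights counts as one step. *)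

theory Defs
  imports Complex_Main "HOL-Library.Log_Nat" "HOL-Computational_Algebra.Polynomial"
begin

section \<open>Undirected graphs and degree-constrained spanning trees\<close>

record 'a ugraph =
  uverts :: "'a set"
  uedges :: "'a set set"

definition simple_graph :: "'a ugraph \<Rightarrow> bool" where
  "simple_graph G \<longleftrightarrow>
     finite (uverts G) \<and> (\<forall>e\<in>uedges G. e \<subseteq> uverts G \<and> card e = 2)"

definition induced_edges :: "'a ugraph \<Rightarrow> 'a set \<Rightarrow> 'a set set" where
  "induced_edges G S = {e \<in> uedges G. e \<subseteq> S}"

definition stable_set :: "'a ugraph \<Rightarrow> 'a set \<Rightarrow> bool" where
  "stable_set G S \<longleftrightarrow> S \<subseteq> uverts G \<and> induced_edges G S = {}"

definition degree_in :: "'a ugraph \<Rightarrow> 'a \<Rightarrow> nat" where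
  "degree_in T v = card {e \<in> uedges T. v \<in> e}"

text \<open>The graph without vertices does not count as connected.\<close>

definition connected_graph :: "'a ugraph \<Rightarrow> bool" where
  "connected_graph G \<longleftrightarrow> uverts G \<noteq> {} \<and>
     (\<forall>u\<in>uverts G. \<forall>v\<in>uverts G. (u, v) \<in> {(x, y). {x, y} \<in> uedges G}\<^sup>*)"

definition is_cycle :: "'a ugraph \<Rightarrow> 'a list \<Rightarrow> bool" where
  "is_cycle G xs \<longleftrightarrow> 3 \<le> length xs \<and> distinct xs \<and>
     (\<forall>i<length xs. {xs ! i, xs ! (Suc i mod length xs)} \<in> uedges G)"

definition is_tree :: "'a ugraph \<Rightarrow> bool" where
  "is_tree T \<longleftrightarrow> simple_graph T \<and> connected_graph T \<and> (\<nexists>xs. is_cycle T xs)"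

definition spanning_tree_of :: "'a ugraph \<Rightarrow> 'a ugraph \<Rightarrow> bool" where
  "spanning_tree_of T G \<longleftrightarrow>
     is_tree T \<and> uverts T = uverts G \<and> uedges T \<subseteq> uedges G"

definition feasible_tree ::
    "'a ugraph \<Rightarrow> 'a set \<Rightarrow> ('a \<Rightarrow> nat) \<Rightarrow> ('a \<Rightarrow> nat) \<Rightarrow> 'a ugraph \<Rightarrow> bool" where
  "feasible_tree G U \<alpha> \<beta> T \<longleftrightarrow> spanning_tree_of T G \<and>
     (\<forall>v\<in>U. \<alpha> v \<le> degree_in T v \<and> degree_in T v \<le> \<beta> v)"

definition tree_cost :: "('a set \<Rightarrow> real) \<Rightarrow> 'a ugraph \<Rightarrow> real" where
  "tree_cost c T = (\<Sum>e\<in>uedges T. c e)"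

definition min_cost_feasible_tree ::
    "'a ugraph \<Rightarrow> ('a set \<Rightarrow> real) \<Rightarrow> 'a set \<Rightarrow> ('a \<Rightarrow> nat) \<Rightarrow> ('a \<Rightarrow> nat) \<Rightarrow>
     'a ugraph \<Rightarrow> bool" where
  "min_cost_feasible_tree G c U \<alpha> \<beta> T \<longleftrightarrow> feasible_tree G U \<alpha> \<beta> T \<and>
     (\<forall>T'. feasible_tree G U \<alpha> \<beta> T' \<longrightarrow> tree_cost c T \<le> tree_cost c T')"


section \<open>Programs and their running time\<close>

text \<open>
  Algorithms are programs for a random access machine, written as while programs. The memory
  consists of named arrays of natural numbers and named arrays of reals, with unbounded index
  range; a program mentions finitely many names. Every operation, memory access, test and
  assignment costs one step.

  There is no multiplication on natural numbers: with unit cost, repeated squaring would give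
  numbers of exponential length in polynomially many steps. With addition and truncated
  subtraction only, each step lengthens the largest number by at most a constant, so that
  polynomially many steps amount to polynomial time on a Turing machine as far as no reals are
  involved. Reals admit exact field operations (division by zero yields zero) and comparison at
  unit cost. A real can influence the natural numbers only through the outcome of comparisons,
  and the only real constants are integers, so that a program cannot contain hidden information.
\<close>

type_synonym name = string

type_synonym state = "(name \<Rightarrow> nat \<Rightarrow> nat) \<times> (name \<Rightarrow> nat \<Rightarrow> real)"

datatype nexp =
    NConst nat
  | NCell name nexp
  | NAdd nexp nexp
  | NSub nexp nexp

datatype rexp =
    RConst int
  | RCell name nexp
  | RAdd rexp rexp
  | RSub rexp rexp
  | RMul rexp rexp
  | RDiv rexp rexp

datatype bexp =
    NLess nexp nexp
  | RLess rexp rexp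
  | BNot bexp
  | BAnd bexp bexp

datatype com =
    Skip
  | NAssign name nexp nexp
  | RAssign name nexp rexp
  | Seq com com
  | Cond bexp com com
  | While bexp com

fun nval :: "nexp \<Rightarrow> state \<Rightarrow> nat" where
  "nval (NConst k) s = k"
| "nval (NCell x a) s = fst s x (nval a s)"
| "nval (NAdd a b) s = nval a s + nval b s"
| "nval (NSub a b) s = nval a s - nval b s"

fun rval :: "rexp \<Rightarrow> state \<Rightarrow> real" where
  "rval (RConst k) s = of_int k"
| "rval (RCell x a) s = snd s x (nval a s)"
| "rval (RAdd a b) s = rval a s + rval b s"
| "rval (RSub a b) s = rval a s - rval b s"
| "rval (RMul a b) s = rval a s * rval b s"
| "rval (RDiv a b) s = rval a s / rval b s"

fun bval :: "bexp \<Rightarrow> state \<Rightarrow> bool" where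
  "bval (NLess a b) s \<longleftrightarrow> nval a s < nval b s"
| "bval (RLess a b) s \<longleftrightarrow> rval a s < rval b s"
| "bval (BNot b) s \<longleftrightarrow> \<not> bval b s"
| "bval (BAnd a b) s \<longleftrightarrow> bval a s \<and> bval b s"

fun nsteps :: "nexp \<Rightarrow> nat" where
  "nsteps (NConst k) = 1"
| "nsteps (NCell x a) = 1 + nsteps a"
| "nsteps (NAdd a b) = 1 + nsteps a + nsteps b"
| "nsteps (NSub a b) = 1 + nsteps a + nsteps b"

fun rsteps :: "rexp \<Rightarrow> nat" where
  "rsteps (RConst k) = 1"
| "rsteps (RCell x a) = 1 + nsteps a"
| "rsteps (RAdd a b) = 1 + rsteps a + rsteps b"
| "rsteps (RSub a b) = 1 + rsteps a + rsteps b"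
| "rsteps (RMul a b) = 1 + rsteps a + rsteps b"
| "rsteps (RDiv a b) = 1 + rsteps a + rsteps b"

fun bsteps :: "bexp \<Rightarrow> nat" where
  "bsteps (NLess a b) = 1 + nsteps a + nsteps b"
| "bsteps (RLess a b) = 1 + rsteps a + rsteps b"
| "bsteps (BNot b) = 1 + bsteps b"
| "bsteps (BAnd a b) = 1 + bsteps a + bsteps b"

definition nupd :: "name \<Rightarrow> nat \<Rightarrow> nat \<Rightarrow> state \<Rightarrow> state" where
  "nupd x i k s = ((fst s)(x := (fst s x)(i := k)), snd s)"

definition rupd :: "name \<Rightarrow> nat \<Rightarrow> real \<Rightarrow> state \<Rightarrow> state" where
  "rupd x i r s = (fst s, (snd s)(x := (snd s x)(i := r)))"

text \<open>\<open>exec p s t s'\<close>: started in \<open>s\<close>, program \<open>p\<close> halts in \<open>s'\<close> after \<open>t\<close> steps.\<close>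

inductive exec :: "com \<Rightarrow> state \<Rightarrow> nat \<Rightarrow> state \<Rightarrow> bool" where
  Skip: "exec Skip s 1 s"
| NAssign: "exec (NAssign x a b) s (1 + nsteps a + nsteps b) (nupd x (nval a s) (nval b s) s)"
| RAssign: "exec (RAssign x a r) s (1 + nsteps a + rsteps r) (rupd x (nval a s) (rval r s) s)"
| Seq: "exec p s t s' \<Longrightarrow> exec q s' t' s'' \<Longrightarrow> exec (Seq p q) s (t + t') s''"
| CondTrue: "bval b s \<Longrightarrow> exec p s t s' \<Longrightarrow> exec (Cond b p q) s (1 + bsteps b + t) s'"
| CondFalse: "\<not> bval b s \<Longrightarrow> exec q s t s' \<Longrightarrow> exec (Cond b p q) s (1 + bsteps b + t) s'"
| WhileFalse: "\<not> bval b s \<Longrightarrow> exec (While b p) s (1 + bsteps b) s"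
| WhileTrue: "bval b s \<Longrightarrow> exec p s t s' \<Longrightarrow> exec (While b p) s' t' s'' \<Longrightarrow>
    exec (While b p) s (1 + bsteps b + t + t') s''"

inductive_cases Skip_elim: "exec Skip s t s'"
inductive_cases NAssign_elim: "exec (NAssign x a b) s t s'"
inductive_cases RAssign_elim: "exec (RAssign x a r) s t s'"
inductive_cases Seq_elim: "exec (Seq p q) s t s'"
inductive_cases Cond_elim: "exec (Cond b p q) s t s'"
inductive_cases While_elim: "exec (While b p) s t s'"

lemma exec_deterministic:
  "exec p s t s' \<Longrightarrow> exec p s u s'' \<Longrightarrow> u = t \<and> s'' = s'"
proof (induction arbitrary: u s'' rule: exec.induct)
  case (Seq p s t s1 q t' s2)
  from Seq.prems obtain v v' r where "exec p s v r" "exec q r v' s''" "u = v + v'"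
    by (rule Seq_elim)
  with Seq.IH(1)[of v r] Seq.IH(2)[of v' s''] show ?case by simp
next
  case (CondTrue b s p t s1 q)
  from CondTrue.prems obtain v where "exec p s v s''" "u = 1 + bsteps b + v"
    by (rule Cond_elim) (use CondTrue.hyps in simp_all)
  with CondTrue.IH[of v s''] show ?case by simp
next
  case (CondFalse b s q t s1 p)
  from CondFalse.prems obtain v where "exec q s v s''" "u = 1 + bsteps b + v"
    by (rule Cond_elim) (use CondFalse.hyps in simp_all)
  with CondFalse.IH[of v s''] show ?case by simp
next
  case (WhileFalse b s p)
  from WhileFalse.prems show ?case by (rule While_elim) (use WhileFalse.hyps in simp_all)
next
  case (WhileTrue b s p t s1 t' s2)
  from WhileTrue.prems obtain v v' r
    where "exec p s v r" "exec (While b p) r v' s''" "u = 1 + bsteps b + v + v'"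
    by (rule While_elim) (use WhileTrue.hyps in simp_all)
  with WhileTrue.IH(1)[of v r] WhileTrue.IH(2)[of v' s''] show ?case by simp
qed (auto elim: Skip_elim NAssign_elim RAssign_elim)


section \<open>Encoding of instances and results\<close>

text \<open>
  A graph is presented by a list \<open>vs\<close> of its vertices and a list \<open>es\<close> of its edges, where an edge
  is given by the positions of its two ends in \<open>vs\<close>, in either order.
\<close>

definition edge_at :: "'a list \<Rightarrow> nat \<times> nat \<Rightarrow> 'a set" where
  "edge_at vs p = {vs ! fst p, vs ! snd p}"

definition presents :: "'a list \<Rightarrow> (nat \<times> nat) list \<Rightarrow> 'a ugraph \<Rightarrow> bool" where
  "presents vs es G \<longleftrightarrow>
     distinct vs \<and> set vs = uverts G \<and>
     (\<forall>p\<in>set es. fst p < length vs \<and> snd p < length vs) \<and>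
     distinct (map (edge_at vs) es) \<and> set (map (edge_at vs) es) = uedges G"

definition cells :: "'b::zero list \<Rightarrow> nat \<Rightarrow> 'b" where
  "cells xs i = (if i < length xs then xs ! i else 0)"

definition input_state ::
    "'a list \<Rightarrow> (nat \<times> nat) list \<Rightarrow> ('a set \<Rightarrow> real) \<Rightarrow> 'a set \<Rightarrow>
     ('a \<Rightarrow> nat) \<Rightarrow> ('a \<Rightarrow> nat) \<Rightarrow> state" where
  "input_state vs es c U \<alpha> \<beta> =
     ((\<lambda>_ _. 0)
        (''n'' := cells [length vs],
         ''m'' := cells [length es],
         ''end1'' := cells (map fst es),
         ''end2'' := cells (map snd es),
         ''inU'' := cells (map (\<lambda>v. if v \<in> U then 1 else 0) vs),
         ''lower'' := cells (map (\<lambda>v. if v \<in> U then \<alpha> v else 0) vs),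
         ''upper'' := cells (map (\<lambda>v. if v \<in> U then \<beta> v else 0) vs)),
      (\<lambda>_ _. 0)
        (''cost'' := cells (map (\<lambda>p. c (edge_at vs p)) es)))"

text \<open>
  Reals count as one unit each. The vertex numbers in the list of edges are not charged by their
  binary length, which makes a polynomial time bound only more demanding.
\<close>

definition input_size ::
    "'a ugraph \<Rightarrow> 'a set \<Rightarrow> ('a \<Rightarrow> nat) \<Rightarrow> ('a \<Rightarrow> nat) \<Rightarrow> nat" where
  "input_size G U \<alpha> \<beta> =
     card (uverts G) + card (uedges G) + (\<Sum>v\<in>U. floorlog 2 (\<alpha> v) + floorlog 2 (\<beta> v))"

definition answers_yes :: "state \<Rightarrow> bool" where
  "answers_yes s \<longleftrightarrow> fst s ''answer'' 0 \<noteq> 0"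

definition output_graph :: "'a list \<Rightarrow> (nat \<times> nat) list \<Rightarrow> state \<Rightarrow> 'a ugraph" where
  "output_graph vs es s =
     \<lparr>uverts = set vs,
      uedges = {edge_at vs (es ! k) | k. k < length es \<and> fst s ''tree'' k \<noteq> 0}\<rparr>"

end

theory Submission
  imports Defs
begin

text \<open>
  Give every vertex \<open>v\<close> in \<open>U\<close> a price, which is added to the cost of the edges at \<open>v\<close>; since \<open>U\<close> is
  stable, every edge carries at most one price. Keep a spanning tree \<open>T\<close> of minimum priced cost such
  that a positive price at \<open>v\<close> forces \<open>d\<^sub>T(v) \<ge> \<beta>\<^sub>v\<close> and a price other than the initial one, \<open>- M\<close>,
  forces \<open>d\<^sub>T(v) \<ge> \<alpha>\<^sub>v\<close>. Call \<open>v\<close> excessive if its degree exceeds its cap, which is \<open>\<alpha>\<^sub>v\<close> for a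
  negative price and \<open>\<beta>\<^sub>v\<close> otherwise. From the excessive vertices search along the exchanges of a tree
  edge for another edge of the same priced cost. If a vertex below its cap is reached, the exchanges
  on a shortest path together yield another minimum tree with less excess. If not, raise the prices
  on the reached set until a new exchange becomes tight or a price becomes 0; if neither ever
  happens, every spanning tree violates an upper bound on the reached set. Without excess, \<open>T\<close> is
  optimal by complementary slackness or, if it still violates a lower bound, the problem is
  infeasible because \<open>M\<close> exceeds the sum of all absolute costs.

  Every loop of the algorithm has a number of rounds that is fixed on entry and linear in the size
  of the input. This makes termination and the polynomial running time a matter of syntax.
\<close>

section \<open>Bases of matroids and spanning trees\<close>

text \<open>Behind the method is weighted matroid intersection: spanning trees are the bases of the
  cycle matroid, and as no edge has two ends in \<open>U\<close>, the degree conditions bound the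
  numbers of edges in the blocks of a partition. Prices only select which trees count as minimum.
  These are again the bases of a matroid, so between price changes the argument is unweighted, and
  tight exchanges are simply exchanges in the family \<open>min_bases\<close>. The obstacle is that
  several exchanges, each possible alone, may together leave the family of bases; the lack of
  shortcuts on a shortest path excludes this. As the costs are arbitrary reals, the number of rounds
  must not depend on their size, so it is bounded by a potential made of counts only. The initial
  price \<open>- M\<close> turns each lower bound into a cap. Hence any minimum spanning tree is a
  valid start, prices never have to fall, and only excess has to be removed.\<close>

definition swap :: "'e set \<Rightarrow> 'e \<Rightarrow> 'e \<Rightarrow> 'e set" where
  "swap T e f = insert f (T - {e})"

lemma sum_swap:
  fixes w :: "'e \<Rightarrow> real"
  assumes "finite T" "e \<in> T" "f \<notin> T"
  shows "sum w (swap T e f) = sum w T - w e + w f"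
  using assms by (simp add: swap_def sum_diff1)

text \<open>The exchange axiom is taken in its symmetric form because this form passes to minimum
  bases: the two swaps change the weights of \<open>A\<close> and \<open>B\<close> by opposite
  amounts. The family may be empty, as for a disconnected graph.\<close>

locale base_family =
  fixes bases :: "'e set set"
  assumes finite_base: "T \<in> bases \<Longrightarrow> finite T"
    and exchange: "\<lbrakk>A \<in> bases; B \<in> bases; e \<in> A - B\<rbrakk>
      \<Longrightarrow> \<exists>f\<in>B - A. swap A e f \<in> bases \<and> swap B f e \<in> bases"
begin

definition min_bases :: "('e \<Rightarrow> real) \<Rightarrow> 'e set set" where
  "min_bases w = {T \<in> bases. \<forall>T'\<in>bases. sum w T \<le> sum w T'}"

text \<open>Local optimality is global. Symmetric exchange trades an element of
  \<open>T' - T\<close> for one of \<open>T - T'\<close> such that the reverse trade is possible in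
  \<open>T\<close>. By assumption this does not raise the weight of \<open>T'\<close>, and it brings
  \<open>T'\<close> closer to \<open>T\<close>.\<close>

lemma min_bases_if_no_improving_swap:
  assumes T: "T \<in> bases"
    and loc: "\<And>e f. \<lbrakk>e \<in> T; f \<notin> T; swap T e f \<in> bases\<rbrakk> \<Longrightarrow> w e \<le> w f"
  shows "T \<in> min_bases w"
proof -
  have "sum w T \<le> sum w T'" if "T' \<in> bases" for T'
    using that
  proof (induction "card (T' - T)" arbitrary: T' rule: less_induct)
    case less
    show ?case
    proof (cases "T' \<subseteq> T")
      case True
      \<comment> \<open>Distinct bases are incomparable: an element of \<open>T - T'\<close> would
        need a partner in \<open>T' - T\<close>.\<close>
      then have "T' = T" using exchange[OF T less.prems] by blast
      then show ?thesis by simp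
    next
      case False
      then obtain f where f: "f \<in> T' - T" by blast
      from exchange[OF less.prems T f] obtain e where e: "e \<in> T - T'"
        and s: "swap T' f e \<in> bases" "swap T e f \<in> bases" by blast
      have "swap T' f e - T = (T' - T) - {f}" using e by (auto simp: swap_def)
      then have "card (swap T' f e - T) < card (T' - T)"
        using f finite_base[OF less.prems] by (metis card_Diff1_less finite_Diff)
      from less.hyps[OF this s(1)] have "sum w T \<le> sum w (swap T' f e)" .
      also have "\<dots> = sum w T' - w f + w e"
        using e f finite_base[OF less.prems] by (intro sum_swap) auto
      finally show ?thesis using loc[of e f] e f s(2) by auto
    qed
  qed
  then show ?thesis using T by (simp add: min_bases_def)
qed

lemma min_bases_swap_le:
  assumes "T \<in> min_bases w" "e \<in> T" "f \<notin> T" "swap T e f \<in> bases"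
  shows "w e \<le> w f"
  using assms sum_swap[of T e f w] finite_base[of T] by (force simp: min_bases_def)

lemma swap_in_min_bases_iff:
  assumes "T \<in> min_bases w" "e \<in> T" "f \<notin> T"
  shows "swap T e f \<in> min_bases w \<longleftrightarrow> swap T e f \<in> bases \<and> w e = w f"
  using assms sum_swap[of T e f w] finite_base[of T] by (force simp: min_bases_def)

text \<open>Minimality of \<open>A\<close> gives \<open>w e \<le> w f\<close> and minimality of
  \<open>B\<close> the converse, so both swaps keep the weight.\<close>

lemma base_family_min_bases: "base_family (min_bases w)"
proof
  fix A B e assume A: "A \<in> min_bases w" and B: "B \<in> min_bases w" and e: "e \<in> A - B"
  then have AB: "A \<in> bases" "B \<in> bases" by (auto simp: min_bases_def)
  from exchange[OF this e] obtain f where f: "f \<in> B - A"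
    "swap A e f \<in> bases" "swap B f e \<in> bases" by blast
  have "w e \<le> w f" using min_bases_swap_le[OF A] e f by blast
  moreover have "w f \<le> w e" using min_bases_swap_le[OF B] e f by blast
  ultimately show "\<exists>f\<in>B - A. swap A e f \<in> min_bases w \<and> swap B f e \<in> min_bases w"
    using e f swap_in_min_bases_iff[OF A, of e f] swap_in_min_bases_iff[OF B, of f e] by auto
qed (auto simp: min_bases_def finite_base)

lemma min_bases_nonempty:
  assumes "finite bases" "bases \<noteq> {}"
  shows "min_bases w \<noteq> {}"
  using ex_min_if_finite[of "sum w ` bases"] assms
  by (fastforce simp: min_bases_def not_less)

text \<open>Two swaps are compatible if there is no shortcut from \<open>e\<close> to
  \<open>f'\<close>. Comparing the two swapped bases, \<open>e'\<close> has to be exchanged against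
  \<open>e\<close> or \<open>f'\<close>, and the choice of \<open>e\<close> would make
  \<open>swap T e f'\<close> a base.\<close>

lemma two_swaps:
  assumes "e \<in> T" "e' \<in> T" "f \<notin> T" "f' \<notin> T" "e \<noteq> e'" "f \<noteq> f'"
    and b: "swap T e f \<in> bases" "swap T e' f' \<in> bases" and nb: "swap T e f' \<notin> bases"
  shows "swap (swap T e' f') e f \<in> bases"
proof -
  have "e' \<in> swap T e f - swap T e' f'" using assms by (auto simp: swap_def)
  from exchange[OF b this] obtain y where y: "y \<in> swap T e' f' - swap T e f"
    and s: "swap (swap T e f) e' y \<in> bases" "swap (swap T e' f') y e' \<in> bases" by blast
  have "swap (swap T e' f') e e' = swap T e f'" using assms by (auto simp: swap_def)
  then have "y \<noteq> e" using s(2) nb by auto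
  then have "y = f'" using y by (auto simp: swap_def)
  moreover have "swap (swap T e f) e' f' = swap (swap T e' f') e f"
    using assms by (auto simp: swap_def)
  ultimately show ?thesis using s by simp
qed

text \<open>Breadth-first levels stay valid when a swap leads from one level to the next. This is what
  makes it safe to perform the swaps of a shortest path one after the other.\<close>

lemma levels_after_swap:
  fixes L :: "'e \<Rightarrow> nat"
  assumes T: "T \<in> bases"
    and valid: "\<And>e f. \<lbrakk>e \<in> T; f \<notin> T; swap T e f \<in> bases\<rbrakk> \<Longrightarrow> L f \<le> Suc (L e)"
    and s0: "e0 \<in> T" "f0 \<notin> T" "swap T e0 f0 \<in> bases" "L f0 = Suc (L e0)"
    and ef: "e \<in> swap T e0 f0" "f \<notin> swap T e0 f0" "swap (swap T e0 f0) e f \<in> bases"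
  shows "L f \<le> Suc (L e)"
proof -
  consider "e = f0" "f = e0" | "e = f0" "f \<noteq> e0" | "e \<noteq> f0" "f = e0" | "e \<noteq> f0" "f \<noteq> e0" by blast
  then show ?thesis
  proof cases
    case 1
    then show ?thesis using s0 by simp
  next
    case 2
    then have "swap (swap T e0 f0) e f = swap T e0 f" "f \<notin> T"
      using s0 ef by (auto simp: swap_def)
    then show ?thesis using valid[of e0 f] s0 ef 2 by simp
  next
    case 3
    then have "swap (swap T e0 f0) e f = swap T e f0" "e \<in> T"
      using s0 ef by (auto simp: swap_def)
    then show ?thesis using valid[of e f0] s0 ef 3 by simp
  next
    case 4
    have e: "e \<in> T" "f \<notin> T" "e \<noteq> e0" "f \<noteq> f0" using 4 s0 ef by (auto simp: swap_def)
    have "e \<in> T - swap (swap T e0 f0) e f" using e 4 s0 by (auto simp: swap_def)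
    \<comment> \<open>Between \<open>T\<close> and the result of both swaps, the partner of
      \<open>e\<close> is \<open>f\<close> or \<open>f0\<close>. In the second case the swaps of
      \<open>e0\<close> for \<open>f\<close> and of \<open>e\<close> for \<open>f0\<close> are
      available in \<open>T\<close>, and \<open>L f0 = Suc (L e0)\<close> links their two
      inequalities.\<close>
    from exchange[OF T ef(3) this] obtain y where
      y: "y \<in> swap (swap T e0 f0) e f - T" and
      s: "swap T e y \<in> bases" "swap (swap (swap T e0 f0) e f) y e \<in> bases" by blast
    from y have "y = f \<or> y = f0" by (auto simp: swap_def)
    then show ?thesis
    proof
      assume "y = f" then show ?thesis using valid e s by simp
    next
      assume [simp]: "y = f0"
      have "swap (swap (swap T e0 f0) e f) f0 e = swap T e0 f"
        using e 4 s0 by (auto simp: swap_def)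
      then have "L f \<le> Suc (L e0)" using valid[of e0 f] e s s0 by simp
      moreover have "L f0 \<le> Suc (L e)" using valid[of e f0] e s s0 by simp
      ultimately show ?thesis using s0 by simp
    qed
  qed
qed

end

section \<open>The cycle matroid of a graph with numbered edges\<close>

locale index_graph =
  fixes n m :: nat and a b :: "nat \<Rightarrow> nat"
  assumes ends: "k < m \<Longrightarrow> a k < n" "k < m \<Longrightarrow> b k < n"
begin

definition adj :: "nat set \<Rightarrow> nat rel" where
  "adj F = {(x, y). \<exists>k\<in>F. x = a k \<and> y = b k \<or> x = b k \<and> y = a k}"

definition conn :: "nat set \<Rightarrow> nat rel" where
  "conn F = (adj F)\<^sup>*"

text \<open>Acyclicity in the form that every edge is a bridge. The theory of trees then needs
  neither paths nor cycles, only \<open>conn\<close>.\<close>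

definition forest :: "nat set \<Rightarrow> bool" where
  "forest F \<longleftrightarrow> (\<forall>k\<in>F. (a k, b k) \<notin> conn (F - {k}))"

text \<open>The condition \<open>0 < n\<close> follows the convention that the graph without
  vertices is not connected.\<close>

definition tree :: "nat set \<Rightarrow> bool" where
  "tree F \<longleftrightarrow> F \<subseteq> {..<m} \<and> 0 < n \<and> forest F \<and> (\<forall>x<n. \<forall>y<n. (x, y) \<in> conn F)"

lemma conn_refl [simp]: "(x, x) \<in> conn F"
  by (simp add: conn_def)

lemma conn_trans: "(x, y) \<in> conn F \<Longrightarrow> (y, z) \<in> conn F \<Longrightarrow> (x, z) \<in> conn F"
  by (simp add: conn_def)

lemma conn_sym: "(x, y) \<in> conn F \<longleftrightarrow> (y, x) \<in> conn F"
proof -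
  have "sym (adj F)" by (auto simp: adj_def intro!: symI)
  then show ?thesis unfolding conn_def by (meson sym_rtrancl symE)
qed

lemma conn_mono: "F \<subseteq> F' \<Longrightarrow> (x, y) \<in> conn F \<Longrightarrow> (x, y) \<in> conn F'"
  unfolding conn_def by (rule rtrancl_mono[THEN subsetD]) (auto simp: adj_def)

lemma conn_edge: "k \<in> F \<Longrightarrow> (a k, b k) \<in> conn F"
  unfolding conn_def by (rule r_into_rtrancl) (auto simp: adj_def)

lemma conn_cong: "(x, y) \<in> conn F \<Longrightarrow> (z, x) \<in> conn F \<longleftrightarrow> (z, y) \<in> conn F"
  using conn_sym conn_trans by blast

text \<open>A connection that uses \<open>k\<close> repeatedly can be shortened to use it at most
  once. This reduces insertion and deletion of an edge to propositional reasoning about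
  \<open>conn F\<close>.\<close>

lemma conn_insert:
  "(x, y) \<in> conn (insert k F) \<longleftrightarrow> (x, y) \<in> conn F \<or>
     (x, a k) \<in> conn F \<and> (b k, y) \<in> conn F \<or> (x, b k) \<in> conn F \<and> (a k, y) \<in> conn F"
  (is "_ \<longleftrightarrow> ?R y")
proof
  assume "(x, y) \<in> conn (insert k F)"
  then have "(x, y) \<in> (adj (insert k F))\<^sup>*" by (simp add: conn_def)
  then show "?R y"
  proof induction
    case (step y z)
    from step(2) consider "(y, z) \<in> adj F" | "y = a k" "z = b k" | "y = b k" "z = a k"
      by (auto simp: adj_def)
    then show ?case
    proof cases
      case 1
      then have "(y, z) \<in> conn F" by (simp add: conn_def)
      then show ?thesis using step.IH by (meson conn_trans)
    qed (use step.IH in \<open>auto intro: conn_trans\<close>)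
  qed simp
next
  have k: "(a k, b k) \<in> conn (insert k F)" "(b k, a k) \<in> conn (insert k F)"
    using conn_edge[of k "insert k F"] conn_sym by auto
  assume "?R y"
  then show "(x, y) \<in> conn (insert k F)"
    using conn_mono[of F "insert k F"] k by (meson conn_trans subset_insertI)
qed

lemma conn_closed:
  assumes "(x, y) \<in> conn F" "x \<in> X" "\<And>k. k \<in> F \<Longrightarrow> a k \<in> X \<longleftrightarrow> b k \<in> X"
  shows "y \<in> X"
  using assms(1) unfolding conn_def
  by induction (use assms(2,3) in \<open>auto simp: adj_def\<close>)

lemma forest_subset: "forest F' \<Longrightarrow> F \<subseteq> F' \<Longrightarrow> forest F"
  unfolding forest_def using conn_mono[of "F - {_}" "F' - {_}"] by (meson Diff_mono order_refl subsetD)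

text \<open>If another edge \<open>g\<close> stopped being a bridge, the detour around
  \<open>g\<close> would pass through \<open>k\<close>. The rest of the detour, closed up by
  \<open>g\<close>, would then connect the ends of \<open>k\<close> inside \<open>F\<close>.\<close>

lemma forest_insert:
  assumes "forest F" "(a k, b k) \<notin> conn F"
  shows "forest (insert k F)"
proof -
  have k: "k \<notin> F" using assms(2) conn_edge by blast
  have "(a g, b g) \<notin> conn (insert k F - {g})" if g: "g \<in> F" for g
  proof
    assume c: "(a g, b g) \<in> conn (insert k F - {g})"
    have "insert k F - {g} = insert k (F - {g})" using g k by auto
    with c have "(a g, b g) \<in> conn (F - {g}) \<or>
      (a g, a k) \<in> conn (F - {g}) \<and> (b k, b g) \<in> conn (F - {g}) \<or>
      (a g, b k) \<in> conn (F - {g}) \<and> (a k, b g) \<in> conn (F - {g})"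
      by (simp add: conn_insert)
    then have "(a g, a k) \<in> conn F \<and> (b k, b g) \<in> conn F \<or> (a g, b k) \<in> conn F \<and> (a k, b g) \<in> conn F"
      using assms(1) g conn_mono[of "F - {g}" F] by (auto simp: forest_def)
    then have "(a k, b k) \<in> conn F" using conn_edge[OF g] by (meson conn_sym conn_trans)
    then show False using assms(2) by simp
  qed
  then show ?thesis using assms k by (auto simp: forest_def)
qed

text \<open>This replaces the uniqueness of paths in a forest.\<close>

lemma conn_minus_set:
  assumes F: "forest F" and "finite D"
    and "(x, y) \<in> conn F" and "\<And>f. f \<in> D \<Longrightarrow> (x, y) \<in> conn (F - {f})"
  shows "(x, y) \<in> conn (F - D)"
  using assms(2-)
proof (induction D)
  case (insert f D)
  then have c: "(x, y) \<in> conn (F - D)" "(x, y) \<in> conn (F - {f})" by auto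
  show ?case
  proof (cases "f \<in> F - D")
    case True
    then have eq: "F - D = insert f (F - insert f D)" by auto
    have sub: "F - insert f D \<subseteq> F - {f}" by auto
    \<comment> \<open>If the connection used \<open>f\<close>, the ends of \<open>f\<close> would be
      linked to \<open>x\<close> and \<open>y\<close> without \<open>f\<close>. As \<open>x\<close>
      and \<open>y\<close> are also connected without \<open>f\<close>, the edge \<open>f\<close>
      would not be a bridge.\<close>
    have "(a f, b f) \<notin> conn (F - {f})" using F True by (auto simp: forest_def)
    then show ?thesis using c(1)[unfolded eq conn_insert] c(2) conn_mono[OF sub]
      by (meson conn_sym conn_trans)
  next
    case False
    then have "F - insert f D = F - D" by auto
    then show ?thesis using c by simp
  qed
qed simp

text \<open>Removing \<open>e\<close> splits the tree into exactly two components, because putting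
  \<open>e\<close> back connects everything. The edge \<open>f\<close> repairs the tree iff it joins
  these two.\<close>

lemma tree_swap_iff:
  assumes T: "tree T" and e: "e \<in> T" and f: "f \<notin> T" "f < m"
  shows "tree (swap T e f) \<longleftrightarrow> (a f, b f) \<notin> conn (T - {e})"
proof
  assume "tree (swap T e f)"
  moreover have "swap T e f - {f} = T - {e}" using e f by (auto simp: swap_def)
  ultimately show "(a f, b f) \<notin> conn (T - {e})" by (auto simp: tree_def forest_def swap_def)
next
  assume nc: "(a f, b f) \<notin> conn (T - {e})"
  have T': "T = insert e (T - {e})" using e by auto
  have c: "(x, y) \<in> conn (insert e (T - {e}))" if "x < n" "y < n" for x y
    using T that e by (auto simp: tree_def insert_absorb)
  have "forest (swap T e f)" unfolding swap_def
    using nc T by (intro forest_insert) (auto simp: tree_def intro: forest_subset)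
  moreover have "(x, y) \<in> conn (swap T e f)" if xy: "x < n" "y < n" for x y
    unfolding swap_def conn_insert
    using c[OF xy, unfolded conn_insert] c[OF ends, unfolded conn_insert, OF f(2) f(2)] nc
    by (meson conn_sym conn_trans)
  ultimately show "tree (swap T e f)" using T f by (auto simp: tree_def swap_def)
qed

text \<open>The connection in \<open>T\<close> between the ends of \<open>k\<close> has to cross the
  cut. If each crossing edge were dispensable for it, all of them could be removed at once by
  \<open>conn_minus_set\<close>, but then nothing leads out of \<open>X\<close>.\<close>

lemma tree_swap_across_cut:
  assumes T: "tree T" and k: "k < m" "k \<notin> T" and X: "a k \<in> X" "b k \<notin> X"
  shows "\<exists>f\<in>T. (a f \<in> X \<longleftrightarrow> b f \<notin> X) \<and> tree (swap T f k)"
proof (rule ccontr)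
  assume neg: "\<not> ?thesis"
  let ?D = "{f \<in> T. a f \<in> X \<longleftrightarrow> b f \<notin> X}"
  have "T \<subseteq> {..<m}" using T by (simp add: tree_def)
  then have "finite ?D" by (auto intro: finite_subset[OF _ finite_lessThan[of m]])
  moreover have "(a k, b k) \<in> conn T" using T ends k by (auto simp: tree_def)
  moreover have "(a k, b k) \<in> conn (T - {f})" if "f \<in> ?D" for f
  proof -
    have f: "f \<in> T" "a f \<in> X \<longleftrightarrow> b f \<notin> X" using that by auto
    then have "\<not> tree (swap T f k)" using neg by metis
    then show ?thesis using tree_swap_iff[OF T f(1) k(2,1)] by simp
  qed
  ultimately have "(a k, b k) \<in> conn (T - ?D)"
    using T conn_minus_set[of T ?D "a k" "b k"] by (simp add: tree_def)
  then have "b k \<in> X" by (rule conn_closed) (use X in auto)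
  then show False using X by simp
qed

lemma tree_finite: "tree T \<Longrightarrow> finite T"
  using finite_subset[of T "{..<m}"] by (auto simp: tree_def)

text \<open>The set \<open>X\<close> is one side of the fundamental cut of \<open>e\<close> in
  \<open>A\<close>. Since \<open>e\<close> crosses it, so does some \<open>f\<close> of
  \<open>B\<close> that can be traded for \<open>e\<close>; and crossing this cut is exactly what
  makes \<open>f\<close> a replacement for \<open>e\<close> in \<open>A\<close>.\<close>

lemma tree_exchange:
  assumes A: "tree A" and B: "tree B" and e: "e \<in> A - B"
  shows "\<exists>f\<in>B - A. tree (swap A e f) \<and> tree (swap B f e)"
proof -
  let ?X = "{x. (a e, x) \<in> conn (A - {e})}"
  have m: "e < m" using A e by (auto simp: tree_def)
  have "b e \<notin> ?X" using A e by (auto simp: tree_def forest_def)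
  then obtain f where
    f: "f \<in> B" "a f \<in> ?X \<longleftrightarrow> b f \<notin> ?X" "tree (swap B f e)"
    using tree_swap_across_cut[OF B m, of ?X] e by fastforce
  have nc: "(a f, b f) \<notin> conn (A - {e})" using f(2) conn_cong by blast
  then have "f \<notin> A - {e}" using conn_edge[of f "A - {e}"] by auto
  then have "f \<notin> A" using f e by blast
  moreover have "f < m" using B f by (auto simp: tree_def)
  ultimately show ?thesis using tree_swap_iff[OF A, of e f] nc f e by auto
qed

end

sublocale index_graph \<subseteq> base_family "Collect tree"
  by unfold_locales (use tree_exchange tree_finite in auto)

section \<open>The greedy construction of minimum spanning trees\<close>

context index_graph begin

lemma finite_trees: "finite (Collect tree)"
  by (rule finite_subset[of _ "Pow {..<m}"]) (auto simp: tree_def)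

definition crossing :: "nat set \<Rightarrow> nat set" where
  "crossing F = {k. k < m \<and> (a k, b k) \<notin> conn F}"

text \<open>No edge of \<open>F\<close> leaves the component \<open>X\<close> of one end of
  \<open>k\<close>. If \<open>k\<close> is not in \<open>T\<close>, some edge \<open>f\<close> of
  \<open>T\<close> crosses this cut and can be traded for \<open>k\<close>. It was itself a
  candidate for the greedy choice, so it is no cheaper than \<open>k\<close>, and minimality of
  \<open>T\<close> makes the weights equal.\<close>

lemma kruskal_step:
  assumes T: "T \<in> min_bases w" and F: "F \<subseteq> T" and k: "k \<in> crossing F"
    and least: "\<And>j. j \<in> crossing F \<Longrightarrow> w k \<le> w j"
  shows "\<exists>T'\<in>min_bases w. insert k F \<subseteq> T'"
proof (cases "k \<in> T")
  case False
  let ?X = "{x. (a k, x) \<in> conn F}"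
  have tT: "tree T" using T by (simp add: min_bases_def)
  obtain f where
    f: "f \<in> T" "a f \<in> ?X \<longleftrightarrow> b f \<notin> ?X" "tree (swap T f k)"
    using tree_swap_across_cut[OF tT, of k ?X] k False by (fastforce simp: crossing_def)
  have nc: "(a f, b f) \<notin> conn F" using f(2) conn_cong by blast
  then have "f \<notin> F" using conn_edge[of f F] by auto
  have "f \<in> crossing F" using nc f(1) tT by (auto simp: crossing_def tree_def)
  then have "w k \<le> w f" by (rule least)
  moreover have "w f \<le> w k" using min_bases_swap_le[OF T] f False by blast
  ultimately have "swap T f k \<in> min_bases w"
    using swap_in_min_bases_iff[OF T] f False by auto
  moreover have "insert k F \<subseteq> swap T f k" using F \<open>f \<notin> F\<close> by (auto simp: swap_def)
  ultimately show ?thesis by blast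
qed (use assms in auto)

lemma kruskal_end:
  assumes "tree T" "F \<subseteq> T" "crossing F = {}"
  shows "F = T"
proof (rule ccontr)
  assume "F \<noteq> T"
  then obtain k where k: "k \<in> T" "k \<notin> F" using assms by auto
  then have "(a k, b k) \<in> conn F" using assms by (auto simp: crossing_def tree_def)
  then have "(a k, b k) \<in> conn (T - {k})" by (rule conn_mono[rotated]) (use assms k in auto)
  then show False using assms k by (auto simp: tree_def forest_def)
qed

end

section \<open>Bounded loop programs\<close>

datatype prog =
    PSkip
  | PNat name nexp nexp
  | PReal name nexp rexp
  | PSeq prog prog (infixr ";;" 60)
  | PCond bexp prog prog
  | PFor name name prog

abbreviation V :: "name \<Rightarrow> nexp" where
  "V x \<equiv> NCell x (NConst 0)"

fun compile :: "prog \<Rightarrow> com" where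
  "compile PSkip = Skip"
| "compile (PNat x e f) = NAssign x e f"
| "compile (PReal x e f) = RAssign x e f"
| "compile (p ;; q) = Seq (compile p) (compile q)"
| "compile (PCond c p q) = Cond c (compile p) (compile q)"
| "compile (PFor i u p) = Seq (NAssign i (NConst 0) (NConst 0))
     (While (NLess (V i) (V u))
       (Seq (compile p) (NAssign i (NConst 0) (NAdd (V i) (NConst 1)))))"

text \<open>The number of rounds is the limit on entry, while the counter is incremented from its
  value in the state, as the compiled loop does. The two agree when the body writes neither counter
  nor limit, which is what \<open>counters_ok\<close> and \<open>limits\<close> serve to
  express.\<close>

fun den :: "prog \<Rightarrow> state \<Rightarrow> state" where
  "den PSkip s = s"
| "den (PNat x e f) s = nupd x (nval e s) (nval f s) s"
| "den (PReal x e f) s = rupd x (nval e s) (rval f s) s"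
| "den (p ;; q) s = den q (den p s)"
| "den (PCond c p q) s = (if bval c s then den p s else den q s)"
| "den (PFor i u p) s =
     ((\<lambda>s. nupd i 0 (Suc (fst (den p s) i 0)) (den p s)) ^^ fst s u 0) (nupd i 0 0 s)"

fun nwr :: "prog \<Rightarrow> name set" where
  "nwr PSkip = {}"
| "nwr (PNat x e f) = {x}"
| "nwr (PReal x e f) = {}"
| "nwr (p ;; q) = nwr p \<union> nwr q"
| "nwr (PCond c p q) = nwr p \<union> nwr q"
| "nwr (PFor i u p) = insert i (nwr p)"

fun rwr :: "prog \<Rightarrow> name set" where
  "rwr PSkip = {}"
| "rwr (PNat x e f) = {}"
| "rwr (PReal x e f) = {x}"
| "rwr (p ;; q) = rwr p \<union> rwr q"
| "rwr (PCond c p q) = rwr p \<union> rwr q"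
| "rwr (PFor i u p) = rwr p"

fun limits :: "prog \<Rightarrow> name set" where
  "limits (p ;; q) = limits p \<union> limits q"
| "limits (PCond c p q) = limits p \<union> limits q"
| "limits (PFor i u p) = insert u (limits p)"
| "limits _ = {}"

fun counters_ok :: "prog \<Rightarrow> bool" where
  "counters_ok (p ;; q) \<longleftrightarrow> counters_ok p \<and> counters_ok q"
| "counters_ok (PCond c p q) \<longleftrightarrow> counters_ok p \<and> counters_ok q"
| "counters_ok (PFor i u p) \<longleftrightarrow> counters_ok p \<and> i \<notin> nwr p"
| "counters_ok _ \<longleftrightarrow> True"

text \<open>A polynomial in a common bound on all loop limits. For a loop, 9 is 3 steps for
  resetting the counter and 6 for the final failing test; 12 is 6 for each successful test and 6 for
  the increment. A conditional is charged for both branches, since their sum bounds the larger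
  one.\<close>

fun time :: "prog \<Rightarrow> nat poly" where
  "time PSkip = [:1:]"
| "time (PNat x e f) = [:1 + nsteps e + nsteps f:]"
| "time (PReal x e f) = [:1 + nsteps e + rsteps f:]"
| "time (p ;; q) = time p + time q"
| "time (PCond c p q) = [:1 + bsteps c:] + time p + time q"
| "time (PFor i u p) = [:9:] + [:0, 1:] * ([:12:] + time p)"

definition frame :: "name set \<Rightarrow> name set \<Rightarrow> state \<Rightarrow> state \<Rightarrow> bool" where
  "frame W R s s' \<longleftrightarrow> (\<forall>x. x \<notin> W \<longrightarrow> fst s' x = fst s x) \<and> (\<forall>x. x \<notin> R \<longrightarrow> snd s' x = snd s x)"

lemma fst_nupd [simp]: "fst (nupd x i k s) = (fst s)(x := (fst s x)(i := k))"
  and snd_nupd [simp]: "snd (nupd x i k s) = snd s"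
  and fst_rupd [simp]: "fst (rupd x i r s) = fst s"
  and snd_rupd [simp]: "snd (rupd x i r s) = (snd s)(x := (snd s x)(i := r))"
  by (simp_all add: nupd_def rupd_def)

lemma frame_refl [simp]: "frame W R s s"
  by (simp add: frame_def)

lemma frame_trans: "frame W R s s' \<Longrightarrow> frame W R s' s'' \<Longrightarrow> frame W R s s''"
  by (simp add: frame_def)

lemma frame_mono: "frame W R s s' \<Longrightarrow> W \<subseteq> W' \<Longrightarrow> R \<subseteq> R' \<Longrightarrow> frame W' R' s s'"
  by (auto simp: frame_def)

lemma frame_nupd: "x \<in> W \<Longrightarrow> frame W R s (nupd x i k s)"
  by (simp add: frame_def)

lemma frame_den: "frame (nwr p) (rwr p) s (den p s)"
proof (induction p arbitrary: s)
  case (PSeq p q)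
  have "frame (nwr (p ;; q)) (rwr (p ;; q)) s (den p s)"
    by (rule frame_mono[OF PSeq.IH(1)]) auto
  moreover have "frame (nwr (p ;; q)) (rwr (p ;; q)) (den p s) (den q (den p s))"
    by (rule frame_mono[OF PSeq.IH(2)]) auto
  ultimately show ?case by (auto intro: frame_trans)
next
  case (PCond c p q)
  have "frame (nwr (PCond c p q)) (rwr (PCond c p q)) s (den p s)"
    by (rule frame_mono[OF PCond.IH(1)]) auto
  moreover have "frame (nwr (PCond c p q)) (rwr (PCond c p q)) s (den q s)"
    by (rule frame_mono[OF PCond.IH(2)]) auto
  ultimately show ?case by simp
next
  case (PFor i u p)
  let ?f = "\<lambda>s. nupd i 0 (Suc (fst (den p s) i 0)) (den p s)"
  have f: "frame (insert i (nwr p)) (rwr p) s (?f s)" for s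
    by (rule frame_trans[OF frame_mono[OF PFor.IH]]) (auto intro: frame_nupd)
  have "frame (insert i (nwr p)) (rwr p) s ((?f ^^ r) s)" for r s
  proof (induction r)
    case (Suc r)
    show ?case using frame_trans[OF Suc.IH f] by (simp only: funpow.simps o_apply)
  qed simp
  from frame_trans[OF frame_nupd this] show ?case by simp
qed (auto simp: frame_def)

lemma fst_den: "x \<notin> nwr p \<Longrightarrow> fst (den p s) x = fst s x"
  and snd_den: "x \<notin> rwr p \<Longrightarrow> snd (den p s) x = snd s x"
  using frame_den[of p s] by (auto simp: frame_def)

text \<open>The \<open>frame\<close> premise of the step relates every round to the state before the
  loop, so an invariant need not mention what the body leaves unchanged.\<close>

lemma den_PFor_induct [consumes 3, case_names init step]:
  assumes u: "fst s u 0 = N" and iu: "i \<notin> nwr p" "i \<noteq> u"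
    and init: "I 0 (nupd i 0 0 s)"
    and step: "\<And>k t. \<lbrakk>k < N; fst t i 0 = k; frame (insert i (nwr p)) (rwr p) s t; I k t\<rbrakk>
      \<Longrightarrow> I (Suc k) (nupd i 0 (Suc k) (den p t))"
  shows "I N (den (PFor i u p) s)"
proof -
  let ?f = "\<lambda>s. nupd i 0 (Suc (fst (den p s) i 0)) (den p s)"
  let ?t = "\<lambda>k. (?f ^^ k) (nupd i 0 0 s)"
  have "fst (?t k) i 0 = k \<and> frame (insert i (nwr p)) (rwr p) s (?t k) \<and> I k (?t k)" if "k \<le> N" for k
    using that
  proof (induction k)
    case 0
    then show ?case using init by (auto intro: frame_nupd)
  next
    case (Suc k)
    have i: "fst (den p (?t k)) i 0 = k" using Suc iu by (simp add: fst_den)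
    have "frame (insert i (nwr p)) (rwr p) (?t k) (?t (Suc k))"
      by (auto intro: frame_trans[OF frame_mono[OF frame_den]] frame_nupd)
    then show ?case using Suc i step[of k "?t k"] by (auto intro: frame_trans)
  qed
  then show ?thesis using u by simp
qed

text \<open>Limits are never written, so a bound \<open>N\<close> on their initial values holds
  throughout, and no loop at any depth makes more than \<open>N\<close> rounds.\<close>

lemma exec_compile:
  assumes "counters_ok p" "limits p \<inter> nwr p = {}" "\<And>u. u \<in> limits p \<Longrightarrow> fst s u 0 \<le> N"
  shows "\<exists>t\<le>poly (time p) N. exec (compile p) s t (den p s)"
  using assms
proof (induction p arbitrary: s)
  case PSkip
  have "exec (compile PSkip) s 1 (den PSkip s)" using exec.Skip by simp
  then show ?case by (intro exI[of _ 1]) simp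
next
  case (PNat x e f)
  have "exec (NAssign x e f) s (1 + nsteps e + nsteps f) (den (PNat x e f) s)"
    using exec.NAssign by simp
  then show ?case by (intro exI[of _ "1 + nsteps e + nsteps f"]) simp
next
  case (PReal x e f)
  have "exec (RAssign x e f) s (1 + nsteps e + rsteps f) (den (PReal x e f) s)"
    using exec.RAssign by simp
  then show ?case by (intro exI[of _ "1 + nsteps e + rsteps f"]) simp
next
  case (PSeq p q)
  from PSeq.prems have "\<exists>t\<le>poly (time p) N. exec (compile p) s t (den p s)"
    by (intro PSeq.IH(1)) auto
  moreover have "\<exists>t\<le>poly (time q) N. exec (compile q) (den p s) t (den q (den p s))"
  proof (intro PSeq.IH(2))
    fix u assume u: "u \<in> limits q"
    then have "u \<notin> nwr p" using PSeq.prems(2) by auto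
    then show "fst (den p s) u 0 \<le> N" using PSeq.prems(3) u by (simp add: fst_den)
  qed (use PSeq.prems in auto)
  ultimately obtain t t' where "t \<le> poly (time p) N" "exec (compile p) s t (den p s)"
    "t' \<le> poly (time q) N" "exec (compile q) (den p s) t' (den q (den p s))" by blast
  then show ?case by (intro exI[of _ "t + t'"]) (auto intro: exec.Seq)
next
  case (PCond c p q)
  show ?case
  proof (cases "bval c s")
    case True
    from PCond.prems have "\<exists>t\<le>poly (time p) N. exec (compile p) s t (den p s)"
      by (intro PCond.IH(1)) auto
    then obtain t where "t \<le> poly (time p) N" "exec (compile p) s t (den p s)" by blast
    then show ?thesis using True
      by (intro exI[of _ "1 + bsteps c + t"]) (auto intro: exec.CondTrue[simplified])
  next
    case False
    from PCond.prems have "\<exists>t\<le>poly (time q) N. exec (compile q) s t (den q s)"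
      by (intro PCond.IH(2)) auto
    then obtain t where "t \<le> poly (time q) N" "exec (compile q) s t (den q s)" by blast
    then show ?thesis using False
      by (intro exI[of _ "1 + bsteps c + t"]) (auto intro: exec.CondFalse[simplified])
  qed
next
  case (PFor i u p)
  let ?f = "\<lambda>s. nupd i 0 (Suc (fst (den p s) i 0)) (den p s)"
  let ?body = "Seq (compile p) (NAssign i (NConst 0) (NAdd (V i) (NConst 1)))"
  let ?loop = "While (NLess (V i) (V u)) ?body"
  let ?b = "12 + poly (time p) N"
  from PFor.prems have iu: "i \<notin> nwr p" "u \<notin> nwr p" "i \<noteq> u" by auto
  have "\<exists>t\<le>r * ?b + 6. exec ?loop s t ((?f ^^ r) s)"
    if "fst s i 0 + r = fst s u 0" "\<And>v. v \<in> limits p \<Longrightarrow> fst s v 0 \<le> N" for r s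
    using that
  proof (induction r arbitrary: s)
    case 0
    then have "exec ?loop s (1 + bsteps (NLess (V i) (V u))) s" by (intro exec.WhileFalse) simp
    moreover have "1 + bsteps (NLess (V i) (V u)) = 6" by simp
    ultimately have "exec ?loop s 6 s" by metis
    then show ?case by (intro exI[of _ 6]) simp
  next
    case (Suc r)
    have "\<exists>t\<le>poly (time p) N. exec (compile p) s t (den p s)"
      using PFor.prems Suc.prems by (intro PFor.IH) auto
    then obtain t where t: "t \<le> poly (time p) N" "exec (compile p) s t (den p s)" by blast
    have "exec (NAssign i (NConst 0) (NAdd (V i) (NConst 1))) (den p s) 6 (?f s)"
      using exec.NAssign[of i "NConst 0" "NAdd (V i) (NConst 1)" "den p s"] by (simp add: eval_nat_numeral)
    with t(2) have e: "exec ?body s (t + 6) (?f s)" by (rule exec.Seq)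
    have "\<exists>t\<le>r * ?b + 6. exec ?loop (?f s) t ((?f ^^ r) (?f s))"
    proof (rule Suc.IH)
      show "fst (?f s) i 0 + r = fst (?f s) u 0" using Suc.prems iu by (simp add: fst_den)
    next
      fix v assume "v \<in> limits p"
      then have "v \<noteq> i" "v \<notin> nwr p" "fst s v 0 \<le> N" using PFor.prems Suc.prems by auto
      then show "fst (?f s) v 0 \<le> N" by (simp add: fst_den)
    qed
    then obtain t' where t': "t' \<le> r * ?b + 6" "exec ?loop (?f s) t' ((?f ^^ r) (?f s))" by blast
    have "exec ?loop s (1 + bsteps (NLess (V i) (V u)) + (t + 6) + t') ((?f ^^ r) (?f s))"
      by (rule exec.WhileTrue[OF _ e t'(2)]) (use Suc.prems in simp)
    moreover have "1 + bsteps (NLess (V i) (V u)) + (t + 6) + t' = 12 + t + t'" by simp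
    moreover have "(?f ^^ Suc r) s = (?f ^^ r) (?f s)" by (simp only: funpow_Suc_right o_apply)
    ultimately have x: "exec ?loop s (12 + t + t') ((?f ^^ Suc r) s)" by metis
    show ?case by (rule exI[of _ "12 + t + t'"]) (use x t t' in simp)
  qed
  moreover have "fst (nupd i 0 0 s) v 0 \<le> N" if "v \<in> limits p" for v
  proof -
    have "v \<noteq> i" using PFor.prems that by auto
    then show ?thesis using PFor.prems that by simp
  qed
  moreover have "fst (nupd i 0 0 s) i 0 + fst s u 0 = fst (nupd i 0 0 s) u 0" using iu by simp
  ultimately have "\<exists>t\<le>fst s u 0 * ?b + 6. exec ?loop (nupd i 0 0 s) t (den (PFor i u p) s)"
    by (simp only: den.simps)
  then obtain t where
    t: "t \<le> fst s u 0 * ?b + 6" "exec ?loop (nupd i 0 0 s) t (den (PFor i u p) s)" by blast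
  have "exec (NAssign i (NConst 0) (NConst 0)) s 3 (nupd i 0 0 s)"
    using exec.NAssign[of i "NConst 0" "NConst 0" s] by (simp add: eval_nat_numeral)
  from exec.Seq[OF this t(2)] have "exec (compile (PFor i u p)) s (3 + t) (den (PFor i u p) s)" by simp
  moreover have "fst s u 0 * ?b \<le> N * ?b" using PFor.prems by (intro mult_right_mono) auto
  with t(1) have "t \<le> 6 + N * ?b" by linarith
  then have "3 + t \<le> poly (time (PFor i u p)) N" by simp
  ultimately show ?case by blast
qed

definition beq :: "nexp \<Rightarrow> nexp \<Rightarrow> bexp" where
  "beq e f = BAnd (BNot (NLess e f)) (BNot (NLess f e))"

definition bor :: "bexp \<Rightarrow> bexp \<Rightarrow> bexp" where
  "bor c d = BNot (BAnd (BNot c) (BNot d))"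

abbreviation bpos :: "nexp \<Rightarrow> bexp" where
  "bpos e \<equiv> NLess (NConst 0) e"

lemma bval_beq [simp]: "bval (beq e f) s \<longleftrightarrow> nval e s = nval f s"
  and bval_bor [simp]: "bval (bor c d) s \<longleftrightarrow> bval c s \<or> bval d s"
  by (auto simp: beq_def bor_def)

section \<open>Prices and tight exchanges\<close>

text \<open>The class \<open>cl k\<close> of an edge \<open>k\<close> is its end in \<open>U\<close>, or \<open>n\<close> if it has none. The bound \<open>Suc m\<close> on
  class \<open>n\<close> is out of reach, so that this class is never excessive and always able to take an edge.\<close>

locale priced_graph = index_graph +
  fixes cl lo up :: "nat \<Rightarrow> nat" and cst :: "nat \<Rightarrow> real" and M :: real
  assumes cl_le: "k < m \<Longrightarrow> cl k \<le> n"
    and lo_n: "lo n = 0" and up_n: "up n = Suc m"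
    and M_large: "(\<Sum>k<m. \<bar>cst k\<bar>) < M"
begin

definition cnt :: "nat set \<Rightarrow> nat \<Rightarrow> nat" where
  "cnt T v = card {k \<in> T. cl k = v}"

definition pcost :: "(nat \<Rightarrow> real) \<Rightarrow> nat \<Rightarrow> real" where
  "pcost lam k = cst k + lam (cl k)"

definition cap :: "(nat \<Rightarrow> real) \<Rightarrow> nat \<Rightarrow> nat" where
  "cap lam v = (if lam v < 0 then lo v else up v)"

definition feas :: "nat set \<Rightarrow> bool" where
  "feas T \<longleftrightarrow> tree T \<and> (\<forall>v<n. lo v \<le> cnt T v \<and> cnt T v \<le> up v)"

definition bounds_ok :: bool where
  "bounds_ok \<longleftrightarrow> (\<forall>v<n. lo v \<le> up v)"

definition price_inv :: "nat set \<Rightarrow> (nat \<Rightarrow> real) \<Rightarrow> bool" where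
  "price_inv T lam \<longleftrightarrow> T \<in> min_bases (pcost lam) \<and> lam n = 0 \<and>
     (\<forall>v<n. (lam v \<noteq> - M \<longrightarrow> lo v \<le> cnt T v) \<and> (0 < lam v \<longrightarrow> up v \<le> cnt T v))"

lemma min_basesD:
  assumes "T \<in> min_bases w"
  shows "tree T" "T \<subseteq> {..<m}" "finite T"
  using assms tree_finite by (auto simp: min_bases_def tree_def)

lemma M_pos: "0 < M"
proof -
  have "0 \<le> (\<Sum>k<m. \<bar>cst k\<bar>)" by (rule sum_nonneg) simp
  then show ?thesis using M_large by linarith
qed

lemma lo_le_up: "bounds_ok \<Longrightarrow> v \<le> n \<Longrightarrow> lo v \<le> up v"
  by (cases "v = n") (auto simp: bounds_ok_def lo_n)

lemma lo_le_cap: "bounds_ok \<Longrightarrow> v \<le> n \<Longrightarrow> lo v \<le> cap lam v"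
  by (simp add: cap_def lo_le_up)

lemma cap_le_up: "bounds_ok \<Longrightarrow> v \<le> n \<Longrightarrow> cap lam v \<le> up v"
  by (simp add: cap_def lo_le_up)

lemma cnt_le:
  assumes "T \<subseteq> {..<m}"
  shows "cnt T v \<le> m"
proof -
  have "card {k \<in> T. cl k = v} \<le> card {..<m}" using assms by (intro card_mono) auto
  then show ?thesis by (simp add: cnt_def)
qed

lemma sum_classes:
  fixes g :: "nat \<Rightarrow> 'b::comm_semiring_1"
  assumes T: "T \<subseteq> {..<m}" and R: "R \<subseteq> {..n}"
  shows "(\<Sum>k\<in>{k \<in> T. cl k \<in> R}. g (cl k)) = (\<Sum>v\<in>R. g v * of_nat (cnt T v))"
proof -
  have fin: "finite T" "finite R" using T R finite_subset by auto
  have "(\<Sum>k\<in>{k \<in> T. cl k \<in> R}. g (cl k)) = (\<Sum>v\<in>R. \<Sum>k\<in>{k \<in> {k \<in> T. cl k \<in> R}. cl k = v}. g (cl k))"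
    using fin by (intro sum.group[symmetric]) auto
  also have "\<dots> = (\<Sum>v\<in>R. g v * of_nat (cnt T v))"
  proof (rule sum.cong)
    fix v assume "v \<in> R"
    then have "{k \<in> {k \<in> T. cl k \<in> R}. cl k = v} = {k \<in> T. cl k = v}" by auto
    then show "(\<Sum>k\<in>{k \<in> {k \<in> T. cl k \<in> R}. cl k = v}. g (cl k)) = g v * of_nat (cnt T v)"
      by (simp add: cnt_def mult.commute)
  qed simp
  finally show ?thesis .
qed

lemma sum_pcost:
  assumes T: "T \<subseteq> {..<m}"
  shows "sum (pcost lam) T = sum cst T + (\<Sum>v\<le>n. lam v * cnt T v)"
proof -
  have "{k \<in> T. cl k \<in> {..n}} = T" using T cl_le by auto
  then show ?thesis using sum_classes[OF T order_refl, of lam]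
    by (simp add: pcost_def[abs_def] sum.distrib)
qed

lemma cost_difference_less:
  assumes T: "T \<subseteq> {..<m}" and T': "T' \<subseteq> {..<m}"
  shows "sum cst T' - sum cst T < M"
proof -
  have "sum cst S = (\<Sum>k<m. if k \<in> S then cst k else 0)" if "S \<subseteq> {..<m}" for S
    using that by (simp add: sum.If_cases Int_absorb1)
  then have "sum cst T' - sum cst T = (\<Sum>k<m. (if k \<in> T' then cst k else 0) - (if k \<in> T then cst k else 0))"
    using T T' by (simp add: sum_subtractf)
  also have "\<dots> \<le> (\<Sum>k<m. \<bar>cst k\<bar>)" by (intro sum_mono) auto
  finally show ?thesis using M_large by simp
qed

text \<open>Optimality by complementary slackness. A class still below its lower bound has never had
  its price raised above \<open>- M\<close>, and repairing it would have to cost at least \<open>M\<close>.\<close>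

lemma price_certificate:
  assumes inv: "price_inv T lam" and bo: "bounds_ok"
    and cap: "\<And>v. v \<le> n \<Longrightarrow> cnt T v \<le> cap lam v"
    and T': "feas T'"
  shows "feas T" and "sum cst T \<le> sum cst T'"
proof -
  have tT: "T \<in> min_bases (pcost lam)" and tT': "tree T'" using inv T' by (auto simp: price_inv_def feas_def)
  then have sub: "T \<subseteq> {..<m}" "T' \<subseteq> {..<m}" by (auto simp: min_bases_def tree_def)
  have "sum (pcost lam) T \<le> sum (pcost lam) T'" using tT tT' by (simp add: min_bases_def)
  then have le: "sum cst T - sum cst T' \<le> (\<Sum>v\<le>n. lam v * (real (cnt T' v) - real (cnt T v)))"
    using sub by (simp add: sum_pcost right_diff_distrib sum_subtractf)
  \<comment> \<open>Complementary slackness: at a negative price \<open>T\<close> has at most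
    \<open>lo v\<close> edges of class \<open>v\<close> and \<open>T'\<close> at least as many; at a
    positive price \<open>T\<close> has at least \<open>up v\<close> and \<open>T'\<close> at most
    as many.\<close>
  have neg: "lam v * (real (cnt T' v) - real (cnt T v)) \<le> 0" if v: "v \<le> n" for v
  proof (cases "v = n \<or> lam v = 0")
    case False
    then have v: "v < n" using v by simp
    have b: "lo v \<le> cnt T' v" "cnt T' v \<le> up v" using T' v by (auto simp: feas_def)
    show ?thesis
    proof (cases "lam v < 0")
      case True
      then have "cnt T v \<le> lo v" using cap[of v] v by (simp add: cap_def)
      then show ?thesis using True b by (intro mult_nonpos_nonneg) auto
    next
      case nn: False
      then have "up v \<le> cnt T v" using inv v False by (simp add: price_inv_def)
      then show ?thesis using nn b by (intro mult_nonneg_nonpos) auto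
    qed
  qed (use inv in \<open>auto simp: price_inv_def\<close>)
  have "(\<Sum>v\<le>n. lam v * (real (cnt T' v) - real (cnt T v))) \<le> 0"
    by (intro sum_nonpos neg) auto
  with le show "sum cst T \<le> sum cst T'" by simp
  have "lo v \<le> cnt T v" if v: "v < n" for v
  proof (rule ccontr)
    assume less: "\<not> lo v \<le> cnt T v"
    then have lam: "lam v = - M" using inv v by (auto simp: price_inv_def)
    have "lo v \<le> cnt T' v" using T' v by (simp add: feas_def)
    then have "M * 1 \<le> M * (real (cnt T' v) - real (cnt T v))"
      using less M_pos by (intro mult_left_mono) auto
    moreover have "(\<Sum>u\<le>n. lam u * (real (cnt T' u) - real (cnt T u)))
        = lam v * (real (cnt T' v) - real (cnt T v))
          + (\<Sum>u\<in>{..n} - {v}. lam u * (real (cnt T' u) - real (cnt T u)))"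
      using v by (intro sum.remove) auto
    moreover have "(\<Sum>u\<in>{..n} - {v}. lam u * (real (cnt T' u) - real (cnt T u))) \<le> 0"
      by (intro sum_nonpos neg) auto
    ultimately have "M \<le> sum cst T' - sum cst T" using le lam by (simp add: algebra_simps)
    then show False using cost_difference_less[OF sub] by simp
  qed
  moreover have "cnt T v \<le> up v" if "v < n" for v
    using order_trans[OF cap cap_le_up[OF bo]] that by simp
  ultimately show "feas T" using min_basesD(1)[OF tT] by (simp add: feas_def)
qed

text \<open>The weight \<open>?w\<close> counts the edges whose class lies in \<open>R\<close>. No
  exchange lowers it at \<open>T\<close>, so every spanning tree has at least as many such edges as
  \<open>T\<close>. Without negative prices in \<open>R\<close> the caps there are the upper bounds;
  \<open>T\<close> attains all of them and exceeds the one at \<open>s\<close>, so no tree respects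
  them all.\<close>

lemma infeasible_if_closed:
  assumes inv: "price_inv T lam" and R: "R \<subseteq> {..n}" "s \<in> R"
    and cap: "\<And>v. v \<in> R \<Longrightarrow> cap lam v \<le> cnt T v" and s: "cap lam s < cnt T s"
    and lam: "\<And>v. v \<in> R \<Longrightarrow> 0 \<le> lam v"
    and closed: "\<And>e f. \<lbrakk>e \<in> T; cl e \<in> R; f < m; f \<notin> T; tree (swap T e f)\<rbrakk> \<Longrightarrow> cl f \<in> R"
  shows "\<not> feas T'"
proof
  assume T': "feas T'"
  let ?w = "\<lambda>k. if cl k \<in> R then 1 else 0 :: real"
  have tT: "T \<in> min_bases (pcost lam)" using inv by (simp add: price_inv_def)
  note T = min_basesD[OF tT]
  have "T \<in> min_bases ?w"
  proof (rule min_bases_if_no_improving_swap)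
    fix e f assume e: "e \<in> T" "f \<notin> T" and s: "swap T e f \<in> Collect tree"
    then have "f < m" by (auto simp: tree_def swap_def)
    then show "?w e \<le> ?w f" using closed e s by auto
  qed (use T in simp)
  then have le: "sum ?w T \<le> sum ?w T'" using T' by (simp add: min_bases_def feas_def)
  have w: "sum ?w S = (\<Sum>v\<in>R. real (cnt S v))" if "S \<subseteq> {..<m}" for S
  proof -
    have "finite S" using that finite_subset by blast
    then have "sum ?w S = (\<Sum>k\<in>{k \<in> S. cl k \<in> R}. 1)" by (simp only: sum.inter_filter)
    then show ?thesis using sum_classes[OF that R(1), of "\<lambda>_. 1 :: real"] by simp
  qed
  have eq: "cap lam v = up v" if "v \<in> R" for v using lam[OF that] by (simp add: cap_def)
  have "n \<notin> R" using cap[of n] eq[of n] cnt_le[OF T(2), of n] by (auto simp: up_n)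
  have "(\<Sum>v\<in>R. real (cnt T' v)) \<le> (\<Sum>v\<in>R. real (up v))"
  proof (rule sum_mono)
    fix v assume "v \<in> R"
    then have "v < n" using R(1) \<open>n \<notin> R\<close> by (metis atMost_iff le_neq_implies_less subsetD)
    then show "real (cnt T' v) \<le> real (up v)" using T' by (auto simp: feas_def)
  qed
  also have "\<dots> < (\<Sum>v\<in>R. real (cnt T v))"
  proof (rule sum_strict_mono_ex1)
    show "finite R" using R finite_subset by auto
    show "\<forall>v\<in>R. real (up v) \<le> real (cnt T v)" using cap eq by auto
    show "\<exists>v\<in>R. real (up v) < real (cnt T v)" using s eq R(2) by auto
  qed
  finally show False using le w T(2) T' by (simp add: feas_def tree_def)
qed

section \<open>Price changes and augmentations preserve the invariant\<close>

definition raise :: "nat set \<Rightarrow> real \<Rightarrow> (nat \<Rightarrow> real) \<Rightarrow> nat \<Rightarrow> real" where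
  "raise R d lam v = (if v \<in> R then lam v + d else lam v)"

text \<open>Only an exchange that leads from \<open>R\<close> to a class outside \<open>R\<close>
  loses in the comparison of priced costs, and \<open>gap\<close> limits this loss. Since no
  negative price passes 0, a price that is positive afterwards was not negative before, so its cap
  was already the upper bound.\<close>

lemma price_inv_raise:
  assumes inv: "price_inv T lam" and bo: bounds_ok and R: "R \<subseteq> {..n}" and d: "0 \<le> d"
    and cap: "\<And>v. v \<in> R \<Longrightarrow> cap lam v \<le> cnt T v"
    and neg: "\<And>v. \<lbrakk>v \<in> R; lam v < 0\<rbrakk> \<Longrightarrow> d \<le> - lam v"
    and gap: "\<And>e f. \<lbrakk>e \<in> T; cl e \<in> R; f < m; f \<notin> T; cl f \<notin> R; tree (swap T e f)\<rbrakk>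
      \<Longrightarrow> d \<le> pcost lam f - pcost lam e"
  shows "price_inv T (raise R d lam)"
proof -
  have tT: "T \<in> min_bases (pcost lam)" using inv by (simp add: price_inv_def)
  note T = min_basesD[OF tT]
  have "T \<in> min_bases (pcost (raise R d lam))"
  proof (rule min_bases_if_no_improving_swap)
    fix e f assume e: "e \<in> T" "f \<notin> T" and s: "swap T e f \<in> Collect tree"
    then have "f < m" by (auto simp: tree_def swap_def)
    then show "pcost (raise R d lam) e \<le> pcost (raise R d lam) f"
      using min_bases_swap_le[OF tT e s] gap[of e f] e s d by (auto simp: pcost_def raise_def)
  qed (use T in simp)
  moreover have "n \<notin> R"
  proof
    assume "n \<in> R"
    then show False using cap[of n] cnt_le[OF T(2), of n] inv by (simp add: cap_def price_inv_def up_n)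
  qed
  moreover have "(raise R d lam v \<noteq> - M \<longrightarrow> lo v \<le> cnt T v) \<and> (0 < raise R d lam v \<longrightarrow> up v \<le> cnt T v)"
    if v: "v < n" for v
  proof (cases "v \<in> R")
    case True
    then have "lo v \<le> cnt T v" using cap[of v] lo_le_cap[OF bo, of v lam] v by simp
    moreover have "up v \<le> cnt T v" if "0 < lam v + d"
      using that cap[OF True] neg[OF True] by (auto simp: cap_def split: if_splits)
    ultimately show ?thesis using True by (simp add: raise_def)
  qed (use inv v in \<open>auto simp: price_inv_def raise_def\<close>)
  ultimately show ?thesis using inv by (simp add: price_inv_def raise_def)
qed

text \<open>The net effect of swaps on the counts: one edge passes from class \<open>s\<close> to
  class \<open>t\<close>. The additive form avoids truncated subtraction and covers
  \<open>s = t\<close>.\<close>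

definition move :: "nat set \<Rightarrow> nat set \<Rightarrow> nat \<Rightarrow> nat \<Rightarrow> bool" where
  "move T T' s t \<longleftrightarrow> (\<forall>v. cnt T' v + of_bool (v = s) = cnt T v + of_bool (v = t))"

text \<open>Only class \<open>s\<close> can lose an edge, and being above its cap it stays at or
  above it. The cap is at least the lower bound, and for a positive price it is the upper
  bound.\<close>

lemma price_inv_move:
  assumes inv: "price_inv T lam" and bo: bounds_ok and T': "T' \<in> min_bases (pcost lam)"
    and mv: "move T T' s t" and s: "cap lam s < cnt T s" and t: "cnt T t < cap lam t"
  shows "price_inv T' lam"
proof -
  have "(lam v \<noteq> - M \<longrightarrow> lo v \<le> cnt T' v) \<and> (0 < lam v \<longrightarrow> up v \<le> cnt T' v)" if v: "v < n" for v
  proof -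
    have c: "cnt T' v + of_bool (v = s) = cnt T v + of_bool (v = t)" using mv by (simp add: move_def)
    show ?thesis
    proof (cases "v = s")
      case True
      then have "cap lam v \<le> cnt T' v" using c s t by (auto split: if_splits)
      then show ?thesis using lo_le_cap[OF bo, of v lam] v by (auto simp: cap_def)
    next
      case False
      then have "cnt T v \<le> cnt T' v" using c by simp
      then show ?thesis using inv v by (force simp: price_inv_def)
    qed
  qed
  then show ?thesis using inv T' by (simp add: price_inv_def)
qed

section \<open>Excess, reached classes and the potential\<close>

definition excess :: "nat set \<Rightarrow> (nat \<Rightarrow> real) \<Rightarrow> nat" where
  "excess T lam = (\<Sum>v\<le>n. cnt T v - cap lam v)"

text \<open>The exchange graph is contracted to classes: only the counts matter for the caps, so any
  edge of a reached class may continue the search.\<close>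

definition tight :: "nat set \<Rightarrow> (nat \<Rightarrow> real) \<Rightarrow> nat rel" where
  "tight T lam = {(cl e, cl f) | e f. e \<in> T \<and> f \<notin> T \<and> swap T e f \<in> min_bases (pcost lam)}"

definition sources :: "nat set \<Rightarrow> (nat \<Rightarrow> real) \<Rightarrow> nat set" where
  "sources T lam = {v. v \<le> n \<and> cap lam v < cnt T v}"

definition reach :: "nat set \<Rightarrow> (nat \<Rightarrow> real) \<Rightarrow> nat set" where
  "reach T lam = (tight T lam)\<^sup>* `` sources T lam"

text \<open>Augmentations lower the excess. A price change that keeps the excess reaches a further class or
  raises a negative price to 0; the last two summands stay below \<open>2 * n + 3\<close>.\<close>

definition potential :: "nat set \<Rightarrow> (nat \<Rightarrow> real) \<Rightarrow> nat" where
  "potential T lam = excess T lam * (2 * n + 3) + (n + 1 - card (reach T lam))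
     + card {v. v \<le> n \<and> lam v < 0}"

lemma tight_le: "(v, u) \<in> tight T lam \<Longrightarrow> u \<le> n"
  using cl_le min_basesD(2) by (fastforce simp: tight_def swap_def)

lemma reach_subset: "reach T lam \<subseteq> {..n}"
proof
  fix v assume "v \<in> reach T lam"
  then obtain s where s: "s \<in> sources T lam" "(s, v) \<in> (tight T lam)\<^sup>*" by (auto simp: reach_def)
  from s(2) have "v \<le> n" by induction (use s(1) tight_le in \<open>auto simp: sources_def\<close>)
  then show "v \<in> {..n}" by simp
qed

lemma finite_reach [simp]: "finite (reach T lam)"
  by (rule finite_subset[OF reach_subset]) simp

lemma sources_subset_reach: "sources T lam \<subseteq> reach T lam"
  by (auto simp: reach_def)

lemma reach_step: "v \<in> reach T lam \<Longrightarrow> (v, u) \<in> tight T lam \<Longrightarrow> u \<in> reach T lam"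
  by (auto simp: reach_def intro: rtrancl_into_rtrancl)

lemma potential_less_if_excess_less:
  assumes "excess T' lam' < excess T lam"
  shows "potential T' lam' < potential T lam"
proof -
  have "card {v. v \<le> n \<and> lam' v < 0} \<le> card {..n}" by (intro card_mono) auto
  then have "potential T' lam' < (excess T' lam' + 1) * (2 * n + 3)" by (simp add: potential_def)
  also have "\<dots> \<le> excess T lam * (2 * n + 3)" using assms by (intro mult_right_mono) auto
  finally show ?thesis by (simp add: potential_def)
qed

lemma excess_le:
  assumes T: "T \<subseteq> {..<m}"
  shows "excess T lam \<le> m"
proof -
  have "excess T lam \<le> (\<Sum>v\<le>n. cnt T v)" unfolding excess_def by (intro sum_mono) simp
  also have "\<dots> = card {k \<in> T. cl k \<in> {..n}}"
    using sum_classes[OF T order_refl, of "\<lambda>_. 1 :: nat"] by simp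
  also have "\<dots> \<le> card {..<m}" using T by (intro card_mono) auto
  finally show ?thesis by simp
qed

lemma potential_less:
  assumes "T \<subseteq> {..<m}"
  shows "potential T lam < (m + 1) * (2 * n + 3)"
proof -
  have "card {v. v \<le> n \<and> lam v < 0} \<le> card {..n}" by (intro card_mono) auto
  then have "potential T lam < (excess T lam + 1) * (2 * n + 3)" by (simp add: potential_def)
  also have "\<dots> \<le> (m + 1) * (2 * n + 3)" using excess_le[OF assms] by (intro mult_right_mono) auto
  finally show ?thesis .
qed

lemma excess_move_less:
  assumes mv: "move T T' s t" and s: "s \<in> sources T lam" and t: "cnt T t < cap lam t"
  shows "excess T' lam < excess T lam"
proof -
  have c: "cnt T' v + of_bool (v = s) = cnt T v + of_bool (v = t)" for v
    using mv by (simp add: move_def)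
  have "s \<noteq> t" using s t by (auto simp: sources_def)
  show ?thesis unfolding excess_def
  proof (rule sum_strict_mono_ex1)
    show "\<forall>v\<in>{..n}. cnt T' v - cap lam v \<le> cnt T v - cap lam v"
    proof
      fix v
      show "cnt T' v - cap lam v \<le> cnt T v - cap lam v"
        using c[of v] t by (cases "v = t") (auto split: if_splits)
    qed
    show "\<exists>v\<in>{..n}. cnt T' v - cap lam v < cnt T v - cap lam v"
      using c[of s] s \<open>s \<noteq> t\<close> by (intro bexI[of _ s]) (auto simp: sources_def)
  qed simp
qed

text \<open>If the excess stays the same, so do the sources. Arcs inside the reached set stay tight,
  as both ends are raised alike, so the reached set does not shrink. No price becomes negative
  either. The event then makes one of the two counts change strictly.\<close>

lemma potential_raise_less:
  fixes d :: real and T :: "nat set" and lam :: "nat \<Rightarrow> real"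
  defines "R \<equiv> reach T lam" and "lam' \<equiv> raise (reach T lam) d lam"
  assumes inv: "price_inv T lam" and inv': "price_inv T lam'" and bo: bounds_ok and d: "0 < d"
    and neg: "\<And>v. \<lbrakk>v \<in> R; lam v < 0\<rbrakk> \<Longrightarrow> d \<le> - lam v"
    and event: "(\<exists>v\<in>R. lam v < 0 \<and> d = - lam v) \<or>
      (\<exists>e\<in>T. \<exists>f. cl e \<in> R \<and> f \<notin> T \<and> cl f \<notin> R \<and> tree (swap T e f) \<and> d = pcost lam f - pcost lam e)"
  shows "potential T lam' < potential T lam"
proof -
  have tT: "T \<in> min_bases (pcost lam)" and tT': "T \<in> min_bases (pcost lam')"
    using inv inv' by (auto simp: price_inv_def)
  have Rn: "R \<subseteq> {..n}" using reach_subset by (simp add: R_def)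
  have lam': "lam' v = (if v \<in> R then lam v + d else lam v)" for v
    by (simp add: lam'_def raise_def R_def)
  \<comment> \<open>A rising price can only switch a cap from the lower to the upper bound.\<close>
  have cap: "cap lam v \<le> cap lam' v" if "v \<le> n" for v
    using d lo_le_up[OF bo that] by (auto simp: cap_def lam')
  then have "excess T lam' \<le> excess T lam"
    unfolding excess_def by (intro sum_mono diff_le_mono2) auto
  then consider "excess T lam' < excess T lam" | "excess T lam' = excess T lam" by linarith
  then show ?thesis
  proof cases
    case 2
    \<comment> \<open>Equal sums with termwise comparable summands agree term by term, which fixes
      the set of sources.\<close>
    have eq: "cnt T v - cap lam' v = cnt T v - cap lam v" if "v \<le> n" for v
    proof (rule ccontr)
      assume "cnt T v - cap lam' v \<noteq> cnt T v - cap lam v"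
      then have "\<exists>v\<in>{..n}. cnt T v - cap lam' v < cnt T v - cap lam v"
        using cap[OF that] that by (intro bexI[of _ v]) auto
      then have "excess T lam' < excess T lam"
        unfolding excess_def using cap by (intro sum_strict_mono_ex1) (auto intro: diff_le_mono2)
      then show False using 2 by simp
    qed
    have src: "sources T lam' = sources T lam"
      unfolding sources_def using eq by (metis (mono_tags, lifting) zero_less_diff)
    have step: "(v, u) \<in> tight T lam'" if v: "v \<in> R" "(v, u) \<in> tight T lam" for v u
    proof -
      from v(2) obtain e f where e: "e \<in> T" "f \<notin> T" "swap T e f \<in> min_bases (pcost lam)"
        "v = cl e" "u = cl f" by (auto simp: tight_def)
      have "u \<in> R" using v reach_step by (simp add: R_def)
      then have "pcost lam' e = pcost lam' f"
        using e v swap_in_min_bases_iff[OF tT, of e f] by (simp add: pcost_def lam')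
      then show ?thesis using e swap_in_min_bases_iff[OF tT, of e f] swap_in_min_bases_iff[OF tT', of e f]
        by (auto simp: tight_def)
    qed
    have sub: "R \<subseteq> reach T lam'"
    proof
      fix v assume "v \<in> R"
      then obtain s where s: "s \<in> sources T lam" "(s, v) \<in> (tight T lam)\<^sup>*" by (auto simp: R_def reach_def)
      from s(2) have "v \<in> R \<and> v \<in> reach T lam'"
      proof induction
        case base
        then show ?case using s(1) src sources_subset_reach by (auto simp: R_def)
      next
        case (step y z)
        then show ?case using \<open>\<And>v u. _ \<Longrightarrow> _ \<Longrightarrow> (v, u) \<in> tight T lam'\<close>[of y z] reach_step
          by (auto simp: R_def)
      qed
      then show "v \<in> reach T lam'" by simp
    qed
    have subn: "{v. v \<le> n \<and> lam' v < 0} \<subseteq> {v. v \<le> n \<and> lam v < 0}"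
      using d by (auto simp: lam' split: if_splits)
    have "card R \<le> card (reach T lam')" using sub by (intro card_mono) auto
    moreover have "card {v. v \<le> n \<and> lam' v < 0} \<le> card {v. v \<le> n \<and> lam v < 0}"
      using subn by (intro card_mono) auto
    moreover have "card (reach T lam') \<le> card {..n}" using reach_subset by (intro card_mono) auto
    moreover from event have "card R < card (reach T lam') \<or>
      card {v. v \<le> n \<and> lam' v < 0} < card {v. v \<le> n \<and> lam v < 0}"
    proof
      assume "\<exists>v\<in>R. lam v < 0 \<and> d = - lam v"
      then have "{v. v \<le> n \<and> lam' v < 0} \<subset> {v. v \<le> n \<and> lam v < 0}"
        using subn Rn by (fastforce simp: lam')
      then have "card {v. v \<le> n \<and> lam' v < 0} < card {v. v \<le> n \<and> lam v < 0}"
        by (intro psubset_card_mono) auto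
      then show ?thesis ..
    next
      assume "\<exists>e\<in>T. \<exists>f. cl e \<in> R \<and> f \<notin> T \<and> cl f \<notin> R \<and> tree (swap T e f) \<and>
        d = pcost lam f - pcost lam e"
      then obtain e f where e: "e \<in> T" "cl e \<in> R" "f \<notin> T" "cl f \<notin> R" "tree (swap T e f)"
        "d = pcost lam f - pcost lam e" by blast
      then have "pcost lam' e = pcost lam' f" by (simp add: pcost_def lam')
      then have "(cl e, cl f) \<in> tight T lam'"
        using e swap_in_min_bases_iff[OF tT', of e f] by (auto simp: tight_def)
      then have "cl f \<in> reach T lam'" using sub e reach_step by blast
      then have "R \<subset> reach T lam'" using sub e by blast
      then show ?thesis by (auto intro: psubset_card_mono)
    qed
    ultimately show ?thesis using 2 by (auto simp: potential_def R_def)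
  qed (rule potential_less_if_excess_less)
qed

text \<open>Level 0 marks the classes that are not reached, level 1 the sources.\<close>

definition valid_levels :: "nat set \<Rightarrow> (nat \<Rightarrow> real) \<Rightarrow> (nat \<Rightarrow> nat) \<Rightarrow> bool" where
  "valid_levels T lam lev \<longleftrightarrow> (\<forall>v u. (v, u) \<in> tight T lam \<and> lev v \<noteq> 0 \<longrightarrow> lev u \<noteq> 0 \<and> lev u \<le> Suc (lev v))"

text \<open>For a class \<open>v\<close> beyond the first level, \<open>pe v\<close> and
  \<open>pf v\<close> record the exchange by which it was reached. The claim is limited to levels up
  to \<open>l\<close> because during an augmentation the records survive only below the level of the
  swap just made.\<close>

definition parents :: "nat set \<Rightarrow> (nat \<Rightarrow> real) \<Rightarrow> (nat \<Rightarrow> nat) \<Rightarrow> (nat \<Rightarrow> nat) \<Rightarrow> (nat \<Rightarrow> nat) \<Rightarrow> nat \<Rightarrow> bool" where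
  "parents T lam lev pe pf l \<longleftrightarrow> (\<forall>v\<le>n. 1 < lev v \<and> lev v \<le> l \<longrightarrow>
     pe v \<in> T \<and> pf v \<notin> T \<and> swap T (pe v) (pf v) \<in> min_bases (pcost lam) \<and>
     cl (pf v) = v \<and> lev v = Suc (lev (cl (pe v))))"

lemma cnt_swap:
  assumes "finite T" "e \<in> T" "f \<notin> T"
  shows "move T (swap T e f) (cl e) (cl f)"
proof -
  have "cnt (swap T e f) v + of_bool (v = cl e) = cnt T v + of_bool (v = cl f)" for v
  proof -
    have cnt: "cnt S v = (\<Sum>k\<in>S. of_bool (v = cl k))" if "finite S" for S
    proof -
      have "cnt S v = (\<Sum>k\<in>{k \<in> S. cl k = v}. 1)" by (simp add: cnt_def)
      also have "\<dots> = (\<Sum>k\<in>S. if cl k = v then 1 else 0)" using that by (rule sum.inter_filter)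
      finally show ?thesis by (simp only: of_bool_def eq_commute)
    qed
    have "cnt (swap T e f) v = of_bool (v = cl f) + (\<Sum>k\<in>T - {e}. of_bool (v = cl k))"
      unfolding swap_def using assms by (subst cnt, simp) (rule sum.insert, auto)
    moreover have "cnt T v = of_bool (v = cl e) + (\<Sum>k\<in>T - {e}. of_bool (v = cl k))"
      unfolding cnt[OF assms(1)] by (rule sum.remove) (use assms in auto)
    ultimately show ?thesis by simp
  qed
  then show ?thesis by (simp add: move_def)
qed

lemma move_trans: "move T T' s t \<Longrightarrow> move T' T'' r s \<Longrightarrow> move T T'' r t"
  unfolding move_def
proof
  fix v
  assume "\<forall>v. cnt T' v + of_bool (v = s) = cnt T v + of_bool (v = t)"
    and "\<forall>v. cnt T'' v + of_bool (v = r) = cnt T' v + of_bool (v = s)"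
  from this[THEN spec, of v]
  show "cnt T'' v + of_bool (v = r) = cnt T v + of_bool (v = t)" by linarith
qed

text \<open>The path is traversed backwards, from its end \<open>t\<close> towards a source. Minimum
  bases form a base family, so \<open>levels_after_swap\<close> applies to them and keeps the levels
  valid, while \<open>two_swaps\<close> keeps the exchanges that are still to come.\<close>

lemma augment_step:
  assumes T: "T \<in> min_bases (pcost lam)" and val: "valid_levels T lam lev"
    and par: "parents T lam lev pe pf (lev t)" and t: "t \<le> n" "1 < lev t"
  defines "T' \<equiv> swap T (pe t) (pf t)" and "t' \<equiv> cl (pe t)"
  shows "T' \<in> min_bases (pcost lam)" "valid_levels T' lam lev"
    "parents T' lam lev pe pf (lev t')" "t' \<le> n" "lev t = Suc (lev t')" "move T T' t' t"
    "pe t \<in> T" "pf t < m" "pf t \<notin> T"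
proof -
  interpret mb: base_family "min_bases (pcost lam)" by (rule base_family_min_bases)
  have p: "pe t \<in> T" "pf t \<notin> T" "swap T (pe t) (pf t) \<in> min_bases (pcost lam)" "cl (pf t) = t"
    "lev t = Suc (lev t')"
    using par t by (auto simp: parents_def t'_def)
  show "T' \<in> min_bases (pcost lam)" "lev t = Suc (lev t')" "pe t \<in> T" "pf t \<notin> T"
    using p by (auto simp: T'_def)
  show "t' \<le> n" using p(1) min_basesD(2)[OF T] cl_le by (auto simp: t'_def)
  show "pf t < m" using min_basesD(2)[OF p(3)] by (auto simp: swap_def)
  show "move T T' t' t" using cnt_swap[OF min_basesD(3)[OF T] p(1,2)] p by (simp add: T'_def t'_def)
  \<comment> \<open>Level 0 means unreached, that is infinitely far. The value \<open>big\<close>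
    plays infinity: it exceeds the successor of every level, so the inequality for \<open>?L\<close>
    also says that no tight exchange leads from a reached to an unreached class.\<close>
  have "\<forall>v\<le>n. Suc (lev v) < Suc (Suc (Max (lev ` {..n})))" by (simp add: le_imp_less_Suc)
  then obtain big where big: "\<And>v. v \<le> n \<Longrightarrow> Suc (lev v) < big" by blast
  let ?L = "\<lambda>k. if lev (cl k) = 0 then big else lev (cl k)"
  have cln: "cl e \<le> n" "cl f \<le> n" if "e \<in> S" "swap S e f \<in> min_bases (pcost lam)"
    "S \<in> min_bases (pcost lam)" for S e f
    using min_basesD(2)[OF that(2)] min_basesD(2)[OF that(3)] that(1) cl_le by (auto simp: swap_def)
  have lev: "?L f \<le> Suc (?L e)" if "e \<in> T" "f \<notin> T" "swap T e f \<in> min_bases (pcost lam)" for e f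
  proof -
    have "(cl e, cl f) \<in> tight T lam" using that by (auto simp: tight_def)
    then have "lev (cl e) \<noteq> 0 \<longrightarrow> lev (cl f) \<noteq> 0 \<and> lev (cl f) \<le> Suc (lev (cl e))"
      using val by (auto simp: valid_levels_def)
    then show ?thesis using big[OF cln(2)[OF that(1,3) T]]
      by (cases "lev (cl e) = 0"; cases "lev (cl f) = 0") auto
  qed
  have lev': "?L f \<le> Suc (?L e)" if "e \<in> T'" "f \<notin> T'" "swap T' e f \<in> min_bases (pcost lam)" for e f
    using mb.levels_after_swap[of T ?L, OF T lev p(1,2,3)] that p(4,5) t
    unfolding T'_def t'_def by force
  show "valid_levels T' lam lev" unfolding valid_levels_def
  proof (intro allI impI)
    fix v u assume vu: "(v, u) \<in> tight T' lam \<and> lev v \<noteq> 0"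
    then have v: "lev v \<noteq> 0" by simp
    from vu obtain e f where e: "v = cl e" "u = cl f" "e \<in> T'" "f \<notin> T'"
      "swap T' e f \<in> min_bases (pcost lam)" by (auto simp: tight_def)
    have tn: "T' \<in> min_bases (pcost lam)" using p by (simp add: T'_def)
    show "lev u \<noteq> 0 \<and> lev u \<le> Suc (lev v)"
    proof (cases "lev u = 0")
      case True
      then have "big \<le> Suc (lev v)" using lev'[OF e(3-5)] v e(1,2) by auto
      then show ?thesis using big[OF cln(1)[OF e(3,5) tn]] e(1) by simp
    qed (use lev'[OF e(3-5)] v e(1,2) in auto)
  qed
  show "parents T' lam lev pe pf (lev t')" unfolding parents_def
  proof (intro allI impI)
    fix v assume v: "v \<le> n" "1 < lev v \<and> lev v \<le> lev t'"
    then have q: "pe v \<in> T" "pf v \<notin> T" "swap T (pe v) (pf v) \<in> min_bases (pcost lam)" "cl (pf v) = v"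
      "lev v = Suc (lev (cl (pe v)))"
      using par p(5) by (auto simp: parents_def)
    have "lev v \<noteq> lev t" using v p(5) by simp
    then have ne: "pe v \<noteq> pe t" "pf v \<noteq> pf t" using q(4,5) p(4,5) unfolding t'_def by metis+
    \<comment> \<open>This exchange would be a shortcut: it would put \<open>t\<close> at most on
      the level of \<open>v\<close>, which is lower.\<close>
    have "swap T (pe v) (pf t) \<notin> min_bases (pcost lam)"
    proof
      assume "swap T (pe v) (pf t) \<in> min_bases (pcost lam)"
      then have "(cl (pe v), cl (pf t)) \<in> tight T lam" using q(1) p(2) unfolding tight_def by blast
      moreover have "lev (cl (pe v)) \<noteq> 0" using q(5) v by simp
      ultimately have "lev t \<le> Suc (lev (cl (pe v)))"
        using val p(4) unfolding valid_levels_def by metis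
      then show False using q(5) v p(5) by simp
    qed
    from mb.two_swaps[OF q(1) p(1) q(2) p(2) ne q(3) p(3) this]
    have "swap T' (pe v) (pf v) \<in> min_bases (pcost lam)" by (simp add: T'_def)
    then show "pe v \<in> T' \<and> pf v \<notin> T' \<and> swap T' (pe v) (pf v) \<in> min_bases (pcost lam) \<and>
      cl (pf v) = v \<and> lev v = Suc (lev (cl (pe v)))"
      using q(1,2,4,5) p(1,2) ne unfolding T'_def swap_def by (metis Diff_iff insert_iff singletonD)
  qed
qed

lemma reach_eq_levels:
  assumes val: "valid_levels T lam lev" and par: "\<And>l. parents T lam lev pe pf l"
    and src: "\<And>v. v \<le> n \<Longrightarrow> lev v = 1 \<longleftrightarrow> v \<in> sources T lam"
    and T: "T \<in> min_bases (pcost lam)"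
  shows "reach T lam = {v. v \<le> n \<and> lev v \<noteq> 0}"
proof
  show "reach T lam \<subseteq> {v. v \<le> n \<and> lev v \<noteq> 0}"
  proof
    fix v assume "v \<in> reach T lam"
    then obtain s where s: "s \<in> sources T lam" "(s, v) \<in> (tight T lam)\<^sup>*" by (auto simp: reach_def)
    from s(2) show "v \<in> {v. v \<le> n \<and> lev v \<noteq> 0}"
    proof induction
      case base
      then show ?case using s(1) src[of s] by (auto simp: sources_def)
    next
      case (step y z)
      then show ?case using val tight_le by (auto simp: valid_levels_def)
    qed
  qed
next
  have "v \<in> reach T lam" if "v \<le> n" "lev v \<noteq> 0" for v
    using that
  proof (induction "lev v" arbitrary: v rule: less_induct)
    case less
    show ?case
    proof (cases "lev v = 1")
      case True
      then show ?thesis using src less.prems sources_subset_reach by auto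
    next
      case False
      then have p: "pe v \<in> T" "pf v \<notin> T" "swap T (pe v) (pf v) \<in> min_bases (pcost lam)"
        "cl (pf v) = v" "lev v = Suc (lev (cl (pe v)))"
        using par[of "lev v"] less.prems by (auto simp: parents_def)
      then have "cl (pe v) \<in> reach T lam"
        using less.hyps[of "cl (pe v)"] False min_basesD(2)[OF T] cl_le by auto
      moreover have "(cl (pe v), cl (pf v)) \<in> tight T lam" using p(1-3) unfolding tight_def by blast
      then have "(cl (pe v), v) \<in> tight T lam" by (simp only: p(4))
      ultimately show ?thesis by (rule reach_step)
    qed
  qed
  then show "{v. v \<le> n \<and> lev v \<noteq> 0} \<subseteq> reach T lam" by auto
qed

end

section \<open>Components and minimum spanning trees\<close>

definition relabel_prog :: prog where
  "relabel_prog = PFor ''i'' ''n''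
     (PCond (beq (NCell ''lab'' (V ''i'')) (V ''q'')) (PNat ''lab'' (V ''i'') (V ''p'')) PSkip)"

text \<open>One labelling of the components without the edge \<open>skip\<close> tells for every
  other edge whether it can replace \<open>skip\<close> in the tree. The value \<open>m\<close>
  names no edge, so then nothing is left out.\<close>

definition label_prog :: prog where
  "label_prog =
     PFor ''i'' ''n'' (PNat ''lab'' (V ''i'') (V ''i'')) ;;
     PFor ''k'' ''m''
       (PCond (BAnd (bpos (NCell ''tree'' (V ''k''))) (BNot (beq (V ''k'') (V ''skip''))))
         (PNat ''p'' (NConst 0) (NCell ''lab'' (NCell ''end1'' (V ''k''))) ;;
          PNat ''q'' (NConst 0) (NCell ''lab'' (NCell ''end2'' (V ''k''))) ;;
          relabel_prog)
         PSkip)"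

lemma nwr_relabel_prog [simp]: "nwr relabel_prog = {''i'', ''lab''}"
  by (simp add: relabel_prog_def)

lemma rwr_relabel_prog [simp]: "rwr relabel_prog = {}"
  by (simp add: relabel_prog_def)

lemma nwr_label_prog [simp]: "nwr label_prog = {''i'', ''lab'', ''k'', ''p'', ''q''}"
  by (auto simp: label_prog_def)

lemma rwr_label_prog [simp]: "rwr label_prog = {}"
  by (simp add: label_prog_def)

definition pexp :: "nexp \<Rightarrow> rexp" where
  "pexp e = RAdd (RCell ''cost'' e) (RCell ''lam'' (NCell ''cls'' e))"

definition separated :: "nexp \<Rightarrow> bexp" where
  "separated f = BNot (beq (NCell ''lab'' (NCell ''end1'' f)) (NCell ''lab'' (NCell ''end2'' f)))"

definition pick_body :: prog where
  "pick_body = PCond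
     (BAnd (separated (V ''f''))
       (bor (beq (V ''found'') (NConst 0)) (RLess (pexp (V ''f'')) (pexp (V ''best'')))))
     (PNat ''found'' (NConst 0) (NConst 1) ;; PNat ''best'' (NConst 0) (V ''f'')) PSkip"

definition kruskal_body :: prog where
  "kruskal_body =
     PNat ''skip'' (NConst 0) (V ''m'') ;; label_prog ;;
     PNat ''found'' (NConst 0) (NConst 0) ;; PFor ''f'' ''m'' pick_body ;;
     PCond (bpos (V ''found'')) (PNat ''tree'' (V ''best'') (NConst 1)) PSkip"

definition kruskal_prog :: prog where
  "kruskal_prog = PFor ''j'' ''m'' kruskal_body"

lemma nwr_pick_body [simp]: "nwr pick_body = {''found'', ''best''}"
  and rwr_pick_body [simp]: "rwr pick_body = {}"
  by (auto simp: pick_body_def)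

lemma nwr_kruskal_body [simp]:
  "nwr kruskal_body = {''skip'', ''i'', ''lab'', ''k'', ''p'', ''q'', ''found'', ''f'', ''best'', ''tree''}"
  and rwr_kruskal_body [simp]: "rwr kruskal_body = {}"
  by (auto simp: kruskal_body_def)

lemma nwr_kruskal_prog [simp]:
  "nwr kruskal_prog = {''j'', ''skip'', ''i'', ''lab'', ''k'', ''p'', ''q'', ''found'', ''f'', ''best'', ''tree''}"
  and rwr_kruskal_prog [simp]: "rwr kruskal_prog = {}"
  by (auto simp: kruskal_prog_def)

lemma den_relabel_prog:
  "fst (den relabel_prog s) ''lab'' j =
     (if j < fst s ''n'' 0 \<and> fst s ''lab'' j = fst s ''q'' 0 then fst s ''p'' 0 else fst s ''lab'' j)"
proof -
  let ?I = "\<lambda>k t. \<forall>j. fst t ''lab'' j =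
    (if j < k \<and> fst s ''lab'' j = fst s ''q'' 0 then fst s ''p'' 0 else fst s ''lab'' j)"
  have "?I (fst s ''n'' 0) (den relabel_prog s)"
    unfolding relabel_prog_def
    by (rule den_PFor_induct[where I = ?I]) (auto simp: frame_def less_Suc_eq)
  then show ?thesis by blast
qed

section \<open>Correctness of the labelling and of the greedy construction\<close>

context priced_graph begin

definition static :: "state \<Rightarrow> bool" where
  "static s \<longleftrightarrow> fst s ''n'' 0 = n \<and> fst s ''m'' 0 = m \<and> fst s ''n1'' 0 = n + 1 \<and>
     fst s ''m1'' 0 = m + 1 \<and> fst s ''n3'' 0 = 2 * n + 3 \<and>
     fst s ''end1'' = a \<and> fst s ''end2'' = b \<and> fst s ''cls'' = cl \<and>
     fst s ''lower'' = lo \<and> fst s ''upper'' = up \<and> snd s ''cost'' = cst"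

lemma static_frame:
  assumes "frame W R s s'" "static s"
    and "W \<inter> {''n'', ''m'', ''n1'', ''m1'', ''n3'', ''end1'', ''end2'', ''cls'', ''lower'', ''upper''} = {}"
    and "''cost'' \<notin> R"
  shows "static s'"
proof -
  have "fst s' x = fst s x"
    if "x \<in> {''n'', ''m'', ''n1'', ''m1'', ''n3'', ''end1'', ''end2'', ''cls'', ''lower'', ''upper''}" for x
    using assms(1,3) that by (auto simp: frame_def)
  moreover have "snd s' ''cost'' = snd s ''cost''" using assms(1,4) by (simp add: frame_def)
  ultimately show ?thesis using assms(2) by (simp add: static_def)
qed

lemmas static_den = static_frame[OF frame_den]

definition chosen :: "state \<Rightarrow> nat set" where
  "chosen s = {k. k < m \<and> fst s ''tree'' k \<noteq> 0}"

lemma chosen_frame: "frame W R s s' \<Longrightarrow> ''tree'' \<notin> W \<Longrightarrow> chosen s' = chosen s"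
  by (simp add: chosen_def frame_def)

lemma label_prog:
  assumes s: "static s" and xy: "x < n" "y < n"
  shows "fst (den label_prog s) ''lab'' x = fst (den label_prog s) ''lab'' y
    \<longleftrightarrow> (x, y) \<in> conn (chosen s - {fst s ''skip'' 0})"
proof -
  let ?skip = "fst s ''skip'' 0"
  let ?init = "PFor ''i'' ''n'' (PNat ''lab'' (V ''i'') (V ''i''))"
  let ?I0 = "\<lambda>k t. \<forall>j<k. fst t ''lab'' j = j"
  have init: "?I0 n (den ?init s)"
    by (rule den_PFor_induct[where I = ?I0]) (use s in \<open>auto simp: less_Suc_eq static_def\<close>)
  define s1 where "s1 = den ?init s"
  have fr: "frame {''i'', ''lab''} {} s s1" using frame_den[of ?init s] by (simp add: s1_def)
  have s1: "static s1" by (rule static_frame[OF fr s]) auto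
  let ?body = "PCond (BAnd (bpos (NCell ''tree'' (V ''k''))) (BNot (beq (V ''k'') (V ''skip''))))
    (PNat ''p'' (NConst 0) (NCell ''lab'' (NCell ''end1'' (V ''k''))) ;;
     PNat ''q'' (NConst 0) (NCell ''lab'' (NCell ''end2'' (V ''k''))) ;; relabel_prog) PSkip"
  let ?F = "\<lambda>k. {j \<in> chosen s - {?skip}. j < k}"
  let ?I = "\<lambda>k t. \<forall>x<n. \<forall>y<n. fst t ''lab'' x = fst t ''lab'' y \<longleftrightarrow> (x, y) \<in> conn (?F k)"
  have "?I m (den label_prog s)" unfolding label_prog_def den.simps(4) s1_def[symmetric]
  proof (rule den_PFor_induct[where I = ?I], goal_cases)
    case 1
    then show ?case using s1 by (simp add: static_def)
  next
    case 4
    have "?F 0 = {}" by auto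
    moreover have "(x, y) \<in> conn {} \<longleftrightarrow> x = y" for x y by (simp add: conn_def adj_def)
    ultimately show ?case using init by (simp add: s1_def)
  next
    case (5 k t)
    have t: "fst t ''n'' 0 = n" "fst t ''end1'' = a" "fst t ''end2'' = b" "fst t ''tree'' = fst s ''tree''"
      "fst t ''skip'' 0 = ?skip" "fst t ''k'' 0 = k"
      using 5 s1 fr by (auto simp: frame_def static_def)
    show ?case
    proof (cases "k \<in> chosen s - {?skip}")
      case True
      have F: "?F (Suc k) = insert k (?F k)" using True by (auto simp: less_Suc_eq)
      have ab: "a k < n" "b k < n" using ends 5(1) by auto
      have c: "(x, y) \<in> conn (?F k) \<longleftrightarrow> fst t ''lab'' x = fst t ''lab'' y" if "x < n" "y < n" for x y
        using 5(4) that by blast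
      have k: "fst s ''tree'' k \<noteq> 0" "k \<noteq> ?skip" using True by (auto simp: chosen_def)
      show ?thesis unfolding F conn_insert
      proof (intro allI impI)
        fix x y assume xy: "x < n" "y < n"
        show "fst (nupd ''k'' 0 (Suc k) (den ?body t)) ''lab'' x = fst (nupd ''k'' 0 (Suc k) (den ?body t)) ''lab'' y
          \<longleftrightarrow> (x, y) \<in> conn (?F k) \<or> (x, a k) \<in> conn (?F k) \<and> (b k, y) \<in> conn (?F k) \<or>
            (x, b k) \<in> conn (?F k) \<and> (a k, y) \<in> conn (?F k)"
          unfolding c[OF xy] c[OF xy(1) ab(1)] c[OF ab(2) xy(2)] c[OF xy(1) ab(2)] c[OF ab(1) xy(2)]
          using k xy by (auto simp: t den_relabel_prog)
      qed
    next
      case False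
      then have "?F (Suc k) = ?F k" by (auto simp: less_Suc_eq)
      moreover have "den ?body t = t" using False 5(1) by (auto simp: t chosen_def)
      ultimately show ?thesis using 5(4) by simp
    qed
  qed simp_all
  moreover have "?F m = chosen s - {?skip}" by (auto simp: chosen_def)
  ultimately show ?thesis using xy by simp
qed

lemma label_prog_swap:
  assumes s: "static s" and T: "tree (chosen s)" and e: "fst s ''skip'' 0 \<in> chosen s"
    and f: "f < m" "fst s ''tree'' f = 0"
  shows "fst (den label_prog s) ''lab'' (a f) = fst (den label_prog s) ''lab'' (b f)
    \<longleftrightarrow> \<not> tree (swap (chosen s) (fst s ''skip'' 0) f)"
  using label_prog[OF s ends[OF f(1)]] tree_swap_iff[OF T e, of f] f by (simp add: chosen_def)

lemma rval_pexp: "static s \<Longrightarrow> rval (pexp e) s = pcost (snd s ''lam'') (nval e s)"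
  by (simp add: pexp_def static_def pcost_def)

lemma bval_separated: "static s \<Longrightarrow> bval (separated f) s \<longleftrightarrow>
    fst s ''lab'' (a (nval f s)) \<noteq> fst s ''lab'' (b (nval f s))"
  by (simp add: separated_def static_def)

lemma pick_loop:
  fixes s defines "s' \<equiv> den (PFor ''f'' ''m'' pick_body) s"
    and "C \<equiv> {f. f < m \<and> fst s ''lab'' (a f) \<noteq> fst s ''lab'' (b f)}"
  assumes s: "static s" and found: "fst s ''found'' 0 = 0"
  shows "fst s' ''found'' 0 = 0 \<Longrightarrow> C = {}"
    and "fst s' ''found'' 0 \<noteq> 0 \<Longrightarrow> fst s' ''best'' 0 \<in> C \<and>
      (\<forall>f\<in>C. pcost (snd s ''lam'') (fst s' ''best'' 0) \<le> pcost (snd s ''lam'') f)"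
proof -
  let ?w = "pcost (snd s ''lam'')"
  let ?I = "\<lambda>k t. (fst t ''found'' 0 = 0 \<longrightarrow> {f \<in> C. f < k} = {}) \<and>
    (fst t ''found'' 0 \<noteq> 0 \<longrightarrow> fst t ''best'' 0 \<in> C \<and> (\<forall>f\<in>C. f < k \<longrightarrow> ?w (fst t ''best'' 0) \<le> ?w f))"
  have "?I m s'" unfolding s'_def
  proof (rule den_PFor_induct[where I = ?I], goal_cases)
    case (5 k t)
    have t: "static t" by (rule static_frame[OF 5(3) s]) auto
    have fr: "fst t ''lab'' = fst s ''lab''" "snd t ''lam'' = snd s ''lam''"
      using 5(3) by (auto simp: frame_def)
    have sep: "bval (separated (V ''f'')) t \<longleftrightarrow> k \<in> C"
      using 5(1,2) by (simp add: bval_separated[OF t] C_def fr)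
    show ?case
    proof (cases "k \<in> C \<and> (fst t ''found'' 0 = 0 \<or> ?w k < ?w (fst t ''best'' 0))")
      case True
      then have "fst (den pick_body t) ''found'' 0 = 1" "fst (den pick_body t) ''best'' 0 = k"
        using 5(2) by (simp_all add: pick_body_def sep rval_pexp[OF t] fr)
      moreover have "?w k \<le> ?w f" if "f \<in> C" "f < Suc k" for f
        using 5(4) True that by (cases "f = k") force+
      ultimately show ?thesis using True by simp
    next
      case False
      then have "den pick_body t = t"
        using 5(2) by (auto simp: pick_body_def sep rval_pexp[OF t] fr)
      moreover have "?w (fst t ''best'' 0) \<le> ?w f" if "f \<in> C" "f < Suc k" "fst t ''found'' 0 \<noteq> 0" for f
        using 5(4) False that by (cases "f = k") force+
      moreover have "{f \<in> C. f < Suc k} = {}" if "fst t ''found'' 0 = 0"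
        using 5(4) False that by (auto simp: less_Suc_eq)
      ultimately show ?thesis using 5(4) by simp
    qed
  qed (use s found in \<open>auto simp: static_def\<close>)
  moreover have "{f \<in> C. f < m} = C" by (auto simp: C_def)
  moreover have "f < m" if "f \<in> C" for f using that by (simp add: C_def)
  ultimately show "fst s' ''found'' 0 = 0 \<Longrightarrow> C = {}"
    "fst s' ''found'' 0 \<noteq> 0 \<Longrightarrow> fst s' ''best'' 0 \<in> C \<and> (\<forall>f\<in>C. ?w (fst s' ''best'' 0) \<le> ?w f)"
    by auto
qed

lemma kruskal_body:
  assumes s: "static s"
  shows "if crossing (chosen s) = {} then chosen (den kruskal_body s) = chosen s
    else \<exists>k\<in>crossing (chosen s). (\<forall>j\<in>crossing (chosen s). pcost (snd s ''lam'') k \<le> pcost (snd s ''lam'') j) \<and>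
      chosen (den kruskal_body s) = insert k (chosen s)"
proof -
  define s1 where "s1 = nupd ''skip'' 0 m s"
  define s2 where "s2 = nupd ''found'' 0 0 (den label_prog s1)"
  define s3 where "s3 = den (PFor ''f'' ''m'' pick_body) s2"
  have den: "den kruskal_body s = den (PCond (bpos (V ''found'')) (PNat ''tree'' (V ''best'') (NConst 1)) PSkip) s3"
    using s by (simp add: kruskal_body_def s1_def s2_def s3_def static_def)
  have f1: "frame {''skip''} {} s s1" by (simp add: s1_def frame_nupd)
  have s1: "static s1" by (rule static_frame[OF f1 s]) auto
  have f2: "frame {''i'', ''lab'', ''k'', ''p'', ''q'', ''found''} {} s1 s2"
    unfolding s2_def by (rule frame_trans[OF frame_mono[OF frame_den] frame_nupd]) auto
  have s2: "static s2" by (rule static_frame[OF f2 s1]) auto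
  have f3: "frame {''f'', ''found'', ''best''} {} s2 s3"
    unfolding s3_def by (rule frame_mono[OF frame_den]) auto
  have ch: "chosen s1 = chosen s" "chosen s2 = chosen s" "chosen s3 = chosen s"
    using chosen_frame[OF f1] chosen_frame[OF f2] chosen_frame[OF f3] by simp_all
  have lam: "snd s2 ''lam'' = snd s ''lam''" using f1 f2 by (simp add: frame_def)
  have "fst s1 ''skip'' 0 = m" by (simp add: s1_def)
  moreover have "m \<notin> chosen s" by (simp add: chosen_def)
  ultimately have "{f. f < m \<and> fst s2 ''lab'' (a f) \<noteq> fst s2 ''lab'' (b f)} = crossing (chosen s)"
    using label_prog[OF s1 ends] ch(1) by (auto simp: s2_def crossing_def)
  note pick = pick_loop[OF s2, folded s3_def, unfolded this lam]
  have "fst s2 ''found'' 0 = 0" by (simp add: s2_def)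
  note pick = pick[OF this]
  show ?thesis
  proof (cases "fst s3 ''found'' 0 = 0")
    case True
    then show ?thesis using pick(1) ch by (simp add: den)
  next
    case False
    note p = pick(2)[OF False]
    have "chosen (den kruskal_body s) = insert (fst s3 ''best'' 0) (chosen s3)"
      using False p by (auto simp: den chosen_def crossing_def)
    then show ?thesis using p ch by auto
  qed
qed

lemma kruskal_prog:
  fixes s defines "F \<equiv> chosen (den kruskal_prog s)"
  assumes s: "static s" and init: "chosen s = {}"
  shows "forest F" "crossing F = {}"
    "tree T \<Longrightarrow> \<exists>T\<in>min_bases (pcost (snd s ''lam'')). F \<subseteq> T"
proof -
  let ?w = "pcost (snd s ''lam'')"
  \<comment> \<open>A round with a crossing edge left adds an edge. So after \<open>m\<close> rounds
    no edge crosses, or all \<open>m\<close> edges are chosen and again none crosses. A minimum tree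
    around the chosen edges exists only if there are spanning trees at all, hence the
    implication.\<close>
  let ?I = "\<lambda>k t. forest (chosen t) \<and> (crossing (chosen t) = {} \<or> k \<le> card (chosen t)) \<and>
    ((\<exists>T. tree T) \<longrightarrow> (\<exists>T\<in>min_bases ?w. chosen t \<subseteq> T))"
  have I: "?I m (den kruskal_prog s)" unfolding kruskal_prog_def
  proof (rule den_PFor_induct[where I = ?I], goal_cases)
    case 4
    have "chosen (nupd ''j'' 0 0 s) = {}" using init by (simp add: chosen_def)
    then show ?case using min_bases_nonempty[OF finite_trees, of ?w] by (auto simp: forest_def)
  next
    case (5 k t)
    have t: "static t" by (rule static_frame[OF 5(3) s]) auto
    have lam: "snd t ''lam'' = snd s ''lam''" using 5(3) by (simp add: frame_def)
    have ch: "chosen (nupd ''j'' 0 (Suc k) (den kruskal_body t)) = chosen (den kruskal_body t)"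
      by (simp add: chosen_def)
    show ?case
    proof (cases "crossing (chosen t) = {}")
      case True
      then show ?thesis using kruskal_body[OF t] 5(4) by (simp add: ch)
    next
      case False
      then obtain x where x: "x \<in> crossing (chosen t)"
        "\<And>j. j \<in> crossing (chosen t) \<Longrightarrow> ?w x \<le> ?w j"
        "chosen (den kruskal_body t) = insert x (chosen t)"
        using kruskal_body[OF t] lam by auto
      have nc: "(a x, b x) \<notin> conn (chosen t)" using x(1) by (simp add: crossing_def)
      then have "x \<notin> chosen t" using conn_edge[of x "chosen t"] by auto
      moreover have "finite (chosen t)" by (simp add: chosen_def)
      ultimately have "Suc k \<le> card (insert x (chosen t))" using 5(4) False by simp
      moreover have "forest (insert x (chosen t))" using forest_insert[OF _ nc] 5(4) by simp
      moreover have "(\<exists>T. tree T) \<longrightarrow> (\<exists>T\<in>min_bases ?w. insert x (chosen t) \<subseteq> T)"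
        using kruskal_step[OF _ _ x(1), of _ ?w] x(2) 5(4) by blast
      ultimately show ?thesis by (simp add: ch x(3))
    qed
  qed (use s in \<open>auto simp: static_def\<close>)
  then show "forest F" "tree T \<Longrightarrow> \<exists>T\<in>min_bases ?w. F \<subseteq> T" by (auto simp: F_def)
  show "crossing F = {}"
  proof (rule ccontr)
    assume ne: "crossing F \<noteq> {}"
    have sub: "F \<subseteq> {..<m}" by (auto simp: F_def chosen_def)
    moreover have "card {..<m} \<le> card F" using I ne by (simp add: F_def)
    ultimately have "F = {..<m}" by (intro card_seteq) auto
    then show False using ne conn_edge[of _ F] by (auto simp: crossing_def)
  qed
qed

end

section \<open>Breadth-first search\<close>

definition count_body :: prog where
  "count_body = PCond (bpos (NCell ''tree'' (V ''k'')))
     (PNat ''deg'' (NCell ''cls'' (V ''k'')) (NAdd (NCell ''deg'' (NCell ''cls'' (V ''k''))) (NConst 1))) PSkip"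

definition count_prog :: prog where
  "count_prog = PFor ''v'' ''n1'' (PNat ''deg'' (V ''v'') (NConst 0)) ;; PFor ''k'' ''m'' count_body"

definition cap_body :: prog where
  "cap_body =
     PCond (RLess (RCell ''lam'' (V ''v'')) (RConst 0))
       (PNat ''cap'' (V ''v'') (NCell ''lower'' (V ''v''))) (PNat ''cap'' (V ''v'') (NCell ''upper'' (V ''v''))) ;;
     PCond (NLess (NCell ''cap'' (V ''v'')) (NCell ''deg'' (V ''v'')))
       (PNat ''lev'' (V ''v'') (NConst 1)) (PNat ''lev'' (V ''v'') (NConst 0))"

definition cap_prog :: prog where
  "cap_prog = PFor ''v'' ''n1'' cap_body"

text \<open>In a minimum tree no exchange lowers the priced cost, so excluding \<open><\<close> leaves equality.\<close>

definition bfs_f_body :: prog where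
  "bfs_f_body = PCond
     (BAnd (BAnd (beq (NCell ''tree'' (V ''f'')) (NConst 0)) (separated (V ''f'')))
       (BAnd (BNot (RLess (pexp (V ''e'')) (pexp (V ''f''))))
         (beq (NCell ''lev'' (NCell ''cls'' (V ''f''))) (NConst 0))))
     (PNat ''lev'' (NCell ''cls'' (V ''f'')) (NAdd (V ''r'') (NConst 2)) ;;
      PNat ''pe'' (NCell ''cls'' (V ''f'')) (V ''e'') ;;
      PNat ''pf'' (NCell ''cls'' (V ''f'')) (V ''f'')) PSkip"

definition bfs_e_body :: prog where
  "bfs_e_body = PCond
     (BAnd (bpos (NCell ''tree'' (V ''e'')))
       (beq (NCell ''lev'' (NCell ''cls'' (V ''e''))) (NAdd (V ''r'') (NConst 1))))
     (PNat ''skip'' (NConst 0) (V ''e'') ;; label_prog ;; PFor ''f'' ''m'' bfs_f_body) PSkip"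

text \<open>Levels start at 1, so round \<open>r\<close> expands the classes of level
  \<open>r + 1\<close> and gives new ones level \<open>r + 2\<close>. With class \<open>n\<close>
  there are \<open>n + 1\<close> classes, so \<open>n + 1\<close> rounds exhaust the search.\<close>

definition bfs_prog :: prog where
  "bfs_prog = PFor ''r'' ''n1'' (PFor ''e'' ''m'' bfs_e_body)"

lemma nwr_count_body [simp]: "nwr count_body = {''deg''}"
  and rwr_count_body [simp]: "rwr count_body = {}"
  by (auto simp: count_body_def)

lemma nwr_count_prog [simp]: "nwr count_prog = {''v'', ''k'', ''deg''}"
  and rwr_count_prog [simp]: "rwr count_prog = {}"
  by (auto simp: count_prog_def)

lemma nwr_cap_body [simp]: "nwr cap_body = {''cap'', ''lev''}"
  and rwr_cap_body [simp]: "rwr cap_body = {}"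
  by (auto simp: cap_body_def)

lemma nwr_cap_prog [simp]: "nwr cap_prog = {''v'', ''cap'', ''lev''}"
  and rwr_cap_prog [simp]: "rwr cap_prog = {}"
  by (auto simp: cap_prog_def)

lemma nwr_bfs_f_body [simp]: "nwr bfs_f_body = {''lev'', ''pe'', ''pf''}"
  and rwr_bfs_f_body [simp]: "rwr bfs_f_body = {}"
  by (auto simp: bfs_f_body_def)

lemma nwr_bfs_e_body [simp]:
  "nwr bfs_e_body = {''skip'', ''i'', ''lab'', ''k'', ''p'', ''q'', ''f'', ''lev'', ''pe'', ''pf''}"
  and rwr_bfs_e_body [simp]: "rwr bfs_e_body = {}"
  by (auto simp: bfs_e_body_def)

lemma nwr_bfs_prog [simp]:
  "nwr bfs_prog = {''r'', ''e'', ''skip'', ''i'', ''lab'', ''k'', ''p'', ''q'', ''f'', ''lev'', ''pe'', ''pf''}"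
  and rwr_bfs_prog [simp]: "rwr bfs_prog = {}"
  by (auto simp: bfs_prog_def)

section \<open>Correctness of the search\<close>

context priced_graph begin

lemma count_prog:
  assumes s: "static s" and v: "v \<le> n"
  shows "fst (den count_prog s) ''deg'' v = cnt (chosen s) v"
proof -
  let ?init = "PFor ''v'' ''n1'' (PNat ''deg'' (V ''v'') (NConst 0))"
  let ?I0 = "\<lambda>k t. \<forall>v<k. fst t ''deg'' v = 0"
  have init: "?I0 (n + 1) (den ?init s)"
    by (rule den_PFor_induct[where I = ?I0]) (use s in \<open>auto simp: less_Suc_eq static_def\<close>)
  define s1 where "s1 = den ?init s"
  have fr: "frame {''v'', ''deg''} {} s s1" using frame_den[of ?init s] by (simp add: s1_def)
  have s1: "static s1" by (rule static_frame[OF fr s]) auto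
  let ?F = "\<lambda>k. {j \<in> chosen s. j < k}"
  let ?I = "\<lambda>k t. \<forall>v\<le>n. fst t ''deg'' v = cnt (?F k) v"
  have "?I m (den count_prog s)" unfolding count_prog_def den.simps(4) s1_def[symmetric]
  proof (rule den_PFor_induct[where I = ?I], goal_cases)
    case 4
    then show ?case using init by (simp add: s1_def cnt_def)
  next
    case (5 k t)
    have t: "fst t ''cls'' = cl" "fst t ''tree'' = fst s ''tree''" "fst t ''k'' 0 = k"
      using 5 s1 fr by (auto simp: frame_def static_def)
    show ?case
    proof (cases "k \<in> chosen s")
      case True
      then have F: "?F (Suc k) = insert k (?F k)" by (auto simp: less_Suc_eq)
      have "cnt (?F (Suc k)) v = cnt (?F k) v + of_bool (v = cl k)" for v
      proof -
        have "{j \<in> insert k (?F k). cl j = v} =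
          (if v = cl k then insert k {j \<in> ?F k. cl j = v} else {j \<in> ?F k. cl j = v})" by auto
        then show ?thesis unfolding F cnt_def by (simp add: chosen_def)
      qed
      then show ?thesis using 5(4) True by (auto simp: count_body_def t chosen_def)
    next
      case False
      then have "?F (Suc k) = ?F k" by (auto simp: less_Suc_eq)
      then show ?thesis using 5(1,4) False by (simp add: count_body_def t chosen_def)
    qed
  qed (use s1 in \<open>auto simp: static_def\<close>)
  moreover have "?F m = chosen s" by (auto simp: chosen_def)
  ultimately show ?thesis using v by simp
qed

lemma cap_prog:
  assumes s: "static s" and v: "v \<le> n"
  shows "fst (den cap_prog s) ''cap'' v = cap (snd s ''lam'') v"
    and "fst (den cap_prog s) ''lev'' v = of_bool (cap (snd s ''lam'') v < fst s ''deg'' v)"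
proof -
  let ?I = "\<lambda>k t. \<forall>v<k. fst t ''cap'' v = cap (snd s ''lam'') v \<and>
    fst t ''lev'' v = of_bool (cap (snd s ''lam'') v < fst s ''deg'' v)"
  have "?I (n + 1) (den cap_prog s)" unfolding cap_prog_def
  proof (rule den_PFor_induct[where I = ?I], goal_cases)
    case (5 k t)
    have t: "fst t ''lower'' = lo" "fst t ''upper'' = up" "snd t ''lam'' = snd s ''lam''"
      "fst t ''deg'' = fst s ''deg''" "fst t ''v'' 0 = k"
      using 5 s by (auto simp: frame_def static_def)
    show ?case using 5(4) by (auto simp: cap_body_def t cap_def less_Suc_eq)
  qed (use s in \<open>auto simp: static_def\<close>)
  then show "fst (den cap_prog s) ''cap'' v = cap (snd s ''lam'') v"
    "fst (den cap_prog s) ''lev'' v = of_bool (cap (snd s ''lam'') v < fst s ''deg'' v)"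
    using v by auto
qed

text \<open>The situation within one round of the search: \<open>lev0\<close> holds the levels at
  the start of the round, and \<open>l\<close> is the level given to the classes discovered in
  it.\<close>

definition grown :: "nat set \<Rightarrow> (nat \<Rightarrow> real) \<Rightarrow> (nat \<Rightarrow> nat) \<Rightarrow> nat \<Rightarrow> state \<Rightarrow> bool" where
  "grown T lam lev0 l t \<longleftrightarrow>
     (\<forall>v. lev0 v \<noteq> 0 \<longrightarrow> fst t ''lev'' v = lev0 v) \<and>
     (\<forall>v. lev0 v = 0 \<longrightarrow> fst t ''lev'' v = 0 \<or> fst t ''lev'' v = l) \<and>
     (\<forall>l. parents T lam (fst t ''lev'') (fst t ''pe'') (fst t ''pf'') l)"

lemma grown_nupd [simp]:
  assumes "x \<noteq> ''lev''" "x \<noteq> ''pe''" "x \<noteq> ''pf''"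
  shows "grown T lam lev0 l (nupd x i k t) \<longleftrightarrow> grown T lam lev0 l t"
  using assms by (simp add: grown_def)

lemma grown_frame:
  assumes "frame W R t t'" "''lev'' \<notin> W" "''pe'' \<notin> W" "''pf'' \<notin> W"
  shows "grown T lam lev0 l t' \<longleftrightarrow> grown T lam lev0 l t"
  using assms by (simp add: grown_def frame_def)

lemma bfs_f_loop:
  fixes s defines "s' \<equiv> den (PFor ''f'' ''m'' bfs_f_body) s"
    and "T \<equiv> chosen s" and "lam \<equiv> snd s ''lam''" and "e \<equiv> fst s ''e'' 0" and "r \<equiv> fst s ''r'' 0"
  assumes s: "static s" and T: "T \<in> min_bases (pcost lam)" and e: "e \<in> T" "lev0 (cl e) = r + 1"
    and lab: "\<And>f. \<lbrakk>f < m; f \<notin> T\<rbrakk> \<Longrightarrow> fst s ''lab'' (a f) \<noteq> fst s ''lab'' (b f) \<longleftrightarrow> tree (swap T e f)"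
    and g: "grown T lam lev0 (r + 2) s"
  shows "grown T lam lev0 (r + 2) s'"
    and "\<And>f. \<lbrakk>f \<notin> T; swap T e f \<in> min_bases (pcost lam)\<rbrakk> \<Longrightarrow> fst s' ''lev'' (cl f) \<noteq> 0"
    and "\<And>v. fst s ''lev'' v \<noteq> 0 \<Longrightarrow> fst s' ''lev'' v \<noteq> 0"
proof -
  let ?I = "\<lambda>k t. grown T lam lev0 (r + 2) t \<and> (\<forall>v. fst s ''lev'' v \<noteq> 0 \<longrightarrow> fst t ''lev'' v \<noteq> 0) \<and>
    (\<forall>f<k. f \<notin> T \<longrightarrow> swap T e f \<in> min_bases (pcost lam) \<longrightarrow> fst t ''lev'' (cl f) \<noteq> 0)"
  have "?I m s'" unfolding s'_def
  proof (rule den_PFor_induct[where I = ?I], goal_cases)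
    case (5 k t)
    have t: "static t" by (rule static_frame[OF 5(3) s]) auto
    have fr: "fst t ''lab'' = fst s ''lab''" "snd t ''lam'' = lam" "fst t ''tree'' = fst s ''tree''"
      "fst t ''e'' 0 = e" "fst t ''r'' 0 = r" "fst t ''cls'' = cl"
      using 5(3) t by (auto simp: frame_def lam_def e_def r_def static_def)
    have tk: "fst s ''tree'' k = 0 \<longleftrightarrow> k \<notin> T" using 5(1) by (simp add: T_def chosen_def)
    have sep: "bval (separated (V ''f'')) t \<longleftrightarrow> tree (swap T e k)" if "k \<notin> T"
      using 5(1,2) lab[OF _ that] by (simp add: bval_separated[OF t] fr)
    have w: "bval (RLess (pexp (V ''e'')) (pexp (V ''f''))) t \<longleftrightarrow> pcost lam e < pcost lam k"
      using 5(2) by (simp add: rval_pexp[OF t] fr)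
    let ?c = "bval (BAnd (BAnd (beq (NCell ''tree'' (V ''f'')) (NConst 0)) (separated (V ''f'')))
       (BAnd (BNot (RLess (pexp (V ''e'')) (pexp (V ''f''))))
         (beq (NCell ''lev'' (NCell ''cls'' (V ''f''))) (NConst 0)))) t"
    have c: "?c \<longleftrightarrow> k \<notin> T \<and> swap T e k \<in> min_bases (pcost lam) \<and> fst t ''lev'' (cl k) = 0"
      using sep w 5(2) tk swap_in_min_bases_iff[OF T e(1), of k] min_bases_swap_le[OF T e(1), of k]
      by (auto simp: fr)
    show ?case
    proof (cases ?c)
      case True
      let ?v = "cl k"
      have d: "fst (den bfs_f_body t) ''lev'' = (fst t ''lev'')(?v := r + 2)"
        "fst (den bfs_f_body t) ''pe'' = (fst t ''pe'')(?v := e)"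
        "fst (den bfs_f_body t) ''pf'' = (fst t ''pf'')(?v := k)"
        using True 5(2) by (auto simp: bfs_f_body_def fr)
      have k: "k \<notin> T" "swap T e k \<in> min_bases (pcost lam)" "fst t ''lev'' ?v = 0" using True c by auto
      have lev0: "lev0 ?v = 0" using 5(4) k(3) unfolding grown_def by metis
      have leve: "fst t ''lev'' (cl e) = r + 1" using 5(4) e(2) by (simp add: grown_def)
      have "parents T lam ((fst t ''lev'')(?v := r + 2)) ((fst t ''pe'')(?v := e)) ((fst t ''pf'')(?v := k)) l" for l
        unfolding parents_def
      proof (intro allI impI)
        fix u assume u: "u \<le> n" "1 < ((fst t ''lev'')(?v := r + 2)) u \<and> ((fst t ''lev'')(?v := r + 2)) u \<le> l"
        let ?P = "\<lambda>lev pe pf. pe u \<in> T \<and> pf u \<notin> T \<and> swap T (pe u) (pf u) \<in> min_bases (pcost lam) \<and>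
          cl (pf u) = u \<and> lev u = Suc (lev (cl (pe u)))"
        show "?P ((fst t ''lev'')(?v := r + 2)) ((fst t ''pe'')(?v := e)) ((fst t ''pf'')(?v := k))"
        proof (cases "u = ?v")
          case True
          have "cl e \<noteq> ?v" using leve k(3) by auto
          then show ?thesis using True e(1) k leve by simp
        next
          case False
          then have "?P (fst t ''lev'') (fst t ''pe'') (fst t ''pf'')"
            using 5(4) u unfolding grown_def parents_def by auto
          \<comment> \<open>The parent class of \<open>u\<close> has positive level while
            \<open>?v\<close> still has level 0, so the update at \<open>?v\<close> does not affect
            the record of \<open>u\<close>.\<close>
          moreover from this have "cl (fst t ''pe'' u) \<noteq> ?v" using k(3) u False by auto
          ultimately show ?thesis using False by simp
        qed
      qed
      then have "grown T lam lev0 (r + 2) (den bfs_f_body t)"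
        using 5(4) lev0 by (auto simp: grown_def d)
      then show ?thesis using 5(4) by (auto simp: d less_Suc_eq)
    next
      case False
      then have "den bfs_f_body t = t" by (simp only: bfs_f_body_def den.simps if_False)
      moreover have "k \<notin> T \<Longrightarrow> swap T e k \<in> min_bases (pcost lam) \<Longrightarrow> fst t ''lev'' (cl k) \<noteq> 0"
        using False unfolding c by auto
      ultimately show ?thesis using 5(4) by (auto simp: less_Suc_eq)
    qed
  qed (use s g in \<open>auto simp: static_def\<close>)
  then show "grown T lam lev0 (r + 2) s'" "\<And>v. fst s ''lev'' v \<noteq> 0 \<Longrightarrow> fst s' ''lev'' v \<noteq> 0"
    "\<And>f. \<lbrakk>f \<notin> T; swap T e f \<in> min_bases (pcost lam)\<rbrakk> \<Longrightarrow> fst s' ''lev'' (cl f) \<noteq> 0"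
    using min_basesD(2) by (auto simp: swap_def subset_iff)
qed

lemma bfs_e_loop:
  fixes s defines "s' \<equiv> den (PFor ''e'' ''m'' bfs_e_body) s"
    and "T \<equiv> chosen s" and "lam \<equiv> snd s ''lam''" and "lev0 \<equiv> fst s ''lev''" and "r \<equiv> fst s ''r'' 0"
  assumes s: "static s" and T: "T \<in> min_bases (pcost lam)"
    and par: "\<And>l. parents T lam lev0 (fst s ''pe'') (fst s ''pf'') l"
  shows "grown T lam lev0 (r + 2) s'"
    and "\<And>v u. \<lbrakk>(v, u) \<in> tight T lam; lev0 v = r + 1\<rbrakk> \<Longrightarrow> fst s' ''lev'' u \<noteq> 0"
proof -
  let ?I = "\<lambda>k t. grown T lam lev0 (r + 2) t \<and>
    (\<forall>e\<in>T. \<forall>f. e < k \<longrightarrow> f \<notin> T \<longrightarrow> swap T e f \<in> min_bases (pcost lam) \<longrightarrow> lev0 (cl e) = r + 1 \<longrightarrow>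
      fst t ''lev'' (cl f) \<noteq> 0)"
  have I: "?I m s'" unfolding s'_def
  proof (rule den_PFor_induct[where I = ?I], goal_cases)
    case (5 k t)
    have t: "static t" by (rule static_frame[OF 5(3) s]) auto
    have fr: "snd t ''lam'' = lam" "fst t ''tree'' = fst s ''tree''" "fst t ''r'' 0 = r" "fst t ''cls'' = cl"
      using 5(3) t by (auto simp: frame_def lam_def r_def static_def)
    have ch: "chosen t = T" by (simp add: T_def chosen_def fr)
    \<comment> \<open>New classes get level \<open>r + 2\<close>, so the set of classes to be
      expanded does not change during the round.\<close>
    have lev: "fst t ''lev'' v = r + 1 \<longleftrightarrow> lev0 v = r + 1" for v
    proof (cases "lev0 v = 0")
      case True
      then have "fst t ''lev'' v = 0 \<or> fst t ''lev'' v = r + 2" using 5(4) unfolding grown_def by blast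
      then show ?thesis using True by auto
    next
      case False
      then show ?thesis using 5(4) unfolding grown_def by auto
    qed
    have c: "bval (BAnd (bpos (NCell ''tree'' (V ''e'')))
       (beq (NCell ''lev'' (NCell ''cls'' (V ''e''))) (NAdd (V ''r'') (NConst 1)))) t \<longleftrightarrow>
      k \<in> T \<and> lev0 (cl k) = r + 1"
      using 5(1,2) lev[of "cl k"] by (auto simp: fr T_def chosen_def)
    show ?case
    proof (cases "k \<in> T \<and> lev0 (cl k) = r + 1")
      case True
      define t1 where "t1 = nupd ''skip'' 0 k t"
      define t2 where "t2 = den label_prog t1"
      have den: "den bfs_e_body t = den (PFor ''f'' ''m'' bfs_f_body) t2"
        using True c 5(2) by (simp add: bfs_e_body_def t1_def t2_def del: bval.simps)
      have f1: "frame {''skip''} {} t t1" by (simp add: t1_def frame_nupd)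
      have t1: "static t1" by (rule static_frame[OF f1 t]) auto
      have f2: "frame {''i'', ''lab'', ''k'', ''p'', ''q''} {} t1 t2"
        unfolding t2_def by (rule frame_mono[OF frame_den]) auto
      have t2: "static t2" by (rule static_frame[OF f2 t1]) auto
      have chs: "chosen t1 = T" "chosen t2 = T"
        using chosen_frame[OF f1] chosen_frame[OF f2] ch by auto
      have q: "snd t2 ''lam'' = lam" "fst t2 ''e'' 0 = k" "fst t2 ''r'' 0 = r" "fst t1 ''skip'' 0 = k"
        using f1 f2 fr 5(2) by (auto simp: frame_def t1_def)
      have g: "grown T lam lev0 (r + 2) t2"
        using 5(4) grown_frame[OF f1] grown_frame[OF f2] by simp
      have "fst t2 ''lab'' (a f) \<noteq> fst t2 ''lab'' (b f) \<longleftrightarrow> tree (swap T k f)" if "f < m" "f \<notin> T" for f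
      proof -
        have "fst t1 ''tree'' f = 0" using that chs(1) by (auto simp: chosen_def)
        then show ?thesis using label_prog_swap[OF t1, of f] that True min_basesD(1)[OF T] chs(1) q(4)
          by (simp add: t2_def)
      qed
      from bfs_f_loop[OF t2, unfolded chs q, of lev0, OF T _ _ this g] True
      have r: "grown T lam lev0 (r + 2) (den bfs_e_body t)"
        "\<And>f. \<lbrakk>f \<notin> T; swap T k f \<in> min_bases (pcost lam)\<rbrakk> \<Longrightarrow> fst (den bfs_e_body t) ''lev'' (cl f) \<noteq> 0"
        "\<And>v. fst t2 ''lev'' v \<noteq> 0 \<Longrightarrow> fst (den bfs_e_body t) ''lev'' v \<noteq> 0"
        by (auto simp: den)
      moreover have "fst t2 ''lev'' = fst t ''lev''" using f1 f2 by (simp add: frame_def)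
      ultimately have "fst (den bfs_e_body t) ''lev'' v \<noteq> 0" if "fst t ''lev'' v \<noteq> 0" for v
        using that by simp
      then show ?thesis using r 5(4) by (auto simp: less_Suc_eq)
    next
      case False
      then have "den bfs_e_body t = t" unfolding c[symmetric] by (simp only: bfs_e_body_def den.simps if_False)
      then show ?thesis using 5(4) False by (auto simp: less_Suc_eq)
    qed
  qed (use s par in \<open>auto simp: static_def grown_def lev0_def\<close>)
  show "grown T lam lev0 (r + 2) s'" using I by simp
  fix v u assume "(v, u) \<in> tight T lam" and v: "lev0 v = r + 1"
  then obtain e f where e: "v = cl e" "u = cl f" "e \<in> T" "f \<notin> T" "swap T e f \<in> min_bases (pcost lam)"
    by (auto simp: tight_def)
  have "e < m" using min_basesD(2)[OF T] e by auto
  then show "fst s' ''lev'' u \<noteq> 0" using I e v by blast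
qed

text \<open>Exchanges out of level \<open>r + 1\<close> are still unexamined, hence the restriction
  to levels up to \<open>r\<close>. The last conjunct bounds the depth: a class on level
  \<open>r + 1\<close> has predecessors on all levels below, so at least \<open>r + 1\<close>
  classes are reached.\<close>

definition bfs_inv :: "nat set \<Rightarrow> (nat \<Rightarrow> real) \<Rightarrow> nat \<Rightarrow> state \<Rightarrow> bool" where
  "bfs_inv T lam r t \<longleftrightarrow> (\<forall>v\<le>n. fst t ''lev'' v \<le> r + 1) \<and>
     (\<forall>v\<le>n. fst t ''lev'' v = 1 \<longleftrightarrow> v \<in> sources T lam) \<and>
     (\<forall>l. parents T lam (fst t ''lev'') (fst t ''pe'') (fst t ''pf'') l) \<and>
     (\<forall>v u. (v, u) \<in> tight T lam \<and> fst t ''lev'' v \<noteq> 0 \<and> fst t ''lev'' v \<le> r \<longrightarrow>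
       fst t ''lev'' u \<noteq> 0 \<and> fst t ''lev'' u \<le> Suc (fst t ''lev'' v)) \<and>
     ((\<exists>v\<le>n. fst t ''lev'' v = r + 1) \<longrightarrow> r + 1 \<le> card {v. v \<le> n \<and> fst t ''lev'' v \<noteq> 0})"

lemma bfs_prog:
  fixes s defines "s' \<equiv> den bfs_prog s" and "T \<equiv> chosen s" and "lam \<equiv> snd s ''lam''"
  assumes s: "static s" and T: "T \<in> min_bases (pcost lam)"
    and lev: "\<forall>v\<le>n. fst s ''lev'' v = of_bool (v \<in> sources T lam)"
  shows "valid_levels T lam (fst s' ''lev'')"
    and "parents T lam (fst s' ''lev'') (fst s' ''pe'') (fst s' ''pf'') l"
    and "v \<le> n \<Longrightarrow> fst s' ''lev'' v = 1 \<longleftrightarrow> v \<in> sources T lam"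
    and "v \<le> n \<Longrightarrow> fst s' ''lev'' v \<le> n + 2"
proof -
  have tight_n: "v \<le> n" "u \<le> n" if "(v, u) \<in> tight T lam" for v u
    using that tight_le min_basesD(2)[OF T] cl_le by (auto simp: tight_def)
  have I: "bfs_inv T lam (n + 1) s'" unfolding s'_def bfs_prog_def
  proof (rule den_PFor_induct[where I = "bfs_inv T lam"], goal_cases)
    case 4
    have "parents T lam (fst s ''lev'') pe pf l" for pe pf l
      using lev by (auto simp: parents_def)
    moreover have "1 \<le> card {v. v \<le> n \<and> fst s ''lev'' v \<noteq> 0}" if "v \<le> n" "fst s ''lev'' v = 1" for v
    proof -
      have "card {v} \<le> card {v. v \<le> n \<and> fst s ''lev'' v \<noteq> 0}" using that by (intro card_mono) auto
      then show ?thesis by simp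
    qed
    ultimately show ?case using lev by (auto simp: bfs_inv_def)
  next
    case (5 r t)
    have t: "static t" by (rule static_frame[OF 5(3) s]) auto
    have fr: "snd t ''lam'' = lam" "chosen t = T" "fst t ''r'' 0 = r"
      using 5(2,3) by (auto simp: frame_def lam_def T_def chosen_def)
    let ?lev = "fst t ''lev''"
    define t' where "t' = den (PFor ''e'' ''m'' bfs_e_body) t"
    let ?lev' = "fst t' ''lev''"
    have par: "\<And>l. parents T lam ?lev (fst t ''pe'') (fst t ''pf'') l" using 5(4) by (simp add: bfs_inv_def)
    note loop = bfs_e_loop[OF t, unfolded fr, OF T par, folded t'_def]
    have old: "?lev' v = ?lev v" if "?lev v \<noteq> 0" for v
      using loop(1) that by (simp add: grown_def)
    have new: "?lev' v = 0 \<or> ?lev' v = r + 2" if "?lev v = 0" for v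
      using loop(1) that by (simp add: grown_def)
    have par': "\<And>l. parents T lam ?lev' (fst t' ''pe'') (fst t' ''pf'') l"
      using loop(1) by (simp add: grown_def)
    have le: "?lev v \<le> r + 1" if "v \<le> n" for v using 5(4) that by (simp add: bfs_inv_def)
    have le': "?lev' v \<le> r + 2" if "v \<le> n" for v
      using le[OF that] old[of v] new[of v] by (cases "?lev v = 0") auto
    have src: "?lev' v = 1 \<longleftrightarrow> v \<in> sources T lam" if "v \<le> n" for v
    proof -
      have "?lev' v = 1 \<longleftrightarrow> ?lev v = 1" using old[of v] new[of v] by (cases "?lev v = 0") auto
      then show ?thesis using 5(4) that by (simp add: bfs_inv_def)
    qed
    have val: "?lev' u \<noteq> 0 \<and> ?lev' u \<le> Suc (?lev' v)"
      if vu: "(v, u) \<in> tight T lam" and v: "?lev' v \<noteq> 0" "?lev' v \<le> r + 1" for v u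
    proof -
      have nz: "?lev v \<noteq> 0" using new[of v] v by auto
      then have eq: "?lev' v = ?lev v" by (rule old)
      show ?thesis
      proof (cases "?lev v \<le> r")
        case True
        then have "?lev u \<noteq> 0 \<and> ?lev u \<le> Suc (?lev v)" using 5(4) vu nz unfolding bfs_inv_def by blast
        then show ?thesis using old[of u] eq by simp
      next
        case False
        then have "?lev v = r + 1" using v eq by simp
        then show ?thesis using loop(2)[OF vu] le'[OF tight_n(2)[OF vu]] eq by simp
      qed
    qed
    have "r + 2 \<le> card {v. v \<le> n \<and> ?lev' v \<noteq> 0}" if v: "v \<le> n" "?lev' v = r + 2" for v
    proof -
      let ?p = "cl (fst t' ''pe'' v)"
      have p: "fst t' ''pe'' v \<in> T" "?lev' v = Suc (?lev' ?p)"
        using par'[of "?lev' v"] v by (auto simp: parents_def)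
      then have pn: "?p \<le> n" and lp: "?lev' ?p = r + 1" using min_basesD(2)[OF T] cl_le v by auto
      have "?lev ?p \<noteq> 0" using new[of ?p] lp by auto
      then have "?lev ?p = r + 1" using old[of ?p] lp by simp
      then have "r + 1 \<le> card {v. v \<le> n \<and> ?lev v \<noteq> 0}" using 5(4) pn by (auto simp: bfs_inv_def)
      also have "\<dots> < card {v. v \<le> n \<and> ?lev' v \<noteq> 0}"
      proof (rule psubset_card_mono)
        have "?lev v = 0" using le[OF v(1)] old[of v] v by (cases "?lev v = 0") auto
        then have "v \<in> {v. v \<le> n \<and> ?lev' v \<noteq> 0} - {v. v \<le> n \<and> ?lev v \<noteq> 0}" using v by simp
        moreover have "{v. v \<le> n \<and> ?lev v \<noteq> 0} \<subseteq> {v. v \<le> n \<and> ?lev' v \<noteq> 0}" using old by auto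
        ultimately show "{v. v \<le> n \<and> ?lev v \<noteq> 0} \<subset> {v. v \<le> n \<and> ?lev' v \<noteq> 0}" by blast
      qed simp
      finally show ?thesis by simp
    qed
    then have "(\<exists>v\<le>n. ?lev' v = Suc r + 1) \<longrightarrow> Suc r + 1 \<le> card {v. v \<le> n \<and> ?lev' v \<noteq> 0}" by auto
    moreover have "\<forall>v\<le>n. ?lev' v \<le> Suc r + 1" using le' by simp
    moreover have "\<forall>v\<le>n. ?lev' v = 1 \<longleftrightarrow> v \<in> sources T lam" using src by blast
    moreover have "\<forall>l. parents T lam ?lev' (fst t' ''pe'') (fst t' ''pf'') l" using par' by blast
    moreover have "\<forall>v u. (v, u) \<in> tight T lam \<and> ?lev' v \<noteq> 0 \<and> ?lev' v \<le> Suc r \<longrightarrow>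
        ?lev' u \<noteq> 0 \<and> ?lev' u \<le> Suc (?lev' v)"
      using val[unfolded Suc_eq_plus1[symmetric]] by blast
    ultimately have "bfs_inv T lam (Suc r) t'" unfolding bfs_inv_def by blast
    then show ?case unfolding t'_def by (simp add: bfs_inv_def)
  qed (use s in \<open>auto simp: static_def\<close>)
  \<comment> \<open>Level \<open>n + 2\<close> would require \<open>n + 2\<close> reached classes
    among only \<open>n + 1\<close>. Hence every reached class has been expanded, and the
    restriction on levels in the invariant disappears.\<close>
  have lt: "fst s' ''lev'' v \<le> n + 1" if "v \<le> n" for v
  proof -
    have "card {v. v \<le> n \<and> fst s' ''lev'' v \<noteq> 0} \<le> card {..n}" by (intro card_mono) auto
    then have "fst s' ''lev'' v \<noteq> n + 2" using I that by (fastforce simp: bfs_inv_def)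
    moreover have "fst s' ''lev'' v \<le> n + 2" using I that by (simp add: bfs_inv_def)
    ultimately show ?thesis by simp
  qed
  show "valid_levels T lam (fst s' ''lev'')"
    unfolding valid_levels_def
  proof (intro allI impI)
    fix v u assume "(v, u) \<in> tight T lam \<and> fst s' ''lev'' v \<noteq> 0"
    then show "fst s' ''lev'' u \<noteq> 0 \<and> fst s' ''lev'' u \<le> Suc (fst s' ''lev'' v)"
      using I[unfolded bfs_inv_def] lt[of v] tight_n(1)[of v u] by blast
  qed
  show "parents T lam (fst s' ''lev'') (fst s' ''pe'') (fst s' ''pf'') l"
    "v \<le> n \<Longrightarrow> fst s' ''lev'' v = 1 \<longleftrightarrow> v \<in> sources T lam"
    "v \<le> n \<Longrightarrow> fst s' ''lev'' v \<le> n + 2"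
    using I by (simp_all add: bfs_inv_def)
qed

end

section \<open>Augmentation and price changes\<close>

definition find_body :: prog where
  "find_body =
     PCond (NLess (NCell ''cap'' (V ''v'')) (NCell ''deg'' (V ''v'')))
       (PNat ''srcs'' (NConst 0) (NConst 1)) PSkip ;;
     PCond (BAnd (bpos (NCell ''lev'' (V ''v''))) (NLess (NCell ''deg'' (V ''v'')) (NCell ''cap'' (V ''v''))))
       (PNat ''found'' (NConst 0) (NConst 1) ;; PNat ''t'' (NConst 0) (V ''v'')) PSkip"

definition find_prog :: prog where
  "find_prog = PNat ''srcs'' (NConst 0) (NConst 0) ;; PNat ''found'' (NConst 0) (NConst 0) ;;
     PFor ''v'' ''n1'' find_body"

definition augment_body :: prog where
  "augment_body = PCond (NLess (NConst 1) (NCell ''lev'' (V ''t'')))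
     (PNat ''tree'' (NCell ''pe'' (V ''t'')) (NConst 0) ;;
      PNat ''tree'' (NCell ''pf'' (V ''t'')) (NConst 1) ;;
      PNat ''t'' (NConst 0) (NCell ''cls'' (NCell ''pe'' (V ''t'')))) PSkip"

definition augment_prog :: prog where
  "augment_prog = PFor ''r'' ''n1'' augment_body"

definition improve :: "rexp \<Rightarrow> prog" where
  "improve x = PCond (bor (beq (V ''have'') (NConst 0)) (RLess x (RCell ''delta'' (NConst 0))))
     (PReal ''delta'' (NConst 0) x ;; PNat ''have'' (NConst 0) (NConst 1)) PSkip"

definition delta_v_body :: prog where
  "delta_v_body = PCond
     (BAnd (bpos (NCell ''lev'' (V ''v''))) (RLess (RCell ''lam'' (V ''v'')) (RConst 0)))
     (improve (RSub (RConst 0) (RCell ''lam'' (V ''v'')))) PSkip"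

definition delta_f_body :: prog where
  "delta_f_body = PCond
     (BAnd (BAnd (beq (NCell ''tree'' (V ''f'')) (NConst 0)) (separated (V ''f'')))
       (beq (NCell ''lev'' (NCell ''cls'' (V ''f''))) (NConst 0)))
     (improve (RSub (pexp (V ''f'')) (pexp (V ''e'')))) PSkip"

definition delta_e_body :: prog where
  "delta_e_body = PCond
     (BAnd (bpos (NCell ''tree'' (V ''e''))) (bpos (NCell ''lev'' (NCell ''cls'' (V ''e'')))))
     (PNat ''skip'' (NConst 0) (V ''e'') ;; label_prog ;; PFor ''f'' ''m'' delta_f_body) PSkip"

definition delta_prog :: prog where
  "delta_prog = PNat ''have'' (NConst 0) (NConst 0) ;;
     PFor ''v'' ''n1'' delta_v_body ;; PFor ''e'' ''m'' delta_e_body"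

definition raise_prog :: prog where
  "raise_prog = PFor ''v'' ''n1'' (PCond (bpos (NCell ''lev'' (V ''v'')))
     (PReal ''lam'' (V ''v'') (RAdd (RCell ''lam'' (V ''v'')) (RCell ''delta'' (NConst 0)))) PSkip)"

definition accept_prog :: prog where
  "accept_prog = PNat ''answer'' (NConst 0) (NConst 1) ;;
     PFor ''v'' ''n'' (PCond (NLess (NCell ''deg'' (V ''v'')) (NCell ''lower'' (V ''v'')))
       (PNat ''answer'' (NConst 0) (NConst 0)) PSkip) ;;
     PNat ''done'' (NConst 0) (NConst 1)"

definition step_prog :: prog where
  "step_prog = count_prog ;; cap_prog ;; bfs_prog ;; find_prog ;;
     PCond (bpos (V ''srcs''))
       (PCond (bpos (V ''found'')) augment_prog
         (delta_prog ;; PCond (bpos (V ''have'')) raise_prog (PNat ''done'' (NConst 0) (NConst 1))))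
       accept_prog"

lemma nwr_find_body [simp]: "nwr find_body = {''srcs'', ''found'', ''t''}"
  and rwr_find_body [simp]: "rwr find_body = {}"
  by (auto simp: find_body_def)

lemma nwr_find_prog [simp]: "nwr find_prog = {''v'', ''srcs'', ''found'', ''t''}"
  and rwr_find_prog [simp]: "rwr find_prog = {}"
  by (auto simp: find_prog_def)

lemma nwr_augment_body [simp]: "nwr augment_body = {''tree'', ''t''}"
  and rwr_augment_body [simp]: "rwr augment_body = {}"
  by (auto simp: augment_body_def)

lemma nwr_augment_prog [simp]: "nwr augment_prog = {''r'', ''tree'', ''t''}"
  and rwr_augment_prog [simp]: "rwr augment_prog = {}"
  by (auto simp: augment_prog_def)

lemma nwr_improve [simp]: "nwr (improve x) = {''have''}"
  and rwr_improve [simp]: "rwr (improve x) = {''delta''}"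
  by (auto simp: improve_def)

lemma nwr_delta_v_body [simp]: "nwr delta_v_body = {''have''}"
  and rwr_delta_v_body [simp]: "rwr delta_v_body = {''delta''}"
  by (auto simp: delta_v_body_def)

lemma nwr_delta_f_body [simp]: "nwr delta_f_body = {''have''}"
  and rwr_delta_f_body [simp]: "rwr delta_f_body = {''delta''}"
  by (auto simp: delta_f_body_def)

lemma nwr_delta_e_body [simp]:
  "nwr delta_e_body = {''skip'', ''i'', ''lab'', ''k'', ''p'', ''q'', ''f'', ''have''}"
  and rwr_delta_e_body [simp]: "rwr delta_e_body = {''delta''}"
  by (auto simp: delta_e_body_def)

lemma nwr_delta_prog [simp]:
  "nwr delta_prog = {''v'', ''e'', ''skip'', ''i'', ''lab'', ''k'', ''p'', ''q'', ''f'', ''have''}"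
  and rwr_delta_prog [simp]: "rwr delta_prog = {''delta''}"
  by (auto simp: delta_prog_def)

lemma nwr_raise_prog [simp]: "nwr raise_prog = {''v''}"
  and rwr_raise_prog [simp]: "rwr raise_prog = {''lam''}"
  by (auto simp: raise_prog_def)

lemma nwr_accept_prog [simp]: "nwr accept_prog = {''v'', ''answer'', ''done''}"
  and rwr_accept_prog [simp]: "rwr accept_prog = {}"
  by (auto simp: accept_prog_def)

lemma nwr_step_prog:
  "nwr step_prog \<subseteq> {''v'', ''e'', ''skip'', ''i'', ''lab'', ''k'', ''p'', ''q'', ''f'', ''have'', ''r'', ''deg'',
     ''cap'', ''lev'', ''pe'', ''pf'', ''srcs'', ''found'', ''t'', ''tree'', ''answer'', ''done''}"
  and rwr_step_prog: "rwr step_prog \<subseteq> {''lam'', ''delta''}"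
  by (simp_all add: step_prog_def)

text \<open>A zero in \<open>have\<close> stands for an infinite minimum, that is, for a price
  change that nothing limits.\<close>

definition tracks_min :: "real set \<Rightarrow> state \<Rightarrow> bool" where
  "tracks_min S t \<longleftrightarrow> (fst t ''have'' 0 = 0 \<longrightarrow> S = {}) \<and>
     (fst t ''have'' 0 \<noteq> 0 \<longrightarrow> snd t ''delta'' 0 \<in> S \<and> (\<forall>x\<in>S. snd t ''delta'' 0 \<le> x))"

lemma tracks_min_frame:
  "frame W R t t' \<Longrightarrow> ''have'' \<notin> W \<Longrightarrow> ''delta'' \<notin> R \<Longrightarrow> tracks_min S t' \<longleftrightarrow> tracks_min S t"
  by (simp add: tracks_min_def frame_def)

lemma tracks_min_nupd [simp]: "y \<noteq> ''have'' \<Longrightarrow> tracks_min S (nupd y i k t) \<longleftrightarrow> tracks_min S t"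
  by (simp add: tracks_min_def)

lemma tracks_min_improve:
  assumes "tracks_min S t"
  shows "tracks_min (insert (rval x t) S) (den (improve x) t)"
  using assms by (auto simp: tracks_min_def improve_def not_less)

section \<open>Correctness of augmentations and price changes\<close>

context priced_graph begin

lemma find_prog:
  fixes s defines "s' \<equiv> den find_prog s"
  assumes s: "static s"
  shows "fst s' ''srcs'' 0 \<noteq> 0 \<longleftrightarrow> (\<exists>v\<le>n. fst s ''cap'' v < fst s ''deg'' v)"
    and "fst s' ''found'' 0 \<noteq> 0 \<Longrightarrow> fst s' ''t'' 0 \<le> n \<and> fst s ''lev'' (fst s' ''t'' 0) \<noteq> 0 \<and>
      fst s ''deg'' (fst s' ''t'' 0) < fst s ''cap'' (fst s' ''t'' 0)"
    and "\<lbrakk>fst s' ''found'' 0 = 0; v \<le> n; fst s ''lev'' v \<noteq> 0\<rbrakk> \<Longrightarrow> fst s ''cap'' v \<le> fst s ''deg'' v"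
proof -
  let ?P = "\<lambda>v. fst s ''lev'' v \<noteq> 0 \<and> fst s ''deg'' v < fst s ''cap'' v"
  let ?I = "\<lambda>k t. (fst t ''srcs'' 0 \<noteq> 0 \<longleftrightarrow> (\<exists>v<k. fst s ''cap'' v < fst s ''deg'' v)) \<and>
    (fst t ''found'' 0 \<noteq> 0 \<longrightarrow> fst t ''t'' 0 < k \<and> ?P (fst t ''t'' 0)) \<and>
    (fst t ''found'' 0 = 0 \<longrightarrow> (\<forall>v<k. \<not> ?P v))"
  define s1 where "s1 = nupd ''found'' 0 0 (nupd ''srcs'' 0 0 s)"
  have "?I (n + 1) (den (PFor ''v'' ''n1'' find_body) s1)"
  proof (rule den_PFor_induct[where I = ?I], goal_cases)
    case (5 k t)
    have t: "fst t ''cap'' = fst s ''cap''" "fst t ''deg'' = fst s ''deg''" "fst t ''lev'' = fst s ''lev''"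
      using 5(3) by (auto simp: frame_def s1_def)
    show ?case using 5(2,4) by (auto simp: find_body_def t less_Suc_eq)
  qed (use s in \<open>auto simp: static_def s1_def\<close>)
  then have "?I (n + 1) s'" by (simp add: s'_def find_prog_def s1_def)
  then show "fst s' ''srcs'' 0 \<noteq> 0 \<longleftrightarrow> (\<exists>v\<le>n. fst s ''cap'' v < fst s ''deg'' v)"
    "fst s' ''found'' 0 \<noteq> 0 \<Longrightarrow> fst s' ''t'' 0 \<le> n \<and> fst s ''lev'' (fst s' ''t'' 0) \<noteq> 0 \<and>
      fst s ''deg'' (fst s' ''t'' 0) < fst s ''cap'' (fst s' ''t'' 0)"
    "\<lbrakk>fst s' ''found'' 0 = 0; v \<le> n; fst s ''lev'' v \<noteq> 0\<rbrakk> \<Longrightarrow> fst s ''cap'' v \<le> fst s ''deg'' v"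
    by (auto simp: less_Suc_eq_le not_less)
qed

lemma augment_prog:
  fixes s defines "s' \<equiv> den augment_prog s" and "T \<equiv> chosen s" and "lam \<equiv> snd s ''lam''"
    and "lev \<equiv> fst s ''lev''" and "t \<equiv> fst s ''t'' 0"
  assumes s: "static s" and T: "T \<in> min_bases (pcost lam)" and val: "valid_levels T lam lev"
    and par: "\<And>l. parents T lam lev (fst s ''pe'') (fst s ''pf'') l"
    and t: "t \<le> n" "lev t \<noteq> 0" "lev t \<le> n + 2"
  shows "chosen s' \<in> min_bases (pcost lam)"
    and "\<exists>u\<le>n. lev u = 1 \<and> move T (chosen s') u t"
proof -
  \<comment> \<open>The level starts at \<open>n + 2\<close> at most and drops by one per round
    until it is 1, so after \<open>n + 1\<close> rounds the path has been followed back to a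
    source.\<close>
  let ?I = "\<lambda>k z. chosen z \<in> min_bases (pcost lam) \<and> valid_levels (chosen z) lam lev \<and>
    parents (chosen z) lam lev (fst s ''pe'') (fst s ''pf'') (lev (fst z ''t'' 0)) \<and>
    fst z ''t'' 0 \<le> n \<and> lev (fst z ''t'' 0) \<noteq> 0 \<and> (lev (fst z ''t'' 0) = 1 \<or> lev (fst z ''t'' 0) + k \<le> n + 2) \<and>
    move T (chosen z) (fst z ''t'' 0) t"
  have "?I (n + 1) s'" unfolding s'_def augment_prog_def
  proof (rule den_PFor_induct[where I = ?I], goal_cases)
    case 4
    have "chosen (nupd ''r'' 0 0 s) = T" by (simp add: chosen_def T_def)
    moreover have "move T T t t" by (simp add: move_def)
    ultimately show ?case using T val par t by (simp add: t_def)
  next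
    case (5 k z)
    have z: "fst z ''lev'' = lev" "fst z ''pe'' = fst s ''pe''" "fst z ''pf'' = fst s ''pf''" "fst z ''cls'' = cl"
      using 5(3) s by (auto simp: frame_def lev_def static_def)
    have ch: "chosen (nupd ''r'' 0 (Suc k) (den augment_body z)) = chosen (den augment_body z)"
      by (simp add: chosen_def)
    show ?case
    proof (cases "1 < lev (fst z ''t'' 0)")
      case True
      let ?t = "fst z ''t'' 0"
      have aug: "chosen z \<in> min_bases (pcost lam)" "valid_levels (chosen z) lam lev"
        "parents (chosen z) lam lev (fst s ''pe'') (fst s ''pf'') (lev ?t)" "?t \<le> n"
        using 5(4) by auto
      note aug = augment_step[where lev = lev and t = ?t, OF aug True]
      have c: "chosen (den augment_body z) = swap (chosen z) (fst s ''pe'' ?t) (fst s ''pf'' ?t)"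
        using True aug(7-9) by (auto simp: augment_body_def z chosen_def swap_def)
      have t: "fst (den augment_body z) ''t'' 0 = cl (fst s ''pe'' ?t)"
        using True by (simp add: augment_body_def z)
      have "move T (chosen z) ?t t" using 5(4) by simp
      then have "move T (chosen (den augment_body z)) (cl (fst s ''pe'' ?t)) t"
        unfolding c by (rule move_trans[OF _ aug(6)])
      then show ?thesis using aug(1-5) 5(4) True unfolding ch by (auto simp: c t)
    next
      case False
      then have "den augment_body z = z" by (simp add: augment_body_def z)
      then show ?thesis using 5(4) False unfolding ch by auto
    qed
  qed (use s in \<open>auto simp: static_def\<close>)
  then show "chosen s' \<in> min_bases (pcost lam)" "\<exists>u\<le>n. lev u = 1 \<and> move T (chosen s') u t"
    by (auto intro!: exI[of _ "fst s' ''t'' 0"])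
qed

lemma delta_f_loop:
  fixes s defines "s' \<equiv> den (PFor ''f'' ''m'' delta_f_body) s"
    and "w \<equiv> pcost (snd s ''lam'')" and "e \<equiv> fst s ''e'' 0"
  assumes s: "static s" and S: "tracks_min S s"
  shows "tracks_min (S \<union> {w f - w e | f. f < m \<and> f \<notin> chosen s \<and>
    fst s ''lab'' (a f) \<noteq> fst s ''lab'' (b f) \<and> fst s ''lev'' (cl f) = 0}) s'"
proof -
  let ?P = "\<lambda>f. f \<notin> chosen s \<and> fst s ''lab'' (a f) \<noteq> fst s ''lab'' (b f) \<and> fst s ''lev'' (cl f) = 0"
  let ?I = "\<lambda>k t. tracks_min (S \<union> {w f - w e | f. f < k \<and> ?P f}) t"
  have "?I m s'" unfolding s'_def
  proof (rule den_PFor_induct[where I = ?I], goal_cases)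
    case (5 k t)
    have t: "static t" by (rule static_frame[OF 5(3) s]) auto
    have fr: "fst t ''lab'' = fst s ''lab''" "snd t ''lam'' = snd s ''lam''" "fst t ''tree'' = fst s ''tree''"
      "fst t ''e'' 0 = e" "fst t ''lev'' = fst s ''lev''" "fst t ''cls'' = cl"
      using 5(3) t by (auto simp: frame_def e_def static_def)
    have c: "bval (BAnd (BAnd (beq (NCell ''tree'' (V ''f'')) (NConst 0)) (separated (V ''f'')))
       (beq (NCell ''lev'' (NCell ''cls'' (V ''f''))) (NConst 0))) t \<longleftrightarrow> ?P k"
      using 5(1,2) by (simp add: bval_separated[OF t] fr chosen_def)
    show ?case
    proof (cases "?P k")
      case True
      have "rval (RSub (pexp (V ''f'')) (pexp (V ''e''))) t = w k - w e"
        using 5(2) by (simp add: rval_pexp[OF t] fr w_def)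
      moreover have "den delta_f_body t = den (improve (RSub (pexp (V ''f'')) (pexp (V ''e'')))) t"
        by (simp only: delta_f_body_def den.simps c[THEN iffD2, OF True] if_True)
      ultimately have "tracks_min (insert (w k - w e) (S \<union> {w f - w e | f. f < k \<and> ?P f})) (den delta_f_body t)"
        using tracks_min_improve[OF 5(4), of "RSub (pexp (V ''f'')) (pexp (V ''e''))"] by (simp only:)
      moreover have "insert (w k - w e) (S \<union> {w f - w e | f. f < k \<and> ?P f}) =
          S \<union> {w f - w e | f. f < Suc k \<and> ?P f}"
        using True by (auto simp: less_Suc_eq)
      ultimately show ?thesis by simp
    next
      case False
      then have "den delta_f_body t = t" unfolding c[symmetric] by (simp only: delta_f_body_def den.simps if_False)
      moreover have "{w f - w e | f. f < k \<and> ?P f} = {w f - w e | f. f < Suc k \<and> ?P f}"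
        using False by (auto simp: less_Suc_eq)
      ultimately show ?thesis using 5(4) by simp
    qed
  qed (use s S in \<open>auto simp: static_def\<close>)
  then show ?thesis by simp
qed

lemma delta_prog:
  fixes s defines "s' \<equiv> den delta_prog s" and "T \<equiv> chosen s" and "lam \<equiv> snd s ''lam''"
    and "lev \<equiv> fst s ''lev''"
  assumes s: "static s" and T: "tree T"
  shows "tracks_min ({- lam v | v. v \<le> n \<and> lev v \<noteq> 0 \<and> lam v < 0} \<union>
    {pcost lam f - pcost lam e | e f. e \<in> T \<and> lev (cl e) \<noteq> 0 \<and> f < m \<and> f \<notin> T \<and> lev (cl f) = 0 \<and>
      tree (swap T e f)}) s'"
proof -
  let ?A = "\<lambda>k. {- lam v | v. v < k \<and> lev v \<noteq> 0 \<and> lam v < 0}"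
  let ?B = "\<lambda>k. {pcost lam f - pcost lam e | e f. e < k \<and> e \<in> T \<and> lev (cl e) \<noteq> 0 \<and> f < m \<and> f \<notin> T \<and>
    lev (cl f) = 0 \<and> tree (swap T e f)}"
  let ?s0 = "nupd ''have'' 0 0 s"
  define s1 where "s1 = den (PFor ''v'' ''n1'' delta_v_body) ?s0"
  have A: "tracks_min (?A (n + 1)) s1" unfolding s1_def
  proof (rule den_PFor_induct[where I = "\<lambda>k. tracks_min (?A k)"], goal_cases)
    case (5 k t)
    have t: "fst t ''lev'' = lev" "snd t ''lam'' = lam" using 5(3) by (auto simp: frame_def lev_def lam_def)
    show ?case
    proof (cases "lev k \<noteq> 0 \<and> lam k < 0")
      case True
      then have "?A (Suc k) = insert (- lam k) (?A k)" by (auto simp: less_Suc_eq)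
      moreover have "den delta_v_body t = den (improve (RSub (RConst 0) (RCell ''lam'' (V ''v'')))) t"
        using True 5(2) by (simp add: delta_v_body_def t)
      moreover have "rval (RSub (RConst 0) (RCell ''lam'' (V ''v''))) t = - lam k" using 5(2) by (simp add: t)
      ultimately have "tracks_min (?A (Suc k)) (den delta_v_body t)"
        using tracks_min_improve[OF 5(4), of "RSub (RConst 0) (RCell ''lam'' (V ''v''))"] by (simp only:)
      then show ?thesis by simp
    next
      case False
      then have "?A (Suc k) = ?A k" by (auto simp: less_Suc_eq)
      moreover have "den delta_v_body t = t" using False 5(2) by (auto simp: delta_v_body_def t)
      ultimately show ?thesis using 5(4) by simp
    qed
  qed (use s in \<open>auto simp: static_def tracks_min_def\<close>)
  have f1: "frame {''have'', ''v''} {''delta''} s s1" unfolding s1_def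
    by (rule frame_trans[OF frame_nupd frame_mono[OF frame_den]]) auto
  have s1: "static s1" by (rule static_frame[OF f1 s]) auto
  have "tracks_min (?A (n + 1) \<union> ?B m) (den (PFor ''e'' ''m'' delta_e_body) s1)"
  proof (rule den_PFor_induct[where I = "\<lambda>k. tracks_min (?A (n + 1) \<union> ?B k)"], goal_cases)
    case (5 k t)
    have t: "static t" by (rule static_frame[OF 5(3) s1]) auto
    have fr: "fst t ''lev'' = lev" "snd t ''lam'' = lam" "fst t ''tree'' = fst s ''tree''" "fst t ''cls'' = cl"
      using 5(3) f1 t by (auto simp: frame_def lev_def lam_def static_def)
    have ch: "chosen t = T" by (simp add: T_def chosen_def fr)
    show ?case
    proof (cases "k \<in> T \<and> lev (cl k) \<noteq> 0")
      case True
      define t1 where "t1 = nupd ''skip'' 0 k t"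
      define t2 where "t2 = den label_prog t1"
      have den: "den delta_e_body t = den (PFor ''f'' ''m'' delta_f_body) t2"
        using True 5(2) by (auto simp: delta_e_body_def t1_def t2_def fr T_def chosen_def)
      have g1: "frame {''skip''} {} t t1" by (simp add: t1_def frame_nupd)
      have t1: "static t1" by (rule static_frame[OF g1 t]) auto
      have g2: "frame {''i'', ''lab'', ''k'', ''p'', ''q''} {} t1 t2"
        unfolding t2_def by (rule frame_mono[OF frame_den]) auto
      have t2: "static t2" by (rule static_frame[OF g2 t1]) auto
      have chs: "chosen t1 = T" "chosen t2 = T"
        using chosen_frame[OF g1] chosen_frame[OF g2] ch by auto
      have q: "snd t2 ''lam'' = lam" "fst t2 ''e'' 0 = k" "fst t2 ''lev'' = lev" "fst t1 ''skip'' 0 = k"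
        using g1 g2 fr 5(2) by (auto simp: frame_def t1_def)
      have "fst t2 ''lab'' (a f) \<noteq> fst t2 ''lab'' (b f) \<longleftrightarrow> tree (swap T k f)" if "f < m" "f \<notin> T" for f
      proof -
        have "fst t1 ''tree'' f = 0" using that chs(1) by (auto simp: chosen_def)
        then show ?thesis using label_prog_swap[OF t1, of f] that True T chs(1) q(4)
          by (simp add: t2_def)
      qed
      then have eq: "{pcost lam f - pcost lam k | f. f < m \<and> f \<notin> T \<and>
          fst t2 ''lab'' (a f) \<noteq> fst t2 ''lab'' (b f) \<and> lev (cl f) = 0} =
        {pcost lam f - pcost lam k | f. f < m \<and> f \<notin> T \<and> lev (cl f) = 0 \<and> tree (swap T k f)}"
        by (intro Collect_cong) metis
      have "tracks_min (?A (n + 1) \<union> ?B k) t2"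
        using 5(4) tracks_min_frame[OF g1] tracks_min_frame[OF g2] by simp
      from delta_f_loop[OF t2 this, unfolded chs q eq]
      have "tracks_min (?A (n + 1) \<union> ?B k \<union>
        {pcost lam f - pcost lam k | f. f < m \<and> f \<notin> T \<and> lev (cl f) = 0 \<and> tree (swap T k f)}) (den delta_e_body t)"
        by (simp add: den)
      moreover have "?B k \<union> {pcost lam f - pcost lam k | f. f < m \<and> f \<notin> T \<and> lev (cl f) = 0 \<and> tree (swap T k f)} =
          ?B (Suc k)"
        using True by (auto simp: less_Suc_eq)
      ultimately show ?thesis by (simp add: Un_assoc)
    next
      case False
      then have "?B (Suc k) = ?B k" by (auto simp: less_Suc_eq)
      moreover have "den delta_e_body t = t"
        using False 5(1,2) by (auto simp: delta_e_body_def fr T_def chosen_def)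
      ultimately show ?thesis using 5(4) by simp
    qed
  qed (use s1 A in \<open>auto simp: static_def\<close>)
  moreover have "?A (n + 1) = {- lam v | v. v \<le> n \<and> lev v \<noteq> 0 \<and> lam v < 0}" by auto
  moreover have "?B m = {pcost lam f - pcost lam e | e f. e \<in> T \<and> lev (cl e) \<noteq> 0 \<and> f < m \<and> f \<notin> T \<and>
    lev (cl f) = 0 \<and> tree (swap T e f)}"
    by (auto simp: T_def chosen_def)
  ultimately show ?thesis by (simp add: s'_def delta_prog_def s1_def)
qed

lemma raise_prog:
  assumes s: "static s"
  shows "snd (den raise_prog s) ''lam'' =
    raise {v. v \<le> n \<and> fst s ''lev'' v \<noteq> 0} (snd s ''delta'' 0) (snd s ''lam'')"
proof -
  let ?I = "\<lambda>k t. snd t ''lam'' = raise {v. v < k \<and> fst s ''lev'' v \<noteq> 0} (snd s ''delta'' 0) (snd s ''lam'')"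
  have "?I (n + 1) (den raise_prog s)" unfolding raise_prog_def
  proof (rule den_PFor_induct[where I = ?I], goal_cases)
    case (5 k t)
    have t: "fst t ''lev'' = fst s ''lev''" "snd t ''delta'' = snd s ''delta''"
      using 5(3) by (auto simp: frame_def)
    show ?case using 5(2,4) by (auto simp: t raise_def fun_eq_iff less_Suc_eq)
  qed (use s in \<open>auto simp: static_def raise_def fun_eq_iff\<close>)
  then show ?thesis by (simp add: less_Suc_eq_le)
qed

lemma accept_prog:
  assumes s: "static s"
  shows "fst (den accept_prog s) ''done'' 0 = 1"
    and "fst (den accept_prog s) ''answer'' 0 \<noteq> 0 \<longleftrightarrow> (\<forall>v<n. lo v \<le> fst s ''deg'' v)"
proof -
  let ?b = "PCond (NLess (NCell ''deg'' (V ''v'')) (NCell ''lower'' (V ''v''))) (PNat ''answer'' (NConst 0) (NConst 0)) PSkip"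
  let ?I = "\<lambda>k t. fst t ''answer'' 0 \<noteq> 0 \<longleftrightarrow> (\<forall>v<k. lo v \<le> fst s ''deg'' v)"
  have "?I n (den (PFor ''v'' ''n'' ?b) (nupd ''answer'' 0 1 s))"
  proof (rule den_PFor_induct[where I = ?I], goal_cases)
    case (5 k t)
    have t: "fst t ''deg'' = fst s ''deg''" "fst t ''lower'' = lo"
      using 5(3) s by (auto simp: frame_def static_def)
    show ?case using 5(2,4) by (auto simp: t less_Suc_eq)
  qed (use s in \<open>auto simp: static_def\<close>)
  then show "fst (den accept_prog s) ''answer'' 0 \<noteq> 0 \<longleftrightarrow> (\<forall>v<n. lo v \<le> fst s ''deg'' v)"
    by (simp add: accept_prog_def)
  show "fst (den accept_prog s) ''done'' 0 = 1" by (simp add: accept_prog_def)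
qed

end

section \<open>The main loop\<close>

definition main_body :: prog where
  "main_body = PCond (bpos (V ''done'')) PSkip step_prog"

text \<open>Two nested loops, since \<open>(m + 1) * (2 * n + 3)\<close>, the bound on the potential, cannot be computed
  without multiplication.\<close>

definition main_prog :: prog where
  "main_prog = PFor ''x'' ''m1'' (PFor ''y'' ''n3'' main_body)"

text \<open>Here \<open>V ''lab''\<close> is the label of vertex 0: the greedy forest spans the
  graph iff all vertices share this label. The last test rejects the graph without vertices. Setting
  \<open>done\<close> while \<open>answer\<close> is 0 reports infeasibility.\<close>

definition start_prog :: prog where
  "start_prog = kruskal_prog ;; PNat ''skip'' (NConst 0) (V ''m'') ;; label_prog ;;
     PFor ''v'' ''n'' (PCond (beq (NCell ''lab'' (V ''v'')) (V ''lab'')) PSkip (PNat ''done'' (NConst 0) (NConst 1))) ;;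
     PCond (bpos (V ''n'')) PSkip (PNat ''done'' (NConst 0) (NConst 1))"

lemma nwr_main_body:
  "nwr main_body \<subseteq> {''v'', ''e'', ''skip'', ''i'', ''lab'', ''k'', ''p'', ''q'', ''f'', ''have'', ''r'', ''deg'',
     ''cap'', ''lev'', ''pe'', ''pf'', ''srcs'', ''found'', ''t'', ''tree'', ''answer'', ''done''}"
  and rwr_main_body: "rwr main_body \<subseteq> {''lam'', ''delta''}"
  using nwr_step_prog rwr_step_prog by (auto simp: main_body_def)

context priced_graph begin

definition result_ok :: "state \<Rightarrow> bool" where
  "result_ok s \<longleftrightarrow> (if fst s ''answer'' 0 = 0 then \<forall>T. \<not> feas T
     else feas (chosen s) \<and> (\<forall>T. feas T \<longrightarrow> sum cst (chosen s) \<le> sum cst T))"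

lemma step_prog:
  fixes s defines "s' \<equiv> den step_prog s"
  assumes s: "static s" and fin: "fst s ''done'' 0 = 0" and answer: "fst s ''answer'' 0 = 0"
    and bo: bounds_ok and inv: "price_inv (chosen s) (snd s ''lam'')"
  shows "fst s' ''done'' 0 = 0 \<and> fst s' ''answer'' 0 = 0 \<and> price_inv (chosen s') (snd s' ''lam'') \<and>
      potential (chosen s') (snd s' ''lam'') < potential (chosen s) (snd s ''lam'') \<or>
    fst s' ''done'' 0 \<noteq> 0 \<and> result_ok s'"
proof -
  define T where "T = chosen s"
  define lam where "lam = snd s ''lam''"
  define s1 where "s1 = den count_prog s"
  define s2 where "s2 = den cap_prog s1"
  define s3 where "s3 = den bfs_prog s2"
  define s4 where "s4 = den find_prog s3"
  have s': "s' = den (PCond (bpos (V ''srcs''))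
       (PCond (bpos (V ''found'')) augment_prog
         (delta_prog ;; PCond (bpos (V ''have'')) raise_prog (PNat ''done'' (NConst 0) (NConst 1))))
       accept_prog) s4"
    by (simp add: s'_def step_prog_def s1_def s2_def s3_def s4_def)
  have T: "T \<in> min_bases (pcost lam)" using inv by (simp add: price_inv_def T_def lam_def)
  have f1: "frame {''v'', ''k'', ''deg''} {} s s1"
    unfolding s1_def by (rule frame_mono[OF frame_den]) auto
  have f2: "frame {''v'', ''cap'', ''lev''} {} s1 s2"
    unfolding s2_def by (rule frame_mono[OF frame_den]) auto
  have f3: "frame {''r'', ''e'', ''skip'', ''i'', ''lab'', ''k'', ''p'', ''q'', ''f'', ''lev'', ''pe'', ''pf''} {} s2 s3"
    unfolding s3_def by (rule frame_mono[OF frame_den]) auto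
  have f4: "frame {''v'', ''srcs'', ''found'', ''t''} {} s3 s4"
    unfolding s4_def by (rule frame_mono[OF frame_den]) auto
  have st1: "static s1" by (rule static_frame[OF f1 s]) auto
  have st2: "static s2" by (rule static_frame[OF f2 st1]) auto
  have st3: "static s3" by (rule static_frame[OF f3 st2]) auto
  have st4: "static s4" by (rule static_frame[OF f4 st3]) auto
  have ch: "chosen s1 = T" "chosen s2 = T" "chosen s3 = T" "chosen s4 = T"
    using chosen_frame[OF f1] chosen_frame[OF f2] chosen_frame[OF f3] chosen_frame[OF f4]
    by (simp_all add: T_def)
  have lam: "snd s1 ''lam'' = lam" "snd s2 ''lam'' = lam" "snd s3 ''lam'' = lam" "snd s4 ''lam'' = lam"
    using f1 f2 f3 f4 by (simp_all add: frame_def lam_def)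
  have deg1: "fst s1 ''deg'' v = cnt T v" if "v \<le> n" for v
    using count_prog[OF s that] by (simp add: s1_def T_def)
  have deg: "fst s3 ''deg'' v = cnt T v" "fst s4 ''deg'' v = cnt T v" if "v \<le> n" for v
    using deg1[OF that] f2 f3 f4 by (simp_all add: frame_def)
  have cap: "fst s3 ''cap'' v = cap lam v" if "v \<le> n" for v
    using cap_prog(1)[OF st1 that] f3 by (simp add: frame_def s2_def lam)
  have lev2: "\<forall>v\<le>n. fst s2 ''lev'' v = of_bool (v \<in> sources T lam)"
    using cap_prog(2)[OF st1] deg1 by (simp add: s2_def lam sources_def)
  let ?lev = "fst s4 ''lev''"
  have par4: "fst s4 ''lev'' = fst s3 ''lev''" "fst s4 ''pe'' = fst s3 ''pe''" "fst s4 ''pf'' = fst s3 ''pf''"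
    using f4 by (simp_all add: frame_def)
  note bfs = bfs_prog[OF st2, unfolded ch lam, OF T lev2, folded s3_def, folded par4]
  have reach: "reach T lam = {v. v \<le> n \<and> ?lev v \<noteq> 0}"
    by (rule reach_eq_levels[OF bfs(1,2,3) T])
  note find = find_prog[OF st3, folded s4_def, folded par4]
  have srcs: "fst s4 ''srcs'' 0 \<noteq> 0 \<longleftrightarrow> sources T lam \<noteq> {}"
    using find(1) cap deg by (auto simp: sources_def)
  have keep: "fst s4 ''done'' 0 = 0" "fst s4 ''answer'' 0 = 0"
    using f1 f2 f3 f4 fin answer by (auto simp: frame_def)
  consider "fst s4 ''srcs'' 0 = 0"
    | "fst s4 ''srcs'' 0 \<noteq> 0" "fst s4 ''found'' 0 \<noteq> 0"
    | "fst s4 ''srcs'' 0 \<noteq> 0" "fst s4 ''found'' 0 = 0" by blast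
  then show ?thesis
  proof cases
    case 1
    then have s': "s' = den accept_prog s4" by (simp add: s')
    have le: "cnt T v \<le> cap lam v" if "v \<le> n" for v
      using 1 srcs that by (force simp: sources_def)
    have chs: "chosen s' = T" unfolding s' using chosen_frame[OF frame_den, of accept_prog s4] ch by simp
    have ans: "fst s' ''answer'' 0 \<noteq> 0 \<longleftrightarrow> (\<forall>v<n. lo v \<le> cnt T v)"
      using accept_prog(2)[OF st4] deg by (simp add: s')
    have inv': "price_inv T lam" using inv by (simp add: T_def lam_def)
    note cert = price_certificate[OF inv' bo le]
    have "feas T" if "fst s' ''answer'' 0 \<noteq> 0"
    proof -
      have "cnt T v \<le> up v" if "v < n" for v
        using order_trans[OF le cap_le_up[OF bo]] that by simp
      then show ?thesis using that ans min_basesD(1)[OF T] by (simp add: feas_def)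
    qed
    \<comment> \<open>By the certificate, any feasible tree would make \<open>T\<close> feasible, so
      one violated lower bound refutes all of them.\<close>
    moreover have "\<not> feas T'" if "fst s' ''answer'' 0 = 0" for T'
      using that ans cert(1)[of T'] by (auto simp: feas_def)
    ultimately have "result_ok s'" using cert(2) by (simp add: result_ok_def chs)
    then show ?thesis using accept_prog(1)[OF st4] by (simp add: s')
  next
    case 2
    then have s': "s' = den augment_prog s4" by (simp add: s')
    let ?t = "fst s4 ''t'' 0"
    have t: "?t \<le> n" "?lev ?t \<noteq> 0" "cnt T ?t < cap lam ?t"
      using find(2)[OF 2(2)] deg cap by auto
    have fr: "fst s' ''done'' 0 = 0" "fst s' ''answer'' 0 = 0" "snd s' ''lam'' = lam"
      using keep lam by (simp_all add: s' fst_den snd_den)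
    note aug = augment_prog[OF st4, unfolded ch lam, OF T bfs(1,2) t(1,2) bfs(4)[OF t(1)], folded s']
    from aug(2) obtain u where u: "u \<le> n" "?lev u = 1" "move T (chosen s') u ?t" by blast
    then have src: "u \<in> sources T lam" using bfs(3) by blast
    then have "price_inv (chosen s') lam"
      using price_inv_move[OF _ bo aug(1) u(3) _ t(3)] inv by (simp add: T_def lam_def sources_def)
    moreover have "potential (chosen s') lam < potential T lam"
      by (rule potential_less_if_excess_less[OF excess_move_less[OF u(3) src t(3)]])
    ultimately show ?thesis using fr by (simp add: T_def lam_def)
  next
    case 3
    define s5 where "s5 = den delta_prog s4"
    have s': "s' = den (PCond (bpos (V ''have'')) raise_prog (PNat ''done'' (NConst 0) (NConst 1))) s5"
      using 3 by (simp add: s' s5_def)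
    have f5: "frame {''v'', ''e'', ''skip'', ''i'', ''lab'', ''k'', ''p'', ''q'', ''f'', ''have''} {''delta''} s4 s5"
      unfolding s5_def by (rule frame_mono[OF frame_den]) auto
    have st5: "static s5" by (rule static_frame[OF f5 st4]) auto
    have ch5: "chosen s5 = T" using chosen_frame[OF f5] ch by simp
    have fr5: "snd s5 ''lam'' = lam" "fst s5 ''lev'' = ?lev" "fst s5 ''done'' 0 = 0" "fst s5 ''answer'' 0 = 0"
      using f5 lam keep by (simp_all add: frame_def)
    let ?R = "reach T lam" and ?d = "snd s5 ''delta'' 0"
    let ?S = "{- lam v | v. v \<le> n \<and> ?lev v \<noteq> 0 \<and> lam v < 0} \<union>
      {pcost lam f - pcost lam e | e f. e \<in> T \<and> ?lev (cl e) \<noteq> 0 \<and> f < m \<and> f \<notin> T \<and> ?lev (cl f) = 0 \<and>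
        tree (swap T e f)}"
    have min: "tracks_min ?S s5"
      using delta_prog[OF st4, unfolded ch lam, folded s5_def] min_basesD(1)[OF T] by simp
    have inR: "v \<in> ?R \<longleftrightarrow> ?lev v \<noteq> 0" if "v \<le> n" for v using reach that by simp
    have inv': "price_inv T lam" using inv by (simp add: T_def lam_def)
    have capR: "cap lam v \<le> cnt T v" if "v \<in> ?R" for v
      using find(3)[OF 3(2), of v] that reach cap deg by simp
    have cle: "cl e \<le> n" if "e \<in> T" for e using min_basesD(2)[OF T] cl_le that by auto
    have S_neg: "- lam v \<in> ?S" if "v \<in> ?R" "lam v < 0" for v using that reach by auto
    have S_gap: "pcost lam f - pcost lam e \<in> ?S"
      if "e \<in> T" "cl e \<in> ?R" "f < m" "f \<notin> T" "cl f \<notin> ?R" "tree (swap T e f)" for e f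
      using that inR[OF cle] inR[OF cl_le] by blast
    obtain u where u: "u \<in> sources T lam" using 3 srcs by blast
    show ?thesis
    proof (cases "fst s5 ''have'' 0 = 0")
      case True
      \<comment> \<open>Nothing limits the price change: no reached price is negative and no
        exchange of any cost leads out of the reached set.\<close>
      then have S: "?S = {}" using min by (simp add: tracks_min_def)
      have "\<not> feas T'" for T'
      proof (rule infeasible_if_closed[OF inv' reach_subset _ capR])
        show "u \<in> ?R" "cap lam u < cnt T u" using u sources_subset_reach by (auto simp: sources_def)
        show "0 \<le> lam v" if "v \<in> ?R" for v using S_neg[OF that] unfolding S by force
        show "cl f \<in> ?R" if "e \<in> T" "cl e \<in> ?R" "f < m" "f \<notin> T" "tree (swap T e f)" for e f
          using S_gap[OF that(1-4) _ that(5)] unfolding S by blast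
      qed
      then show ?thesis using True fr5 by (simp add: s' result_ok_def)
    next
      case False
      then have d: "?d \<in> ?S" "\<And>x. x \<in> ?S \<Longrightarrow> ?d \<le> x" using min by (simp_all add: tracks_min_def)
      have s': "s' = den raise_prog s5" using False by (simp add: s')
      have fr: "fst s' ''done'' 0 = 0" "fst s' ''answer'' 0 = 0" "chosen s' = T"
        using fr5 chosen_frame[OF frame_den, of raise_prog s5] ch5 by (simp_all add: s' fst_den)
      have lam': "snd s' ''lam'' = raise ?R ?d lam"
        using raise_prog[OF st5] by (simp add: s' fr5 reach)
      have event: "(\<exists>v\<in>?R. lam v < 0 \<and> ?d = - lam v) \<or>
        (\<exists>e\<in>T. \<exists>f. cl e \<in> ?R \<and> f \<notin> T \<and> cl f \<notin> ?R \<and> tree (swap T e f) \<and> ?d = pcost lam f - pcost lam e)"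
        using d(1)
      proof
        assume "?d \<in> {- lam v | v. v \<le> n \<and> ?lev v \<noteq> 0 \<and> lam v < 0}"
        then show ?thesis using reach by auto
      next
        assume "?d \<in> {pcost lam f - pcost lam e | e f. e \<in> T \<and> ?lev (cl e) \<noteq> 0 \<and> f < m \<and> f \<notin> T \<and>
          ?lev (cl f) = 0 \<and> tree (swap T e f)}"
        then show ?thesis using inR[OF cle] inR[OF cl_le] by blast
      qed
      have pos: "0 < ?d"
      proof -
        from event consider v where "lam v < 0" "?d = - lam v"
          | e f where "e \<in> T" "cl e \<in> ?R" "f \<notin> T" "cl f \<notin> ?R" "tree (swap T e f)" "?d = pcost lam f - pcost lam e"
          by blast
        then show ?thesis
        proof cases
          case 2
          have "pcost lam e \<le> pcost lam f" using min_bases_swap_le[OF T 2(1,3)] 2(5) by simp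
          \<comment> \<open>At equal priced cost the exchange would be tight and the class of
            \<open>f\<close> reached already.\<close>
          moreover have "pcost lam e \<noteq> pcost lam f"
          proof
            assume "pcost lam e = pcost lam f"
            then have "(cl e, cl f) \<in> tight T lam"
              using swap_in_min_bases_iff[OF T 2(1,3)] 2 unfolding tight_def by blast
            then show False using reach_step 2 by blast
          qed
          ultimately show ?thesis using 2 by simp
        qed simp
      qed
      have inv2: "price_inv T (raise ?R ?d lam)"
        by (rule price_inv_raise[OF inv' bo reach_subset _ capR]) (use pos d(2) S_neg S_gap in auto)
      have "potential T (raise ?R ?d lam) < potential T lam"
        by (rule potential_raise_less[OF inv' inv2 bo pos _ event]) (use d(2) S_neg in auto)
      then show ?thesis using fr inv2 by (simp add: lam' T_def[symmetric] lam_def[symmetric])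
    qed
  qed
qed

text \<open>The number \<open>p\<close> counts the rounds made so far. A round without result lowers
  the potential, so potential plus \<open>p\<close> stays below the initial bound; once
  \<open>p\<close> equals that bound, only the alternative \<open>result_ok\<close> is left.\<close>

definition progress :: "nat \<Rightarrow> state \<Rightarrow> bool" where
  "progress p s \<longleftrightarrow> (if fst s ''done'' 0 = 0
     then fst s ''answer'' 0 = 0 \<and> bounds_ok \<and> price_inv (chosen s) (snd s ''lam'') \<and>
       potential (chosen s) (snd s ''lam'') + p < (m + 1) * (2 * n + 3)
     else result_ok s)"

lemma progress_nupd [simp]:
  assumes "x \<noteq> ''done''" "x \<noteq> ''answer''" "x \<noteq> ''tree''"
  shows "progress p (nupd x i k s) = progress p s"
  using assms by (simp add: progress_def result_ok_def chosen_def)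

lemma progress_main_body:
  assumes s: "static s" and p: "progress p s"
  shows "progress (Suc p) (den main_body s)"
proof (cases "fst s ''done'' 0 = 0")
  case True
  then have "den main_body s = den step_prog s" by (simp add: main_body_def)
  then show ?thesis using step_prog[OF s True] p True by (auto simp: progress_def)
next
  case False
  then have "den main_body s = s" by (simp add: main_body_def)
  then show ?thesis using p False by (simp add: progress_def)
qed

lemma main_prog:
  assumes s: "static s" and p: "progress 0 s"
  shows "result_ok (den main_prog s)"
proof -
  have disj: "nwr main_body \<inter> N = {}" if "{''v'', ''e'', ''skip'', ''i'', ''lab'', ''k'', ''p'', ''q'', ''f'',
     ''have'', ''r'', ''deg'', ''cap'', ''lev'', ''pe'', ''pf'', ''srcs'', ''found'', ''t'', ''tree'', ''answer'', ''done''}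
     \<inter> N = {}" for N
    using Int_mono[OF nwr_main_body order_refl, of N] that by (simp only: subset_empty)
  have sub: "nwr main_body \<inter> {''n'', ''m'', ''n1'', ''m1'', ''n3'', ''end1'', ''end2'', ''cls'', ''lower'', ''upper''} = {}"
    by (rule disj) simp
  have "nwr main_body \<inter> {''x'', ''y'', ''m1'', ''n3''} = {}" by (rule disj) simp
  then have nw: "''x'' \<notin> nwr main_body" "''y'' \<notin> nwr main_body" "''m1'' \<notin> nwr main_body" "''n3'' \<notin> nwr main_body"
    by blast+
  have rw: "''cost'' \<notin> rwr main_body" using rwr_main_body by auto
  have inner: "progress (q + (2 * n + 3)) (den (PFor ''y'' ''n3'' main_body) t)"
    if t: "static t" "progress q t" for q t
  proof (rule den_PFor_induct[where I = "\<lambda>k. progress (q + k)"], goal_cases)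
    case (5 k z)
    have "static z" by (rule static_frame[OF 5(3) t(1)]) (use sub rw in simp_all)
    then show ?case using progress_main_body[of z "q + k"] 5(4) by simp
  qed (use t nw in \<open>simp_all add: static_def\<close>)
  have "progress ((m + 1) * (2 * n + 3)) (den main_prog s)" unfolding main_prog_def
  proof (rule den_PFor_induct[where I = "\<lambda>k. progress (k * (2 * n + 3))"], goal_cases)
    case (5 k z)
    have "static z" by (rule static_frame[OF 5(3) s]) (use sub rw in simp_all)
    from inner[OF this 5(4)] show ?case by (simp add: add.commute)
  qed (use s p nw in \<open>simp_all add: static_def\<close>)
  then show ?thesis by (simp add: progress_def split: if_splits)
qed

lemma start_prog:
  assumes s: "static s" and empty: "chosen s = {}" and answer: "fst s ''answer'' 0 = 0"
    and lam: "\<And>v. v < n \<Longrightarrow> snd s ''lam'' v = - M" "snd s ''lam'' n = 0"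
    and bad: "fst s ''done'' 0 = 0 \<longleftrightarrow> bounds_ok"
  shows "progress 0 (den start_prog s)"
proof -
  define s1 where "s1 = den kruskal_prog s"
  define s2 where "s2 = nupd ''skip'' 0 m s1"
  define s3 where "s3 = den label_prog s2"
  let ?b = "PCond (beq (NCell ''lab'' (V ''v'')) (V ''lab'')) PSkip (PNat ''done'' (NConst 0) (NConst 1))"
  define s4 where "s4 = den (PFor ''v'' ''n'' ?b) s3"
  define s5 where "s5 = den (PCond (bpos (V ''n'')) PSkip (PNat ''done'' (NConst 0) (NConst 1))) s4"
  have f1: "frame {''j'', ''skip'', ''i'', ''lab'', ''k'', ''p'', ''q'', ''found'', ''f'', ''best'', ''tree''} {} s s1"
    unfolding s1_def by (rule frame_mono[OF frame_den]) auto
  have st1: "static s1" by (rule static_frame[OF f1 s]) auto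
  have f2: "frame {''skip''} {} s1 s2" unfolding s2_def by (rule frame_nupd) simp
  have st2: "static s2" by (rule static_frame[OF f2 st1]) auto
  have f3: "frame {''i'', ''lab'', ''k'', ''p'', ''q''} {} s2 s3"
    unfolding s3_def by (rule frame_mono[OF frame_den]) auto
  have st3: "static s3" by (rule static_frame[OF f3 st2]) auto
  have f4: "frame {''v'', ''done''} {} s3 s4" unfolding s4_def by (rule frame_mono[OF frame_den]) auto
  have st4: "static s4" by (rule static_frame[OF f4 st3]) auto
  have f5: "frame {''done''} {} s4 s5" unfolding s5_def by (rule frame_mono[OF frame_den]) auto
  have den: "den start_prog s = s5"
    using st1 by (simp add: start_prog_def s1_def s2_def s3_def s4_def s5_def static_def)
  let ?F = "chosen s1" and ?lam = "snd s ''lam''"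
  have ch: "chosen s2 = ?F" "chosen s3 = ?F" "chosen s4 = ?F" "chosen s5 = ?F"
    using chosen_frame[OF f2] chosen_frame[OF f3] chosen_frame[OF f4] chosen_frame[OF f5] by simp_all
  have fr: "snd s5 ''lam'' = ?lam" "fst s5 ''answer'' 0 = 0" "fst s3 ''done'' 0 = fst s ''done'' 0"
    using f1 f2 f3 f4 f5 answer by (simp_all add: frame_def)
  note kr = kruskal_prog[OF s empty, folded s1_def]
  have lab: "fst s3 ''lab'' x = fst s3 ''lab'' y \<longleftrightarrow> (x, y) \<in> conn ?F" if "x < n" "y < n" for x y
  proof -
    have "fst s2 ''skip'' 0 = m" by (simp add: s2_def)
    moreover have "m \<notin> ?F" by (simp add: chosen_def)
    ultimately show ?thesis using label_prog[OF st2 that] ch(1) by (simp add: s3_def)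
  qed
  let ?I = "\<lambda>k t. fst t ''done'' 0 = 0 \<longleftrightarrow> fst s ''done'' 0 = 0 \<and> (\<forall>v<k. fst s3 ''lab'' v = fst s3 ''lab'' 0)"
  have "?I n s4" unfolding s4_def
  proof (rule den_PFor_induct[where I = ?I], goal_cases)
    case (5 k t)
    have "fst t ''lab'' = fst s3 ''lab''" using 5(3) by (simp add: frame_def)
    then show ?case using 5(2,4) by (auto simp: less_Suc_eq)
  qed (use st3 fr in \<open>auto simp: static_def\<close>)
  moreover have "fst s5 ''done'' 0 = 0 \<longleftrightarrow> fst s4 ''done'' 0 = 0 \<and> 0 < n"
    using st4 by (simp add: s5_def static_def)
  ultimately have fin: "fst s5 ''done'' 0 = 0 \<longleftrightarrow> bounds_ok \<and> 0 < n \<and> (\<forall>v<n. (v, 0) \<in> conn ?F)"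
    using bad lab by auto
  show ?thesis
  proof (cases "fst s5 ''done'' 0 = 0")
    case True
    have "(x, y) \<in> conn ?F" if "x < n" "y < n" for x y
      using True fin that by (meson conn_sym conn_trans)
    then have tF: "tree ?F" using True fin kr(1) by (auto simp: tree_def chosen_def)
    from kr(3)[OF tF] obtain T where T: "T \<in> min_bases (pcost ?lam)" "?F \<subseteq> T" by blast
    then have "?F = T" using kruskal_end[OF min_basesD(1)[OF T(1)] T(2) kr(2)] by simp
    \<comment> \<open>All vertex prices are \<open>- M\<close>, which is negative, so the invariant
      does not yet require any degrees.\<close>
    then have "price_inv ?F ?lam" using T lam M_pos by (simp add: price_inv_def)
    moreover have "potential ?F ?lam < (m + 1) * (2 * n + 3)"
      by (rule potential_less) (auto simp: chosen_def)
    ultimately show ?thesis using True fin fr unfolding den progress_def ch by simp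
  next
    case False
    have "\<not> feas T" for T
    \<comment> \<open>A feasible tree would force \<open>bounds_ok\<close> and would make the greedy
      forest a tree, hence connected and nonempty; the tests just made exclude this.\<close>
    proof
      assume T: "feas T"
      then have tT: "tree T" and bo: bounds_ok by (force simp: feas_def bounds_ok_def)+
      from kr(3)[OF tT] obtain T' where T': "T' \<in> min_bases (pcost ?lam)" "?F \<subseteq> T'" by blast
      then have "?F = T'" using kruskal_end[OF min_basesD(1)[OF T'(1)] T'(2) kr(2)] by simp
      then have "tree ?F" using min_basesD(1)[OF T'(1)] by simp
      then show False using False fin bo by (auto simp: tree_def)
    qed
    then show ?thesis using False fr by (simp add: den progress_def result_ok_def)
  qed
qed

end

section \<open>Presentations of graphs\<close>

definition arcs :: "'a set set \<Rightarrow> 'a rel" where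
  "arcs E = {(x, y). {x, y} \<in> E}"

lemma rtrancl_distinct_path:
  assumes "(x, y) \<in> r\<^sup>*"
  shows "\<exists>xs. xs \<noteq> [] \<and> hd xs = x \<and> last xs = y \<and> distinct xs \<and>
    (\<forall>i. Suc i < length xs \<longrightarrow> (xs ! i, xs ! Suc i) \<in> r)"
  using assms
proof induction
  case base
  show ?case by (rule exI[of _ "[x]"]) simp
next
  case (step y z)
  then obtain xs where xs: "xs \<noteq> []" "hd xs = x" "last xs = y" "distinct xs"
    "\<And>i. Suc i < length xs \<Longrightarrow> (xs ! i, xs ! Suc i) \<in> r" by blast
  show ?case
  proof (cases "z \<in> set xs")
    case True
    \<comment> \<open>The path already visits \<open>z\<close> and is cut off there.\<close>
    then obtain ys zs where eq: "xs = ys @ z # zs" by (meson split_list)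
    have "((ys @ [z]) ! i, (ys @ [z]) ! Suc i) \<in> r" if "Suc i < length (ys @ [z])" for i
    proof -
      have "i < length ys" using that by simp
      then show ?thesis using xs(5)[of i] by (cases "Suc i = length ys") (auto simp: eq nth_append)
    qed
    then show ?thesis using xs by (intro exI[of _ "ys @ [z]"]) (auto simp: eq hd_append)
  next
    case False
    have "((xs @ [z]) ! i, (xs @ [z]) ! Suc i) \<in> r" if "Suc i < length (xs @ [z])" for i
    proof (cases "Suc i < length xs")
      case False
      then have "Suc i = length xs" using that by simp
      then have "xs ! i = y" using xs(1,3) by (metis last_conv_nth diff_Suc_1)
      then show ?thesis using \<open>Suc i = length xs\<close> step.hyps by (simp add: nth_append)
    qed (use xs(5) in \<open>simp add: nth_append\<close>)
    then show ?thesis using xs False by (intro exI[of _ "xs @ [z]"]) auto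
  qed
qed

text \<open>A cycle is an edge together with a connection of its ends that avoids it. This links
  cycles as lists of vertices to the description of forests by bridges.\<close>

lemma acyclic_iff_bridges:
  assumes "simple_graph T"
  shows "(\<nexists>xs. is_cycle T xs) \<longleftrightarrow>
    (\<forall>x y. {x, y} \<in> uedges T \<longrightarrow> (x, y) \<notin> (arcs (uedges T - {{x, y}}))\<^sup>*)"
proof (intro iffI allI impI notI)
  fix x y assume nc: "\<nexists>xs. is_cycle T xs" and xy: "{x, y} \<in> uedges T"
    and "(x, y) \<in> (arcs (uedges T - {{x, y}}))\<^sup>*"
  from rtrancl_distinct_path[OF this(3)] obtain xs where xs: "xs \<noteq> []" "hd xs = x" "last xs = y" "distinct xs"
    "\<And>i. Suc i < length xs \<Longrightarrow> (xs ! i, xs ! Suc i) \<in> arcs (uedges T - {{x, y}})" by blast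
  have "card {x, y} = 2" using assms xy by (auto simp: simple_graph_def)
  then have ne: "x \<noteq> y" by auto
  have x: "xs ! 0 = x" and y: "xs ! (length xs - 1) = y" using xs by (simp_all add: hd_conv_nth last_conv_nth)
  \<comment> \<open>With just two vertices the path would consist of the removed edge
    itself.\<close>
  have "length xs \<noteq> 0" "length xs \<noteq> 1" "length xs \<noteq> 2"
    using xs(1) x y ne xs(5)[of 0] by (auto simp: arcs_def)
  then have len: "3 \<le> length xs" by linarith
  have "{xs ! i, xs ! (Suc i mod length xs)} \<in> uedges T" if i: "i < length xs" for i
  proof (cases "Suc i < length xs")
    case True
    then show ?thesis using xs(5)[of i] by (simp add: arcs_def)
  next
    case False
    then have "i = length xs - 1" "Suc i = length xs" using i by auto
    then show ?thesis using xy x y by (simp add: insert_commute)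
  qed
  then have "is_cycle T xs" using len xs(4) by (simp add: is_cycle_def)
  then show False using nc by blast
next
  assume br: "\<forall>x y. {x, y} \<in> uedges T \<longrightarrow> (x, y) \<notin> (arcs (uedges T - {{x, y}}))\<^sup>*"
  assume "\<exists>xs. is_cycle T xs"
  then obtain xs where xs: "3 \<le> length xs" "distinct xs"
    "\<And>i. i < length xs \<Longrightarrow> {xs ! i, xs ! (Suc i mod length xs)} \<in> uedges T"
    by (auto simp: is_cycle_def)
  have "xs \<noteq> []" using xs(1) by auto
  let ?l = "length xs - 1"
  let ?x = "xs ! 0" and ?y = "xs ! ?l"
  have "Suc ?l = length xs" using xs(1) by simp
  then have "Suc ?l mod length xs = 0" by simp
  then have e: "{?x, ?y} \<in> uedges T" using xs(3)[of ?l] xs(1) by (simp add: insert_commute)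
  have "(?x, xs ! i) \<in> (arcs (uedges T - {{?x, ?y}}))\<^sup>*" if "i \<le> ?l" for i
    using that
  proof (induction i)
    case (Suc i)
    \<comment> \<open>In a list of at least three distinct vertices, no consecutive pair coincides
      with the closing edge.\<close>
    have "{xs ! i, xs ! Suc i} \<noteq> {?x, ?y}"
      using Suc.prems xs(1,2) \<open>xs \<noteq> []\<close> by (auto simp: doubleton_eq_iff nth_eq_iff_index_eq)
    moreover have "{xs ! i, xs ! Suc i} \<in> uedges T" using xs(3)[of i] Suc.prems by simp
    ultimately have "(xs ! i, xs ! Suc i) \<in> arcs (uedges T - {{?x, ?y}})" by (simp add: arcs_def)
    then show ?case using Suc by (auto intro: rtrancl_into_rtrancl)
  qed simp
  then show False using br e by blast
qed

locale presented_graph =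
  fixes G :: "'a ugraph" and vs :: "'a list" and es :: "(nat \<times> nat) list"
  assumes simple: "simple_graph G" and presents: "presents vs es G"

sublocale presented_graph \<subseteq> index_graph "length vs" "length es" "cells (map fst es)" "cells (map snd es)"
  using presents by unfold_locales (auto simp: presents_def cells_def)

context presented_graph begin

abbreviation a where "a \<equiv> cells (map fst es)"
abbreviation b where "b \<equiv> cells (map snd es)"
abbreviation n where "n \<equiv> length vs"
abbreviation m where "m \<equiv> length es"

definition edge :: "nat \<Rightarrow> 'a set" where
  "edge k = edge_at vs (es ! k)"

definition subgraph :: "nat set \<Rightarrow> 'a ugraph" where
  "subgraph F = \<lparr>uverts = set vs, uedges = edge ` F\<rparr>"

lemma edge_eq: "k < m \<Longrightarrow> edge k = {vs ! a k, vs ! b k}"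
  by (simp add: edge_def edge_at_def cells_def)

lemma edges: "edge ` {..<m} = uedges G"
proof -
  have "(!) es ` {..<m} = set es" using nth_image[of m es] by (simp add: lessThan_atLeast0)
  moreover have "edge ` {..<m} = edge_at vs ` ((!) es ` {..<m})" by (simp add: image_image edge_def)
  ultimately have "edge ` {..<m} = set (map (edge_at vs) es)" by simp
  then show ?thesis using presents by (simp add: presents_def)
qed

lemma inj_edge: "inj_on edge {..<m}"
proof (rule inj_onI)
  fix j k assume "j \<in> {..<m}" "k \<in> {..<m}" "edge j = edge k"
  then show "j = k" using presents nth_eq_iff_index_eq[of "map (edge_at vs) es" j k]
    by (simp add: presents_def edge_def)
qed

lemma nth_vs_eq: "i < n \<Longrightarrow> j < n \<Longrightarrow> vs ! i = vs ! j \<longleftrightarrow> i = j"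
  using presents by (simp add: presents_def nth_eq_iff_index_eq)

lemma simple_subgraph:
  assumes "F \<subseteq> {..<m}"
  shows "simple_graph (subgraph F)"
proof -
  have "edge ` F \<subseteq> uedges G" using edges assms by blast
  then show ?thesis using simple presents by (auto simp: simple_graph_def subgraph_def presents_def)
qed

lemma adj_iff:
  assumes "F \<subseteq> {..<m}" "i < n" "j < n"
  shows "(vs ! i, vs ! j) \<in> arcs (edge ` F) \<longleftrightarrow> (i, j) \<in> adj F"
proof -
  have "{vs ! i, vs ! j} = edge k \<longleftrightarrow> i = a k \<and> j = b k \<or> i = b k \<and> j = a k" if "k \<in> F" for k
  proof -
    have k: "k < m" using that assms by auto
    show ?thesis using ends[OF k] assms by (simp add: edge_eq[OF k] doubleton_eq_iff nth_vs_eq)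
  qed
  then show ?thesis by (auto simp: arcs_def adj_def image_iff)
qed

lemma conn_iff:
  assumes F: "F \<subseteq> {..<m}" and ij: "i < n" "j < n"
  shows "(vs ! i, vs ! j) \<in> (arcs (edge ` F))\<^sup>* \<longleftrightarrow> (i, j) \<in> conn F"
proof
  assume "(vs ! i, vs ! j) \<in> (arcs (edge ` F))\<^sup>*"
  then have "\<exists>k<n. vs ! j = vs ! k \<and> (i, k) \<in> conn F"
  proof induction
    case base
    then show ?case using ij by auto
  next
    case (step y z)
    then obtain k where k: "k < n" "y = vs ! k" "(i, k) \<in> conn F" by blast
    have "{y, z} \<in> uedges (subgraph F)" using step.hyps by (simp add: arcs_def subgraph_def)
    then have "z \<in> set vs" using simple_subgraph[OF F] unfolding simple_graph_def
      by (metis insertI1 insert_commute subsetD subgraph_def ugraph.select_convs(1))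
    then obtain l where l: "l < n" "z = vs ! l" by (auto simp: in_set_conv_nth)
    then have "(k, l) \<in> adj F" using adj_iff[OF F k(1) l(1)] step.hyps k by simp
    then show ?case using k l by (auto simp: conn_def intro: rtrancl_into_rtrancl)
  qed
  then show "(i, j) \<in> conn F" using ij nth_vs_eq by auto
next
  assume "(i, j) \<in> conn F"
  then have "(i, j) \<in> (adj F)\<^sup>*" by (simp add: conn_def)
  then have "j < n \<and> (vs ! i, vs ! j) \<in> (arcs (edge ` F))\<^sup>*"
  proof induction
    case base
    then show ?case using ij by simp
  next
    case (step y z)
    have "z < n" using step.hyps(2) ends F by (auto simp: adj_def)
    then have "(vs ! y, vs ! z) \<in> arcs (edge ` F)" using adj_iff[OF F, of y z] step by simp
    then show ?case using step.IH \<open>z < n\<close> by (auto intro: rtrancl_into_rtrancl)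
  qed
  then show "(vs ! i, vs ! j) \<in> (arcs (edge ` F))\<^sup>*" by simp
qed

lemma forest_iff:
  assumes F: "F \<subseteq> {..<m}"
  shows "forest F \<longleftrightarrow> (\<nexists>xs. is_cycle (subgraph F) xs)"
proof -
  have bridge: "(x, y) \<in> (arcs (uedges (subgraph F) - {{x, y}}))\<^sup>* \<longleftrightarrow> (a k, b k) \<in> conn (F - {k})"
    if k: "k \<in> F" "{x, y} = edge k" for x y k
  proof -
    have km: "k < m" using k F by auto
    have "edge ` F - {edge k} = edge ` (F - {k})"
      using inj_on_image_set_diff[OF inj_edge, of F "{k}"] F km by auto
    moreover have "x = vs ! a k \<and> y = vs ! b k \<or> x = vs ! b k \<and> y = vs ! a k"
      using k(2) by (auto simp: edge_eq[OF km] doubleton_eq_iff)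
    ultimately show ?thesis
      using conn_iff[of "F - {k}" "a k" "b k"] conn_iff[of "F - {k}" "b k" "a k"] ends[OF km] F conn_sym
      by (auto simp: subgraph_def k(2))
  qed
  show ?thesis unfolding acyclic_iff_bridges[OF simple_subgraph[OF F]]
  proof
    assume f: "forest F"
    show "\<forall>x y. {x, y} \<in> uedges (subgraph F) \<longrightarrow> (x, y) \<notin> (arcs (uedges (subgraph F) - {{x, y}}))\<^sup>*"
    proof (intro allI impI)
      fix x y assume "{x, y} \<in> uedges (subgraph F)"
      then obtain k where "k \<in> F" "{x, y} = edge k" by (auto simp: subgraph_def)
      with bridge[OF this] f show "(x, y) \<notin> (arcs (uedges (subgraph F) - {{x, y}}))\<^sup>*"
        by (simp add: forest_def)
    qed
  next
    assume br: "\<forall>x y. {x, y} \<in> uedges (subgraph F) \<longrightarrow> (x, y) \<notin> (arcs (uedges (subgraph F) - {{x, y}}))\<^sup>*"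
    show "forest F" unfolding forest_def
    proof
      fix k assume k: "k \<in> F"
      then have e: "{vs ! a k, vs ! b k} = edge k" using edge_eq F by auto
      then have "{vs ! a k, vs ! b k} \<in> uedges (subgraph F)" using k by (auto simp: subgraph_def)
      then show "(a k, b k) \<notin> conn (F - {k})" using br bridge[OF k e] by blast
    qed
  qed
qed

lemma tree_iff:
  assumes F: "F \<subseteq> {..<m}"
  shows "spanning_tree_of (subgraph F) G \<longleftrightarrow> tree F"
proof -
  have "connected_graph (subgraph F) \<longleftrightarrow> 0 < n \<and> (\<forall>x<n. \<forall>y<n. (x, y) \<in> conn F)"
  proof -
    have "connected_graph (subgraph F) \<longleftrightarrow> vs \<noteq> [] \<and>
        (\<forall>u\<in>set vs. \<forall>v\<in>set vs. (u, v) \<in> (arcs (edge ` F))\<^sup>*)"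
      by (simp add: connected_graph_def subgraph_def arcs_def)
    also have "\<dots> \<longleftrightarrow> 0 < n \<and> (\<forall>x<n. \<forall>y<n. (vs ! x, vs ! y) \<in> (arcs (edge ` F))\<^sup>*)"
      by (auto simp: all_set_conv_all_nth)
    finally show ?thesis using conn_iff[OF F] by auto
  qed
  moreover have "uverts (subgraph F) = uverts G" "uedges (subgraph F) \<subseteq> uedges G"
    using presents edges F by (auto simp: subgraph_def presents_def)
  ultimately show ?thesis
    using simple_subgraph[OF F] forest_iff[OF F] F by (auto simp: spanning_tree_of_def is_tree_def tree_def)
qed

lemma spanning_tree_subgraph:
  assumes "spanning_tree_of T G"
  obtains F where "F \<subseteq> {..<m}" "T = subgraph F"
proof
  let ?F = "{k. k < m \<and> edge k \<in> uedges T}"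
  show "?F \<subseteq> {..<m}" by auto
  have sub: "uedges T \<subseteq> edge ` {..<m}" using assms edges by (simp add: spanning_tree_of_def)
  then have "edge ` ?F = uedges T" by auto
  moreover have "uverts T = set vs" using assms presents by (simp add: spanning_tree_of_def presents_def)
  ultimately show "T = subgraph ?F" by (simp add: subgraph_def)
qed

lemma degree_subgraph:
  assumes F: "F \<subseteq> {..<m}" and v: "v < n"
  shows "degree_in (subgraph F) (vs ! v) = card {k \<in> F. a k = v \<or> b k = v}"
proof -
  have "{e \<in> uedges (subgraph F). vs ! v \<in> e} = edge ` {k \<in> F. a k = v \<or> b k = v}"
  proof -
    have "vs ! v \<in> edge k \<longleftrightarrow> a k = v \<or> b k = v" if "k \<in> F" for k
    proof -
      have k: "k < m" using that F by auto
      show ?thesis using ends[OF k] v by (auto simp: edge_eq[OF k] nth_vs_eq)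
    qed
    then show ?thesis by (auto simp: subgraph_def)
  qed
  moreover have "inj_on edge {k \<in> F. a k = v \<or> b k = v}" using F by (auto intro: inj_on_subset[OF inj_edge])
  ultimately show ?thesis by (simp add: degree_in_def card_image)
qed

lemma cost_subgraph:
  assumes "F \<subseteq> {..<m}"
  shows "tree_cost c (subgraph F) = (\<Sum>k\<in>F. c (edge k))"
  using sum.reindex[OF inj_on_subset[OF inj_edge assms], of c] by (simp add: tree_cost_def subgraph_def)

end

section \<open>Initialisation of classes, bounds and prices\<close>

definition class_body :: prog where
  "class_body = PNat ''cls'' (V ''k'') (V ''n'') ;;
     PCond (bpos (NCell ''inU'' (NCell ''end1'' (V ''k'')))) (PNat ''cls'' (V ''k'') (NCell ''end1'' (V ''k''))) PSkip ;;
     PCond (bpos (NCell ''inU'' (NCell ''end2'' (V ''k'')))) (PNat ''cls'' (V ''k'') (NCell ''end2'' (V ''k''))) PSkip"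

definition big_body :: prog where
  "big_body = PCond (RLess (RCell ''cost'' (V ''k'')) (RConst 0))
     (PReal ''big'' (NConst 0) (RSub (RCell ''big'' (NConst 0)) (RCell ''cost'' (V ''k''))))
     (PReal ''big'' (NConst 0) (RAdd (RCell ''big'' (NConst 0)) (RCell ''cost'' (V ''k''))))"

definition price_loop :: prog where
  "price_loop = PFor ''v'' ''n'' (PReal ''lam'' (V ''v'') (RSub (RConst 0) (RCell ''big'' (NConst 0))))"

definition bounds_loop :: prog where
  "bounds_loop = PFor ''v'' ''n'' (PCond (NLess (NCell ''upper'' (V ''v'')) (NCell ''lower'' (V ''v'')))
     (PNat ''done'' (NConst 0) (NConst 1)) PSkip)"

text \<open>The class of an edge defaults to \<open>n\<close> and is overwritten by an end in
  \<open>U\<close>; stability of \<open>U\<close> makes the order of the two tests irrelevant.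
  Starting \<open>big\<close> at 1 makes it strictly larger than the sum of the absolute
  costs.\<close>

definition init_prog :: prog where
  "init_prog = PFor ''k'' ''m'' class_body ;; PNat ''upper'' (V ''n'') (V ''m1'') ;;
     PReal ''big'' (NConst 0) (RConst 1) ;; PFor ''k'' ''m'' big_body ;; price_loop ;; bounds_loop"

text \<open>Kept apart from the rest because it writes loop limits. It has no loop itself, and
  afterwards the limits are constant, as the time bound for the main part demands.\<close>

definition setup_prog :: prog where
  "setup_prog = PNat ''n1'' (NConst 0) (NAdd (V ''n'') (NConst 1)) ;;
     PNat ''m1'' (NConst 0) (NAdd (V ''m'') (NConst 1)) ;;
     PNat ''n3'' (NConst 0) (NAdd (NAdd (V ''n'') (V ''n'')) (NConst 3))"

definition tree_prog :: prog where
  "tree_prog = init_prog ;; start_prog ;; main_prog"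

lemma nwr_class_body [simp]: "nwr class_body = {''cls''}"
  and rwr_class_body [simp]: "rwr class_body = {}"
  by (auto simp: class_body_def)

lemma nwr_big_body [simp]: "nwr big_body = {}"
  and rwr_big_body [simp]: "rwr big_body = {''big''}"
  by (auto simp: big_body_def)

lemma nwr_price_loop [simp]: "nwr price_loop = {''v''}"
  and rwr_price_loop [simp]: "rwr price_loop = {''lam''}"
  by (auto simp: price_loop_def)

lemma nwr_bounds_loop [simp]: "nwr bounds_loop = {''v'', ''done''}"
  and rwr_bounds_loop [simp]: "rwr bounds_loop = {}"
  by (auto simp: bounds_loop_def)

lemma nwr_init_prog [simp]: "nwr init_prog = {''k'', ''cls'', ''upper'', ''v'', ''done''}"
  and rwr_init_prog [simp]: "rwr init_prog = {''big'', ''lam''}"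
  by (auto simp: init_prog_def)

lemma class_loop:
  assumes k: "k < fst s ''m'' 0" and N: "N = fst s ''n'' 0"
  shows "fst (den (PFor ''k'' ''m'' class_body) s) ''cls'' k =
    (if fst s ''inU'' (fst s ''end2'' k) \<noteq> 0 then fst s ''end2'' k
     else if fst s ''inU'' (fst s ''end1'' k) \<noteq> 0 then fst s ''end1'' k else N)"
proof -
  let ?I = "\<lambda>j t. \<forall>k<j. fst t ''cls'' k =
    (if fst s ''inU'' (fst s ''end2'' k) \<noteq> 0 then fst s ''end2'' k
     else if fst s ''inU'' (fst s ''end1'' k) \<noteq> 0 then fst s ''end1'' k else N)"
  have "?I (fst s ''m'' 0) (den (PFor ''k'' ''m'' class_body) s)"
  proof (rule den_PFor_induct[where I = ?I], goal_cases)
    case (5 k t)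
    have t: "fst t ''inU'' = fst s ''inU''" "fst t ''end1'' = fst s ''end1''" "fst t ''end2'' = fst s ''end2''"
      "fst t ''n'' 0 = N"
      using 5(3) N by (auto simp: frame_def)
    show ?case using 5(2,4) by (auto simp: class_body_def t less_Suc_eq)
  qed auto
  then show ?thesis using k by blast
qed

lemma big_loop:
  "snd (den (PFor ''k'' ''m'' big_body) s) ''big'' 0 =
    snd s ''big'' 0 + (\<Sum>k<fst s ''m'' 0. \<bar>snd s ''cost'' k\<bar>)"
proof -
  let ?I = "\<lambda>j t. snd t ''big'' 0 = snd s ''big'' 0 + (\<Sum>k<j. \<bar>snd s ''cost'' k\<bar>)"
  show ?thesis
  proof (rule den_PFor_induct[where I = ?I], goal_cases)
    case (5 k t)
    have t: "snd t ''cost'' = snd s ''cost''" using 5(3) by (auto simp: frame_def)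
    show ?case using 5(2,4) by (auto simp: big_body_def t)
  qed auto
qed

lemma price_loop:
  "snd (den price_loop s) ''lam'' v = (if v < fst s ''n'' 0 then - snd s ''big'' 0 else snd s ''lam'' v)"
proof -
  let ?I = "\<lambda>j t. \<forall>v. snd t ''lam'' v = (if v < j then - snd s ''big'' 0 else snd s ''lam'' v)"
  have "?I (fst s ''n'' 0) (den price_loop s)" unfolding price_loop_def
  proof (rule den_PFor_induct[where I = ?I], goal_cases)
    case (5 k t)
    have t: "snd t ''big'' = snd s ''big''" using 5(3) by (auto simp: frame_def)
    show ?case using 5(2,4) by (auto simp: t less_Suc_eq)
  qed auto
  then show ?thesis by blast
qed

lemma bounds_loop:
  "fst (den bounds_loop s) ''done'' 0 = 0 \<longleftrightarrow>
    fst s ''done'' 0 = 0 \<and> (\<forall>v<fst s ''n'' 0. fst s ''lower'' v \<le> fst s ''upper'' v)"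
proof -
  let ?I = "\<lambda>j t. fst t ''done'' 0 = 0 \<longleftrightarrow>
    fst s ''done'' 0 = 0 \<and> (\<forall>v<j. fst s ''lower'' v \<le> fst s ''upper'' v)"
  show ?thesis unfolding bounds_loop_def
  proof (rule den_PFor_induct[where I = ?I], goal_cases)
    case (5 k t)
    have t: "fst t ''lower'' = fst s ''lower''" "fst t ''upper'' = fst s ''upper''"
      using 5(3) by (auto simp: frame_def)
    show ?case using 5(2,4) by (auto simp: t less_Suc_eq)
  qed auto
qed

lemma init_prog:
  fixes s defines "s' \<equiv> den init_prog s"
  shows "k < fst s ''m'' 0 \<Longrightarrow> fst s' ''cls'' k =
      (if fst s ''inU'' (fst s ''end2'' k) \<noteq> 0 then fst s ''end2'' k
       else if fst s ''inU'' (fst s ''end1'' k) \<noteq> 0 then fst s ''end1'' k else fst s ''n'' 0)"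
    and "fst s' ''upper'' = (fst s ''upper'')(fst s ''n'' 0 := fst s ''m1'' 0)"
    and "snd s' ''lam'' v = (if v < fst s ''n'' 0
      then - (1 + (\<Sum>k<fst s ''m'' 0. \<bar>snd s ''cost'' k\<bar>)) else snd s ''lam'' v)"
    and "fst s' ''done'' 0 = 0 \<longleftrightarrow>
      fst s ''done'' 0 = 0 \<and> (\<forall>v<fst s ''n'' 0. fst s ''lower'' v \<le> fst s ''upper'' v)"
proof -
  define s1 where "s1 = den (PFor ''k'' ''m'' class_body) s"
  define s2 where "s2 = rupd ''big'' 0 1 (nupd ''upper'' (fst s1 ''n'' 0) (fst s1 ''m1'' 0) s1)"
  define s3 where "s3 = den (PFor ''k'' ''m'' big_body) s2"
  define s4 where "s4 = den price_loop s3"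
  have s': "s' = den bounds_loop s4"
    by (simp add: s'_def init_prog_def s1_def s2_def s3_def s4_def)
  have f1: "frame {''k'', ''cls''} {} s s1" unfolding s1_def by (rule frame_mono[OF frame_den]) auto
  have f2: "frame {''upper''} {''big''} s1 s2" by (simp add: s2_def frame_def)
  have f3: "frame {''k''} {''big''} s2 s3" unfolding s3_def by (rule frame_mono[OF frame_den]) auto
  have f4: "frame {''v''} {''lam''} s3 s4" unfolding s4_def by (rule frame_mono[OF frame_den]) auto
  have f5: "frame {''v'', ''done''} {} s4 s'" unfolding s' by (rule frame_mono[OF frame_den]) auto
  show "k < fst s ''m'' 0 \<Longrightarrow> fst s' ''cls'' k =
      (if fst s ''inU'' (fst s ''end2'' k) \<noteq> 0 then fst s ''end2'' k
       else if fst s ''inU'' (fst s ''end1'' k) \<noteq> 0 then fst s ''end1'' k else fst s ''n'' 0)"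
    using class_loop[of k s, folded s1_def] f2 f3 f4 f5 by (simp add: frame_def)
  have u: "fst s2 ''upper'' = (fst s ''upper'')(fst s ''n'' 0 := fst s ''m1'' 0)"
    using f1 by (simp add: s2_def frame_def)
  then show "fst s' ''upper'' = (fst s ''upper'')(fst s ''n'' 0 := fst s ''m1'' 0)"
    using f3 f4 f5 by (simp add: frame_def)
  have "snd s3 ''big'' 0 = 1 + (\<Sum>k<fst s ''m'' 0. \<bar>snd s ''cost'' k\<bar>)"
    using big_loop[of s2, folded s3_def] f1 f2 by (simp add: s2_def frame_def)
  then show "snd s' ''lam'' v = (if v < fst s ''n'' 0
      then - (1 + (\<Sum>k<fst s ''m'' 0. \<bar>snd s ''cost'' k\<bar>)) else snd s ''lam'' v)"
    using price_loop[of s3 v, folded s4_def] f1 f2 f3 f5 by (simp add: frame_def)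
  show "fst s' ''done'' 0 = 0 \<longleftrightarrow>
      fst s ''done'' 0 = 0 \<and> (\<forall>v<fst s ''n'' 0. fst s ''lower'' v \<le> fst s ''upper'' v)"
    using bounds_loop[of s4, folded s'] f1 f2 f3 f4 u by (simp add: frame_def)
qed

section \<open>Correctness and running time of the complete program\<close>

lemmas prog_defs = tree_prog_def init_prog_def price_loop_def bounds_loop_def class_body_def big_body_def
  start_prog_def kruskal_prog_def kruskal_body_def pick_body_def label_prog_def relabel_prog_def
  main_prog_def main_body_def step_prog_def count_prog_def count_body_def cap_prog_def cap_body_def
  bfs_prog_def bfs_e_body_def bfs_f_body_def find_prog_def find_body_def augment_prog_def augment_body_def
  delta_prog_def delta_v_body_def delta_e_body_def delta_f_body_def improve_def raise_prog_def accept_prog_def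

lemma counters_ok_tree_prog: "counters_ok tree_prog"
  by (simp add: prog_defs)

lemma limits_tree_prog: "limits tree_prog \<subseteq> {''n'', ''m'', ''n1'', ''m1'', ''n3''}"
  by (simp add: prog_defs)

lemma nwr_tree_prog: "nwr tree_prog \<inter> {''n'', ''m'', ''n1'', ''m1'', ''n3''} = {}"
  by (simp add: prog_defs)

lemma tree_prog_correct:
  fixes vs es c U \<alpha> \<beta>
  defines "s' \<equiv> den tree_prog (den setup_prog (input_state vs es c U \<alpha> \<beta>))"
  assumes G: "simple_graph G" "presents vs es G" and U: "stable_set G U"
  shows "answers_yes s' \<longleftrightarrow> (\<exists>T. feasible_tree G U \<alpha> \<beta> T)"
    and "answers_yes s' \<Longrightarrow> min_cost_feasible_tree G c U \<alpha> \<beta> (output_graph vs es s')"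
proof -
  interpret presented_graph G vs es using G by unfold_locales
  define s1 where "s1 = den setup_prog (input_state vs es c U \<alpha> \<beta>)"
  define s2 where "s2 = den init_prog s1"
  define lo where "lo = cells (map (\<lambda>v. if v \<in> U then \<alpha> v else 0) vs)"
  define up where "up = (cells (map (\<lambda>v. if v \<in> U then \<beta> v else 0) vs))(n := Suc m)"
  \<comment> \<open>Read from memory instead of computed from the graph, so that
    \<open>static\<close> holds literally, also at indices from \<open>m\<close> on.\<close>
  define cl where "cl = fst s2 ''cls''"
  define cst where "cst = cells (map (\<lambda>p. c (edge_at vs p)) es)"
  define M where "M = 1 + (\<Sum>k<m. \<bar>cst k\<bar>)"
  have s1: "fst s1 ''n'' 0 = n" "fst s1 ''m'' 0 = m" "fst s1 ''n1'' 0 = n + 1" "fst s1 ''m1'' 0 = m + 1"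
    "fst s1 ''n3'' 0 = 2 * n + 3" "fst s1 ''end1'' = a" "fst s1 ''end2'' = b" "fst s1 ''lower'' = lo"
    "fst s1 ''inU'' = cells (map (\<lambda>v. if v \<in> U then 1 else 0) vs)"
    "fst s1 ''upper'' = cells (map (\<lambda>v. if v \<in> U then \<beta> v else 0) vs)"
    "fst s1 ''tree'' = (\<lambda>_. 0)" "fst s1 ''answer'' = (\<lambda>_. 0)" "fst s1 ''done'' = (\<lambda>_. 0)"
    "snd s1 ''cost'' = cst" "snd s1 ''lam'' = (\<lambda>_. 0)"
    by (simp_all add: s1_def setup_prog_def input_state_def lo_def cst_def cells_def)
  note init = init_prog[where s = s1, folded s2_def, unfolded s1]
  have inU: "cells (map (\<lambda>v. if v \<in> U then 1 else 0) vs) v \<noteq> (0::nat) \<longleftrightarrow> vs ! v \<in> U" if "v < n" for v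
    using that by (simp add: cells_def)
  have cl: "cl k = (if vs ! b k \<in> U then b k else if vs ! a k \<in> U then a k else n)" if "k < m" for k
    using init(1)[OF that] inU[OF ends(1)[OF that]] inU[OF ends(2)[OF that]] by (simp add: cl_def)
  interpret pg: priced_graph n m a b cl lo up cst M
    by unfold_locales (use cl ends in \<open>auto simp: lo_def up_def cells_def M_def less_imp_le\<close>)
  have f2: "frame {''k'', ''cls'', ''upper'', ''v'', ''done''} {''big'', ''lam''} s1 s2"
    unfolding s2_def by (rule frame_mono[OF frame_den]) auto
  have st: "pg.static s2"
    using f2 s1 init(2) unfolding pg.static_def by (simp add: frame_def cl_def up_def)
  have ok: "fst s2 ''done'' 0 = 0 \<longleftrightarrow> pg.bounds_ok"
    unfolding pg.bounds_ok_def using init(4) by (simp add: up_def)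
  have "pg.progress 0 (den start_prog s2)"
    by (rule pg.start_prog[OF st]) (use f2 s1 init(3) ok in \<open>auto simp: pg.chosen_def frame_def M_def\<close>)
  moreover have "pg.static (den start_prog s2)"
    by (rule pg.static_den[OF st]) (auto simp: start_prog_def)
  ultimately have res: "pg.result_ok s'"
    using pg.main_prog by (simp add: s'_def tree_prog_def s1_def s2_def)
  have Usub: "U \<subseteq> set vs" and stable: "\<not> edge k \<subseteq> U" if "k < m" for k
    using U G(2) edges that by (auto simp: stable_set_def presents_def induced_edges_def)
  have not_both: "\<not> (vs ! a k \<in> U \<and> vs ! b k \<in> U)" if "k < m" for k
    using stable[OF that] edge_eq[OF that] by simp
  \<comment> \<open>A vertex of \<open>U\<close> is the class of all edges at it, since none of them
    has a second end in \<open>U\<close>. A vertex outside \<open>U\<close> is the class of no edge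
    and has both bounds 0, so the conditions on it always hold.\<close>
  have cnt: "pg.cnt F v = (if vs ! v \<in> U then degree_in (subgraph F) (vs ! v) else 0)"
    if F: "F \<subseteq> {..<m}" and v: "v < n" for F v
  proof (cases "vs ! v \<in> U")
    case True
    have "cl k = v \<longleftrightarrow> a k = v \<or> b k = v" if "k \<in> F" for k
    proof -
      have k: "k < m" using that F by auto
      show ?thesis using True v unfolding cl[OF k] by (cases "a k = v"; cases "b k = v") (use not_both[OF k] in auto)
    qed
    then have "{k \<in> F. cl k = v} = {k \<in> F. a k = v \<or> b k = v}" by auto
    then show ?thesis using True degree_subgraph[OF F v] by (simp add: pg.cnt_def)
  next
    case False
    have "cl k \<noteq> v" if "k \<in> F" for k
    proof -
      have k: "k < m" using that F by auto
      show ?thesis using False v unfolding cl[OF k] by auto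
    qed
    then have none: "{k \<in> F. cl k = v} = {}" by auto
    show ?thesis unfolding pg.cnt_def none using False by simp
  qed
  have feas: "feasible_tree G U \<alpha> \<beta> (subgraph F) \<longleftrightarrow> pg.feas F" if F: "F \<subseteq> {..<m}" for F
  proof -
    have "(\<forall>v<n. lo v \<le> pg.cnt F v \<and> pg.cnt F v \<le> up v) \<longleftrightarrow>
      (\<forall>v<n. vs ! v \<in> U \<longrightarrow> \<alpha> (vs ! v) \<le> degree_in (subgraph F) (vs ! v) \<and> degree_in (subgraph F) (vs ! v) \<le> \<beta> (vs ! v))"
      using cnt[OF F] by (auto simp: lo_def up_def cells_def)
    also have "\<dots> \<longleftrightarrow> (\<forall>u\<in>U. \<alpha> u \<le> degree_in (subgraph F) u \<and> degree_in (subgraph F) u \<le> \<beta> u)"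
    proof -
      have "U \<subseteq> set vs" using U G(2) by (simp add: stable_set_def presents_def)
      then show ?thesis by (metis in_set_conv_nth nth_mem subsetD)
    qed
    finally show ?thesis using tree_iff[OF F] by (simp add: feasible_tree_def pg.feas_def)
  qed
  have cost: "tree_cost c (subgraph F) = sum cst F" if F: "F \<subseteq> {..<m}" for F
    unfolding cost_subgraph[OF F] using F by (intro sum.cong) (auto simp: cst_def cells_def edge_def)
  have all: "\<exists>F. F \<subseteq> {..<m} \<and> T = subgraph F" if "feasible_tree G U \<alpha> \<beta> T" for T
    using that spanning_tree_subgraph by (metis feasible_tree_def)
  have sub: "F \<subseteq> {..<m}" if "pg.feas F" for F using that by (simp add: pg.feas_def tree_def)
  show ans: "answers_yes s' \<longleftrightarrow> (\<exists>T. feasible_tree G U \<alpha> \<beta> T)"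
  proof
    assume "answers_yes s'"
    then have f: "pg.feas (pg.chosen s')" using res by (simp add: pg.result_ok_def answers_yes_def)
    then show "\<exists>T. feasible_tree G U \<alpha> \<beta> T" using feas[OF sub[OF f]] by blast
  next
    assume "\<exists>T. feasible_tree G U \<alpha> \<beta> T"
    then obtain F where "pg.feas F" using all feas by metis
    then show "answers_yes s'" using res by (auto simp: pg.result_ok_def answers_yes_def split: if_splits)
  qed
  have out: "output_graph vs es s' = subgraph (pg.chosen s')"
    by (auto simp: output_graph_def subgraph_def pg.chosen_def edge_def)
  assume "answers_yes s'"
  then have f: "pg.feas (pg.chosen s')" and opt: "\<And>F. pg.feas F \<Longrightarrow> sum cst (pg.chosen s') \<le> sum cst F"
    using res by (simp_all add: pg.result_ok_def answers_yes_def)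
  have "tree_cost c (subgraph (pg.chosen s')) \<le> tree_cost c T" if T: "feasible_tree G U \<alpha> \<beta> T" for T
  proof -
    obtain F where F: "F \<subseteq> {..<m}" "T = subgraph F" using all[OF T] by blast
    then have "pg.feas F" using feas T by simp
    then show ?thesis using opt cost[OF F(1)] cost[OF sub[OF f]] F(2) by simp
  qed
  then show "min_cost_feasible_tree G c U \<alpha> \<beta> (output_graph vs es s')"
    using feas[OF sub[OF f]] f by (simp add: min_cost_feasible_tree_def out)
qed

theorem theorem2:
  shows "\<exists>(prog :: com) (bound :: nat poly).
    \<forall>(G :: nat ugraph) (c :: nat set \<Rightarrow> real) (U :: nat set) (\<alpha> :: nat \<Rightarrow> nat) (\<beta> :: nat \<Rightarrow> nat) vs es.
      simple_graph G \<and> stable_set G U \<and> presents vs es G \<longrightarrow>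
      (\<exists>t s'. exec prog (input_state vs es c U \<alpha> \<beta>) t s' \<and>
         t \<le> poly bound (input_size G U \<alpha> \<beta>) \<and>
         (answers_yes s' \<longleftrightarrow> (\<exists>T. feasible_tree G U \<alpha> \<beta> T)) \<and>
         (answers_yes s' \<longrightarrow> min_cost_feasible_tree G c U \<alpha> \<beta> (output_graph vs es s')))"
proof (rule exI[of _ "compile (setup_prog ;; tree_prog)"],
    rule exI[of _ "pcompose (time setup_prog + time tree_prog) [:3, 3:]"], intro allI impI, elim conjE)
  fix G :: "nat ugraph" and c :: "nat set \<Rightarrow> real" and U :: "nat set" and \<alpha> \<beta> :: "nat \<Rightarrow> nat"
    and vs :: "nat list" and es :: "(nat \<times> nat) list"
  assume G: "simple_graph G" "presents vs es G" and U: "stable_set G U"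
  let ?s0 = "input_state vs es c U \<alpha> \<beta>"
  let ?s1 = "den setup_prog ?s0"
  let ?s' = "den tree_prog ?s1"
  let ?size = "input_size G U \<alpha> \<beta>"
  \<comment> \<open>A common bound on the loop limits, the critical one being
    \<open>2 * n + 3\<close>. The degree bounds \<alpha> and \<beta> do not influence the number of
    rounds of any loop.\<close>
  let ?N = "3 + 3 * ?size"
  have "length vs = card (uverts G)" using G(2) distinct_card[of vs] by (simp add: presents_def)
  moreover have "length es = card (uedges G)"
    using G(2) distinct_card[of "map (edge_at vs) es"] by (simp add: presents_def)
  ultimately have size: "length vs + length es \<le> ?size" by (simp add: input_size_def)
  have "counters_ok setup_prog" "limits setup_prog = {}" by (simp_all add: setup_prog_def)
  then obtain t1 where t1: "t1 \<le> poly (time setup_prog) ?N" "exec (compile setup_prog) ?s0 t1 ?s1"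
    using exec_compile[of setup_prog ?s0 ?N] by auto
  have lim: "fst ?s1 u 0 \<le> ?N" if "u \<in> limits tree_prog" for u
  proof -
    have "u \<in> {''n'', ''m'', ''n1'', ''m1'', ''n3''}" using that limits_tree_prog by blast
    then show ?thesis using size by (auto simp: setup_prog_def input_state_def cells_def)
  qed
  have "limits tree_prog \<inter> nwr tree_prog = {}" using limits_tree_prog nwr_tree_prog by blast
  then obtain t2 where t2: "t2 \<le> poly (time tree_prog) ?N" "exec (compile tree_prog) ?s1 t2 ?s'"
    using exec_compile[OF counters_ok_tree_prog _ lim] by blast
  have "exec (compile (setup_prog ;; tree_prog)) ?s0 (t1 + t2) ?s'"
    using exec.Seq[OF t1(2) t2(2)] by simp
  moreover have "t1 + t2 \<le> poly (pcompose (time setup_prog + time tree_prog) [:3, 3:]) ?size"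
    using t1(1) t2(1) by (simp add: poly_pcompose mult.commute)
  ultimately show "\<exists>t s'. exec (compile (setup_prog ;; tree_prog)) ?s0 t s' \<and>
      t \<le> poly (pcompose (time setup_prog + time tree_prog) [:3, 3:]) ?size \<and>
      (answers_yes s' \<longleftrightarrow> (\<exists>T. feasible_tree G U \<alpha> \<beta> T)) \<and>
      (answers_yes s' \<longrightarrow> min_cost_feasible_tree G c U \<alpha> \<beta> (output_graph vs es s'))"
    using tree_prog_correct[OF G U] by blast
qed

end
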